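(* Let $n\ge 3$. Assume that $M$ is a properly embedded (connected) minimal hypersurface in $\mathbb{R}^n$ such that for some $\epsilon>0$ every point in the $\epsilon$-neighbourhood $\{x\in\mathbb{R}^n:\mathrm{dist}(x,M)<\epsilon\}$ of $M$ has a unique nearest point in $M$. Then every immersed parabolic minimal hypersurface $R\to\mathbb{R}^n$ intersects $M$, unless $n=3$, $M$ is a plane in $\mathbb{R}^3$, and the image of $R$ is contained in a plane parallel to $M$.
   Context: A minimal hypersurface in $\mathbb{R}^n$ is an $(n-1)$-dimensional submanifold without boundary (embedded or immersed, as indicated) with vanishing mean curvature. The hypersurface $M$ is properly embedded, i.e., it is an embedded hypersurface which is a closed subset of $\mathbb{R}^n$. The immersed hypersurface $R\to\mathbb{R}^n$ is connected and is not assumed to be complete or proper; it intersects $M$ if its image in $\mathbb{R}^n$ meets $M$. A connected Riemannian manifold $(R,g)$ of dimension $\ge 2$ is parabolic if every negative subharmonic function on $R$ is constant. A connected manifold immersed into $\mathbb{R}^n$ is parabolic if it is parabolic in the Riemannian metric induced from the Euclidean metric by the immersion. *)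

theory Defs
  imports "HOL-Analysis.Analysis"
begin

section \<open>Differentiability of higher order\<close>

text \<open>\<^term>\<open>U\<close> is meant to be an open set. A map is of class $C^{k+1}$ on it if it is differentiable
  there and all its directional derivatives are of class $C^k$.\<close>

primrec Ck_on ::
  "nat \<Rightarrow> 'a::real_normed_vector set \<Rightarrow> ('a \<Rightarrow> 'b::real_normed_vector) \<Rightarrow> bool" where
  "Ck_on 0 U f \<longleftrightarrow> continuous_on U f"
| "Ck_on (Suc k) U f \<longleftrightarrow>
     (\<forall>x\<in>U. f differentiable (at x)) \<and> (\<forall>v. Ck_on k U (\<lambda>x. frechet_derivative f (at x) v))"

definition smooth_on ::
  "'a::real_normed_vector set \<Rightarrow> ('a \<Rightarrow> 'b::real_normed_vector) \<Rightarrow> bool" where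
  "smooth_on U f \<longleftrightarrow> (\<forall>k. Ck_on k U f)"

definition partial :: "'m::finite \<Rightarrow> (real^'m \<Rightarrow> 'b::real_normed_vector) \<Rightarrow> real^'m \<Rightarrow> 'b" where
  "partial i f y = frechet_derivative f (at y) (axis i 1)"


section \<open>Smooth manifolds\<close>

text \<open>A chart is a pair of its domain and the coordinate map; the values of the coordinate map
  outside the domain are irrelevant. The dimension of the manifold is \<open>CARD('m)\<close>.\<close>

type_synonym ('r, 'm) chart = "'r set \<times> ('r \<Rightarrow> real^'m)"

definition chart_image :: "('r, 'm::finite) chart \<Rightarrow> (real^'m) set" where
  "chart_image c = snd c ` fst c"

definition chart_inv :: "('r, 'm::finite) chart \<Rightarrow> real^'m \<Rightarrow> 'r" where
  "chart_inv c = inv_into (fst c) (snd c)"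

definition smooth_manifold :: "'r topology \<Rightarrow> ('r, 'm::finite) chart set \<Rightarrow> bool" where
  "smooth_manifold T A \<longleftrightarrow>
     Hausdorff_space T \<and> second_countable T \<and>
     (\<forall>c\<in>A. openin T (fst c) \<and> open (chart_image c) \<and>
        homeomorphic_map (subtopology T (fst c)) (top_of_set (chart_image c)) (snd c)) \<and>
     (\<Union>c\<in>A. fst c) = topspace T \<and>
     (\<forall>c\<in>A. \<forall>d\<in>A. smooth_on (snd c ` (fst c \<inter> fst d)) (snd d \<circ> chart_inv c))"


section \<open>Subharmonic functions and parabolicity of Riemannian manifolds\<close>

text \<open>A Riemannian metric is given by its coefficient matrices \<open>(g\<^sub>i\<^sub>j)\<close> in the charts:
  \<open>g c y\<close> is the matrix at the point with coordinates \<open>y\<close> in the chart \<open>c\<close>.\<close>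

type_synonym ('r, 'm) metric_coeffs = "('r, 'm) chart \<Rightarrow> real^'m \<Rightarrow> real^'m^'m"

text \<open>The Laplace--Beltrami operator in local coordinates,
  $\Delta u = \frac{1}{\sqrt{\det g}} \sum_i \partial_i \bigl(\sqrt{\det g} \sum_j g^{ij} \partial_j u\bigr)$.\<close>

definition laplace_beltrami ::
  "(real^'m \<Rightarrow> real^'m^'m) \<Rightarrow> (real^'m::finite \<Rightarrow> real) \<Rightarrow> real^'m \<Rightarrow> real" where
  "laplace_beltrami G u y =
     (\<Sum>i\<in>UNIV. partial i
        (\<lambda>z. sqrt (det (G z)) * (\<Sum>j\<in>UNIV. matrix_inv (G z) $ i $ j * partial j u z)) y)
     / sqrt (det (G y))"

definition harmonic_on ::
  "('r, 'm::finite) chart set \<Rightarrow> ('r, 'm) metric_coeffs \<Rightarrow> 'r set \<Rightarrow> ('r \<Rightarrow> real) \<Rightarrow> bool" where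
  "harmonic_on A g U h \<longleftrightarrow>
     (\<forall>c\<in>A. Ck_on 2 (snd c ` (fst c \<inter> U)) (h \<circ> chart_inv c) \<and>
        (\<forall>y \<in> snd c ` (fst c \<inter> U). laplace_beltrami (g c) (h \<circ> chart_inv c) y = 0))"

text \<open>Subharmonic functions in the sense of F. Riesz: upper semicontinuous functions with values
  in $[-\infty,\infty)$ that on every relatively compact domain \<open>U\<close> lie below each harmonic function
  (continuous up to the boundary) dominating them on the boundary. The boundary is required to be
  nonempty because on a compact manifold the whole manifold would be a domain with empty boundary,
  on which the boundary condition is vacuous.\<close>

definition subharmonic ::
  "'r topology \<Rightarrow> ('r, 'm::finite) chart set \<Rightarrow> ('r, 'm) metric_coeffs \<Rightarrow> ('r \<Rightarrow> ereal) \<Rightarrow> bool" where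
  "subharmonic T A g u \<longleftrightarrow>
     (\<forall>x\<in>topspace T. u x < \<infinity>) \<and>
     (\<forall>a. openin T {x \<in> topspace T. u x < a}) \<and>
     (\<forall>U h. openin T U \<and> connectedin T U \<and> compactin T (T closure_of U) \<and>
        T frontier_of U \<noteq> {} \<and>
        continuous_map (subtopology T (T closure_of U)) euclideanreal h \<and>
        harmonic_on A g U h \<and>
        (\<forall>x \<in> T frontier_of U. u x \<le> ereal (h x))
        \<longrightarrow> (\<forall>x\<in>U. u x \<le> ereal (h x)))"

text \<open>To be used for connected Riemannian manifolds of dimension at least 2.\<close>

definition parabolic ::
  "'r topology \<Rightarrow> ('r, 'm::finite) chart set \<Rightarrow> ('r, 'm) metric_coeffs \<Rightarrow> bool" where
  "parabolic T A g \<longleftrightarrow>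
     (\<forall>u. subharmonic T A g u \<and> (\<forall>x\<in>topspace T. u x < 0) \<longrightarrow>
        (\<exists>a. \<forall>x\<in>topspace T. u x = a))"


section \<open>Immersed minimal hypersurfaces\<close>

definition immersion ::
  "('r, 'm::finite) chart set \<Rightarrow> ('r \<Rightarrow> real^'n) \<Rightarrow> bool" where
  "immersion A F \<longleftrightarrow>
     (\<forall>c\<in>A. smooth_on (chart_image c) (F \<circ> chart_inv c) \<and>
        (\<forall>y\<in>chart_image c. inj (frechet_derivative (F \<circ> chart_inv c) (at y))))"

definition first_fundamental_form ::
  "(real^'m::finite \<Rightarrow> real^'n) \<Rightarrow> real^'m \<Rightarrow> real^'m^'m" where
  "first_fundamental_form X y = (\<chi> i j. partial i X y \<bullet> partial j X y)"

definition induced_metric ::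
  "('r \<Rightarrow> real^'n) \<Rightarrow> ('r, 'm::finite) metric_coeffs" where
  "induced_metric F c = first_fundamental_form (F \<circ> chart_inv c)"

text \<open>The mean curvature of the parametrized hypersurface \<open>X\<close> with respect to a unit normal
  vector \<open>\<nu>\<close>: the normalized trace $\frac1m \sum_{i,j} g^{ij} b_{ij}$ of the second fundamental form
  $b_{ij} = \partial_i \partial_j X \cdot \nu$.\<close>

definition unit_normal :: "(real^'m::finite \<Rightarrow> real^'n) \<Rightarrow> real^'m \<Rightarrow> real^'n \<Rightarrow> bool" where
  "unit_normal X y \<nu> \<longleftrightarrow> norm \<nu> = 1 \<and> (\<forall>i. partial i X y \<bullet> \<nu> = 0)"

definition mean_curvature :: "(real^'m::finite \<Rightarrow> real^'n) \<Rightarrow> real^'m \<Rightarrow> real^'n \<Rightarrow> real" where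
  "mean_curvature X y \<nu> =
     (\<Sum>i\<in>UNIV. \<Sum>j\<in>UNIV. matrix_inv (first_fundamental_form X y) $ i $ j
        * (partial i (partial j X) y \<bullet> \<nu>)) / real CARD('m)"

definition immersed_minimal_hypersurface ::
  "'r topology \<Rightarrow> ('r, 'm::finite) chart set \<Rightarrow> ('r \<Rightarrow> real^'n) \<Rightarrow> bool" where
  "immersed_minimal_hypersurface T A F \<longleftrightarrow>
     CARD('n) = CARD('m) + 1 \<and> topspace T \<noteq> {} \<and> smooth_manifold T A \<and> immersion A F \<and>
     (\<forall>c\<in>A. \<forall>y\<in>chart_image c. \<forall>\<nu>. unit_normal (F \<circ> chart_inv c) y \<nu> \<longrightarrow>
        mean_curvature (F \<circ> chart_inv c) y \<nu> = 0)"

text \<open>A subset \<open>M\<close> of $\mathbb{R}^n$ is an embedded hypersurface if, with the subspace topology, it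
  carries a smooth structure (the atlas \<open>A\<close>) for which the inclusion map is an immersion. It is
  properly embedded if it is moreover closed.\<close>

definition properly_embedded_minimal_hypersurface ::
  "(real^'n) set \<Rightarrow> (real^'n, 'm::finite) chart set \<Rightarrow> bool" where
  "properly_embedded_minimal_hypersurface M A \<longleftrightarrow>
     closed M \<and> immersed_minimal_hypersurface (top_of_set M) A (\<lambda>x. x)"

end

theory Submission
  imports Defs
begin

text \<open>Suppose that $F(R)$ misses $M$. The idea is to build from the distance $\delta$ to $M$ a bounded
  subharmonic function on $R$ and to let parabolicity make it constant.

  Let $x$ have distance $t\in(0,\epsilon)$ to $M$, with nearest point $p$ and $\nu=(x-p)/t$. Because nearest points
  are unique in the whole $\epsilon$-neighbourhood, the segment from $p$ in the direction $\nu$ stays normal up to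
  length $\epsilon$ (\<open>normal_segment_full_length\<close>, an application of Brouwer's fixed point theorem), so the balls
  of radius $s<\epsilon$ touching $M$ at $p$ from the side of $x$ do not meet $M$, and the second fundamental form $B$
  of $M$ at $p$ with respect to $\nu$ satisfies $B\le 1/\epsilon$. Measuring the distance to points of $M$ straight
  in the direction of $\nu$ shows that near $x$, up to a small multiple of $|\xi|^2$, one has
  $\delta(x+\xi)\le t+\nu\cdot\xi-\frac12 B(\xi,\xi)$, where $\operatorname{tr}B=0$ by
  minimality (\<open>distance_subjet\<close>). For a hyperplane with unit normal $n$ the trace of the right hand Hessian
  is $B(n,n)\le(1-(n\cdot\nu)^2)/\epsilon$, which is controlled by the squared length of the tangential gradient
  of $\delta$. Hence $(\max(0,\epsilon-\delta))^2$ is subharmonic along every minimal hypersurface disjoint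
  from $M$ (\<open>subjet_squared_depth\<close>). The estimates for
  $\delta$ are one-sided, and the maximum principle is applied to quadratic polynomials touching from below
  (\<open>subharmonic_if_subjets\<close>); for these the Laplacian on $R$ is the trace over the tangent space since the
  coordinate functions of a minimal hypersurface are harmonic (\<open>minimal_coordinates_harmonic\<close>).

  By parabolicity, $\delta(F-v)$ is constant for every translation vector $v$ such that $F(R)-v$ misses $M$ but comes
  closer to it than $\epsilon$ (\<open>distance_constant\<close>). If $F(R)$ is far from $M$, translate it towards $M$ until it is
  that close; so some translate $F(R)-v$ has a constant distance $t\in(0,\epsilon)$ from $M$. The same then holds for all
  small changes of $v$, and comparing the constants shows that the direction $\nu$ to the nearest point is the same for
  all points of $R$ (\<open>common_nearest_direction\<close>). So $F$ is tangent to $\nu^\perp$, $F(R)$ lies in a hyperplane $P$, and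
  $F(R)-v-t\nu\subseteq M$.

  It remains to use parabolicity inside $P$. If $\dim P\ge3$, the bounded nonconstant subharmonic function
  $-(1+|x|^2)^{-1/2}$ of Euclidean space gives a contradiction; if $\dim P=2$, the function $-\log|x-b|$ shows that
  $F(R)$ is dense in $P$. Then $M$ contains the plane $P-v-t\nu$, which is open in $M$ by invariance of domain
  and closed, and hence equals $M$.\<close>

section \<open>Normal segments in a neighbourhood with unique nearest points\<close>

definition unique_nearest_points :: "'a::metric_space set \<Rightarrow> real \<Rightarrow> bool" where
  "unique_nearest_points M \<epsilon> \<longleftrightarrow>
     (\<forall>x. infdist x M < \<epsilon> \<longrightarrow> (\<exists>!p. p \<in> M \<and> dist x p = infdist x M))"

text \<open>The distance is 1-Lipschitz, so a point reached from $p$ by going the way $t$ at full speed has been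
  reached at full speed all along.\<close>

lemma nearest_point_on_segment:
  fixes p \<nu> :: "'a::real_normed_vector"
  assumes "p \<in> M" "norm \<nu> = 1" "0 \<le> s" "s \<le> t" "infdist (p + t *\<^sub>R \<nu>) M = t"
  shows "infdist (p + s *\<^sub>R \<nu>) M = s"
proof (rule antisym)
  show "infdist (p + s *\<^sub>R \<nu>) M \<le> s"
    using infdist_le[OF assms(1), of "p + s *\<^sub>R \<nu>"] assms by (simp add: dist_norm)
  have "infdist (p + t *\<^sub>R \<nu>) M \<le> infdist (p + s *\<^sub>R \<nu>) M + dist (p + t *\<^sub>R \<nu>) (p + s *\<^sub>R \<nu>)"
    by (rule infdist_triangle)
  also have "dist (p + t *\<^sub>R \<nu>) (p + s *\<^sub>R \<nu>) = norm ((t - s) *\<^sub>R \<nu>)"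
    by (simp add: dist_norm algebra_simps)
  finally show "s \<le> infdist (p + s *\<^sub>R \<nu>) M"
    using assms by simp
qed

text \<open>A map into a compact set is continuous if its graph is closed. Uniqueness describes the graph of the nearest
  point map by a closed condition.\<close>

lemma nearest_point_continuous:
  fixes M :: "'a::euclidean_space set"
  assumes M: "closed M" "M \<noteq> {}"
    and \<pi>: "\<And>y. y \<in> cball x r \<Longrightarrow> \<pi> y \<in> M \<and> dist y (\<pi> y) = infdist y M"
    and uniq: "\<And>y q. \<lbrakk>y \<in> cball x r; q \<in> M; dist y q = infdist y M\<rbrakk> \<Longrightarrow> q = \<pi> y"
  shows "continuous_on (cball x r) \<pi>"
proof -
  \<comment> \<open>Large enough to contain the nearest points of all points of the ball.\<close>
  define T where "T = M \<inter> cball x (r + (infdist x M + r))"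
  have "compact T"
    unfolding T_def using M by (simp add: closed_Int_compact)
  moreover have im: "\<pi> \<in> cball x r \<rightarrow> T"
  proof
    fix y assume y: "y \<in> cball x r"
    have "infdist y M \<le> infdist x M + dist y x" by (rule infdist_triangle)
    moreover have "dist x (\<pi> y) \<le> dist x y + dist y (\<pi> y)" by (rule dist_triangle)
    ultimately show "\<pi> y \<in> T"
      using \<pi>[OF y] y by (auto simp: T_def dist_commute)
  qed
  moreover have "closed ((\<lambda>y. Pair y (\<pi> y)) ` cball x r)"
  proof -
    have "(\<lambda>y. Pair y (\<pi> y)) ` cball x r
        = (cball x r \<times> T) \<inter> {z. dist (fst z) (snd z) = infdist (fst z) M}"
      using im \<pi> uniq by (auto simp: T_def)
    moreover have "closed {z :: 'a \<times> 'a. dist (fst z) (snd z) = infdist (fst z) M}"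
      by (intro closed_Collect_eq continuous_intros)
    ultimately show ?thesis
      using \<open>compact T\<close> by (simp add: closed_Int closed_Times compact_imp_closed)
  qed
  ultimately show ?thesis
    by (rule continuous_from_closed_graph)
qed

text \<open>With $\pi(y)$ the nearest point of $y$, the map that sends $y$ to the point at distance $s$ from $x$ in the
  direction $y-\pi(y)$ preserves the ball of radius $s$ about $x$ and so has a fixed point $y$. Then $x$ lies on the
  segment from $y$ to $\pi(y)$; hence $\pi(y)$ is the nearest point of $x$ as well, and $y$ extends the segment
  from $p$ to $x$ by the length $s$.\<close>

lemma normal_segment_extends:
  fixes M :: "'a::euclidean_space set"
  assumes M: "closed M" "M \<noteq> {}" and un: "unique_nearest_points M \<epsilon>"
    and p: "p \<in> M" "norm \<nu> = 1" and t: "0 < t" "infdist (p + t *\<^sub>R \<nu>) M = t"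
    and s: "0 < s" "2 * s \<le> t" "t + s < \<epsilon>"
  shows "infdist (p + (t + s) *\<^sub>R \<nu>) M = t + s"
proof -
  define x where "x = p + t *\<^sub>R \<nu>"
  have dx: "infdist x M = t" using t by (simp add: x_def)
  have near: "infdist y M < \<epsilon>" "infdist y M \<ge> s" if "y \<in> cball x s" for y
  proof -
    have "infdist y M \<le> infdist x M + dist y x" "infdist x M \<le> infdist y M + dist x y"
      by (rule infdist_triangle)+
    then show "infdist y M < \<epsilon>" "infdist y M \<ge> s"
      using that s dx by (auto simp: dist_commute)
  qed
  define \<pi> where "\<pi> y = (THE p. p \<in> M \<and> dist y p = infdist y M)" for y
  have ex1: "\<exists>!p. p \<in> M \<and> dist y p = infdist y M" if "y \<in> cball x s" for y
    using un near(1)[OF that] unfolding unique_nearest_points_def by simp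
  have \<pi>: "\<pi> y \<in> M \<and> dist y (\<pi> y) = infdist y M" if "y \<in> cball x s" for y
    unfolding \<pi>_def by (rule theI'[OF ex1[OF that]])
  have uniq: "q = \<pi> y" if "y \<in> cball x s" "q \<in> M" "dist y q = infdist y M" for y q
    using ex1[OF that(1)] \<pi>[OF that(1)] that(2,3) by blast
  have cont: "continuous_on (cball x s) \<pi>"
    by (rule nearest_point_continuous[OF M \<pi> uniq])
  define g where "g y = x + (s / infdist y M) *\<^sub>R (y - \<pi> y)" for y
  have pos: "infdist y M > 0" if "y \<in> cball x s" for y
    using near(2)[OF that] s by linarith
  have "continuous_on (cball x s) g"
    unfolding g_def by (intro continuous_intros cont ballI) (metis pos less_irrefl)
  moreover have "g \<in> cball x s \<rightarrow> cball x s"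
  proof
    fix y assume y: "y \<in> cball x s"
    have "norm (y - \<pi> y) = infdist y M"
      using \<pi>[OF y] by (simp add: dist_norm)
    then show "g y \<in> cball x s"
      using pos[OF y] s by (simp add: g_def dist_norm)
  qed
  ultimately obtain y where y: "y \<in> cball x s" "g y = y"
    using brouwer_ball[OF s(1), of x g] by blast
  define q where "q = \<pi> y"
  define k where "k = infdist y M"
  \<comment> \<open>The unit vector at the fixed point; it turns out to be \<open>\<nu>\<close>.\<close>
  define w where "w = (1 / k) *\<^sub>R (y - q)"
  have q: "q \<in> M" "dist y q = k"
    using \<pi>[OF y(1)] by (auto simp: q_def k_def)
  have k: "k \<ge> s" "k > 0"
    using near(2)[OF y(1)] pos[OF y(1)] unfolding k_def by blast+
  have w: "norm w = 1" using k q by (simp add: w_def dist_norm)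
  have y1: "y = q + k *\<^sub>R w" using k by (simp add: w_def)
  have "x + s *\<^sub>R w = g y" by (simp add: g_def w_def k_def q_def)
  then have xy: "y = x + s *\<^sub>R w" using y(2) by simp
  have x1: "x = q + (k - s) *\<^sub>R w" using y1 xy by (simp add: algebra_simps)
  have "infdist (q + k *\<^sub>R w) M = k" using y1 k_def by simp
  then have "infdist (q + (k - s) *\<^sub>R w) M = k - s"
    using nearest_point_on_segment[OF q(1) w, of "k - s" k] k s by simp
  then have ks: "k - s = t" using x1 dx by simp
  have "dist x q = t" using w ks t by (simp add: x1 dist_norm)
  then have "q = \<pi> x"
    using uniq[of x q] q dx s by simp
  also have "\<pi> x = p"
    using uniq[of x p] dx p s t by (simp add: x_def dist_norm)
  finally have "q = p" .
  then have "t *\<^sub>R w = t *\<^sub>R \<nu>" using x1 ks \<open>q = p\<close> unfolding x_def by auto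
  then have "w = \<nu>" using t by simp
  have "k = t + s" using ks by simp
  then show ?thesis
    using \<open>infdist (q + k *\<^sub>R w) M = k\<close> \<open>q = p\<close> \<open>w = \<nu>\<close> by simp
qed

text \<open>The lengths for which the assertion holds form a closed set, and by \<open>normal_segment_extends\<close> its
  supremum cannot be smaller than $s$.\<close>

lemma normal_segment_full_length:
  fixes M :: "'a::euclidean_space set"
  assumes M: "closed M" "M \<noteq> {}" and un: "unique_nearest_points M \<epsilon>"
    and p: "p \<in> M" "norm \<nu> = 1" and t: "0 < t" "infdist (p + t *\<^sub>R \<nu>) M = t"
    and s: "0 \<le> s" "s < \<epsilon>"
  shows "infdist (p + s *\<^sub>R \<nu>) M = s"
proof (cases "s \<le> t")
  case True
  then show ?thesis using nearest_point_on_segment[OF p s(1) _ t(2)] by simp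
next
  case False
  define S where "S = {u. t \<le> u \<and> u \<le> s \<and> infdist (p + u *\<^sub>R \<nu>) M = u}"
  have "S = {t..s} \<inter> {u. infdist (p + u *\<^sub>R \<nu>) M = u}"
    by (auto simp: S_def)
  moreover have "closed {u. infdist (p + u *\<^sub>R \<nu>) M = u}"
    by (intro closed_Collect_eq continuous_intros)
  ultimately have "closed S" by (simp add: closed_Int)
  moreover have "t \<in> S" using False t by (simp add: S_def)
  moreover have bdd: "bdd_above S" by (rule bdd_aboveI[of _ s]) (simp add: S_def)
  ultimately have m: "Sup S \<in> S"
    using closed_contains_Sup by blast
  define \<tau> where "\<tau> = Sup S"
  have \<tau>: "t \<le> \<tau>" "\<tau> \<le> s" "infdist (p + \<tau> *\<^sub>R \<nu>) M = \<tau>"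
    using m by (auto simp: S_def \<tau>_def)
  have "\<tau> = s"
  proof (rule ccontr)
    assume "\<tau> \<noteq> s"
    define h where "h = min (\<tau> / 2) (s - \<tau>)"
    have h: "0 < h" "2 * h \<le> \<tau>" "\<tau> + h \<le> s"
      using \<open>\<tau> \<noteq> s\<close> \<tau> t by (auto simp: h_def min_def)
    have "\<tau> + h \<in> S"
      using normal_segment_extends[OF M un p _ \<tau>(3), of h] h \<tau> t s by (simp add: S_def)
    then have "\<tau> + h \<le> \<tau>"
      unfolding \<tau>_def using bdd by (rule cSup_upper)
    then show False using h by simp
  qed
  then show ?thesis using \<tau>(3) by simp
qed

section \<open>Orthonormal frames of hyperplanes\<close>

definition orthonormal_frame :: "('i \<Rightarrow> 'a::real_inner) \<Rightarrow> bool" where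
  "orthonormal_frame \<sigma> \<longleftrightarrow> (\<forall>i j. \<sigma> i \<bullet> \<sigma> j = (if i = j then 1 else 0))"

lemma orthonormal_frame_inj: "orthonormal_frame \<sigma> \<Longrightarrow> inj \<sigma>"
  unfolding orthonormal_frame_def inj_def by (metis zero_neq_one)

text \<open>The frame and the normal are $m+1$ orthonormal vectors in a space of that dimension, hence a basis.\<close>

lemma frame_and_normal_expand:
  fixes \<sigma> :: "'m::finite \<Rightarrow> real^'n"
  assumes card: "CARD('n) = CARD('m) + 1" and \<sigma>: "orthonormal_frame \<sigma>"
    and n: "norm n = 1" "\<And>i. \<sigma> i \<bullet> n = 0"
  shows "(\<Sum>i\<in>UNIV. (x \<bullet> \<sigma> i) *\<^sub>R \<sigma> i) + (x \<bullet> n) *\<^sub>R n = x"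
proof -
  define B where "B = insert n (range \<sigma>)"
  have [simp]: "\<sigma> i \<bullet> \<sigma> j = (if i = j then 1 else 0)" for i j
    using \<sigma> by (simp add: orthonormal_frame_def)
  have [simp]: "n \<bullet> n = 1" using n by (simp add: norm_eq_1)
  have notin: "n \<notin> range \<sigma>"
    using n \<open>n \<bullet> n = 1\<close> by (metis imageE zero_neq_one)
  have inj: "inj \<sigma>" using \<sigma> by (rule orthonormal_frame_inj)
  have orth: "pairwise orthogonal B"
    unfolding B_def pairwise_def orthogonal_def using n by (auto simp: inner_commute)
  have norm: "norm v = 1" if "v \<in> B" for v
    using that n unfolding B_def by (auto simp: norm_eq_1)
  have ind: "independent B"
    by (rule pairwise_orthogonal_independent[OF orth]) (use norm in fastforce)
  have fin: "finite B" by (simp add: B_def)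
  have "card B = DIM(real^'n)"
    using notin card card_image[OF inj] by (simp add: B_def)
  then have "span B = UNIV"
    using card_ge_dim_independent[OF subset_UNIV ind] by auto
  then have "(\<Sum>v\<in>B. (x \<bullet> v) *\<^sub>R v) = x"
    by (intro orthonormal_basis_expand[OF orth norm _ fin]) auto
  then show ?thesis
    using notin sum.reindex[OF inj, of "\<lambda>v. (x \<bullet> v) *\<^sub>R v"] by (simp add: B_def add.commute)
qed

lemma frame_and_normal_Parseval:
  fixes \<sigma> :: "'m::finite \<Rightarrow> real^'n"
  assumes "CARD('n) = CARD('m) + 1" "orthonormal_frame \<sigma>" "norm n = 1" "\<And>i. \<sigma> i \<bullet> n = 0"
  shows "(\<Sum>i\<in>UNIV. (x \<bullet> \<sigma> i) * (\<sigma> i \<bullet> y)) + (x \<bullet> n) * (n \<bullet> y) = x \<bullet> y"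
proof -
  have "((\<Sum>i\<in>UNIV. (x \<bullet> \<sigma> i) *\<^sub>R \<sigma> i) + (x \<bullet> n) *\<^sub>R n) \<bullet> y = x \<bullet> y"
    by (simp only: frame_and_normal_expand[OF assms])
  then show ?thesis by (simp add: inner_sum_left inner_add_left)
qed

text \<open>The trace of a quadratic form over a hyperplane, expressed without reference to a basis of it.\<close>

lemma trace_along_frame:
  fixes \<sigma> :: "'m::finite \<Rightarrow> real^'n" and H :: "real^'n^'n"
  assumes "CARD('n) = CARD('m) + 1" "orthonormal_frame \<sigma>" "norm n = 1" "\<And>i. \<sigma> i \<bullet> n = 0"
  shows "(\<Sum>i\<in>UNIV. \<sigma> i \<bullet> (H *v \<sigma> i)) = trace H - n \<bullet> (H *v n)"
proof -
  have ax: "v \<bullet> (H *v v) = (\<Sum>k\<in>UNIV. (v \<bullet> (H *v axis k 1)) * (v \<bullet> axis k 1))" for v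
  proof -
    have "H *v v = (\<Sum>k\<in>UNIV. (v $ k) *\<^sub>R (H *v axis k 1))"
      by (simp add: matrix_vector_mult_def vec_eq_iff axis_def if_distrib cong: if_cong) (simp add: mult.commute)
    then show ?thesis by (simp add: inner_sum_right inner_axis mult.commute)
  qed
  have "(\<Sum>i\<in>UNIV. \<sigma> i \<bullet> (H *v \<sigma> i)) + n \<bullet> (H *v n)
      = (\<Sum>k\<in>UNIV. (\<Sum>i\<in>UNIV. (axis k 1 \<bullet> \<sigma> i) * (\<sigma> i \<bullet> (H *v axis k 1))) + (axis k 1 \<bullet> n) * (n \<bullet> (H *v axis k 1)))"
    unfolding ax[of "\<sigma> _"] ax[of n] sum.distrib
    by (subst sum.swap) (simp add: inner_commute mult.commute)
  also have "\<dots> = (\<Sum>k\<in>UNIV. axis k 1 \<bullet> (H *v axis k 1))"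
    by (simp only: frame_and_normal_Parseval[OF assms])
  also have "\<dots> = trace H"
    by (simp add: trace_def inner_axis' matrix_vector_mult_basis column_def)
  finally show ?thesis by simp
qed

lemma exists_unit_normal:
  fixes D :: "real^'m::finite \<Rightarrow> real^'n"
  assumes "linear D" "CARD('n) = CARD('m) + 1"
  obtains n where "norm n = 1" "\<And>v. D v \<bullet> n = 0"
proof -
  have "dim (range D) \<le> CARD('m)"
    using dim_image_le[OF assms(1), of UNIV] by simp
  then have "dim (range D) < DIM(real^'n)" using assms(2) by simp
  then obtain x where x: "x \<noteq> 0" "\<And>y. y \<in> span (range D) \<Longrightarrow> orthogonal x y"
    by (rule orthogonal_to_subspace_exists) auto
  show ?thesis
  proof
    show "norm (x /\<^sub>R norm x) = 1" using x by simp
    show "D v \<bullet> (x /\<^sub>R norm x) = 0" for v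
      using x(2)[of "D v"] by (simp add: span_base orthogonal_def inner_commute)
  qed
qed

lemma matrix_inv_mult:
  fixes G :: "real^'m^'m"
  assumes "invertible G"
  shows "matrix_inv G ** G = mat 1" "G ** matrix_inv G = mat 1"
  using someI_ex[OF assms[unfolded invertible_def]] unfolding matrix_inv_def by auto

text \<open>Pull back an orthonormal basis of the image of $D$ to vectors $E_k$. If $\mathcal E$ is the matrix with these
  columns, then $\mathcal E^T G\mathcal E=1$, so that $G^{-1}=\mathcal E\mathcal E^T$. In this form a contraction with $g^{ij}$ becomes a
  sum over an orthonormal frame of the tangent space.\<close>

lemma exists_orthonormalizing_frame:
  fixes D :: "real^'m::finite \<Rightarrow> real^'n"
  assumes lin: "linear D" and inj: "inj D"
  defines "G \<equiv> (\<chi> i j. D (axis i 1) \<bullet> D (axis j 1))"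
  obtains E :: "'m \<Rightarrow> real^'m"
    where "orthonormal_frame (\<lambda>k. D (E k))" "det G > 0"
      "\<And>i j. matrix_inv G $ i $ j = (\<Sum>k\<in>UNIV. E k $ i * E k $ j)"
proof -
  have sub: "subspace (range D)" using lin by (simp add: linear_subspace_image)
  obtain B where B: "B \<subseteq> range D" "pairwise orthogonal B" "\<And>x. x \<in> B \<Longrightarrow> norm x = 1"
    "independent B" "card B = dim (range D)"
    using orthonormal_basis_subspace[OF sub] by metis
  have "card B = CARD('m)"
    using B(5) dim_image_eq[OF lin, of UNIV] inj by simp
  then obtain \<sigma> :: "'m \<Rightarrow> real^'n" where \<sigma>: "bij_betw \<sigma> UNIV B"
    using independent_imp_finite[OF B(4)] by (metis bij_betw_iff_card finite)
  define E where "E k = inv D (\<sigma> k)" for k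
  have DE: "D (E k) = \<sigma> k" for k
    unfolding E_def by (rule f_inv_into_f) (use \<sigma> B(1) in \<open>auto simp: bij_betw_def\<close>)
  have on: "orthonormal_frame \<sigma>"
    unfolding orthonormal_frame_def
  proof (intro allI)
    fix i j
    have "\<sigma> i \<in> B" "\<sigma> j \<in> B" "i \<noteq> j \<Longrightarrow> \<sigma> i \<noteq> \<sigma> j"
      using \<sigma> by (auto simp: bij_betw_def inj_def)
    then show "\<sigma> i \<bullet> \<sigma> j = (if i = j then 1 else 0)"
      using B(2,3) by (auto simp: pairwise_def orthogonal_def norm_eq_1)
  qed
  define Em :: "real^'m^'m" where "Em = (\<chi> i k. E k $ i)"
  have DEs: "D (E k) = (\<Sum>i\<in>UNIV. (E k $ i) *\<^sub>R D (axis i 1))" for k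
  proof -
    have "D (E k) = D (\<Sum>i\<in>UNIV. (E k $ i) *\<^sub>R axis i 1)"
      by (simp add: basis_expansion flip: scalar_mult_eq_scaleR)
    also have "\<dots> = (\<Sum>i\<in>UNIV. (E k $ i) *\<^sub>R D (axis i 1))"
      by (simp add: linear_sum[OF lin] linear_cmul[OF lin])
    finally show ?thesis .
  qed
  have id: "transpose Em ** (G ** Em) = mat 1"
  proof -
    have "(transpose Em ** (G ** Em)) $ k $ l = D (E k) \<bullet> D (E l)" for k l
      unfolding DEs
      by (simp add: matrix_matrix_mult_def transpose_def Em_def G_def inner_sum_left inner_sum_right
          sum_distrib_left sum_distrib_right algebra_simps) (rule sum.swap)
    then show ?thesis
      using on DE by (simp add: vec_eq_iff mat_def orthonormal_frame_def)
  qed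
  have "det (transpose Em) * (det G * det Em) = 1"
    using arg_cong[OF id, of det] by (simp add: det_mul)
  then have d: "det G * (det Em)\<^sup>2 = 1"
    by (simp add: power2_eq_square mult_ac)
  then have dG: "det G > 0"
    by (metis zero_less_one zero_less_mult_pos2 zero_less_power2 mult_zero_right power_zero_numeral zero_neq_one)
  have "(G ** Em) ** transpose Em = mat 1"
    using id matrix_left_right_inverse by blast
  then have GE: "G ** (Em ** transpose Em) = mat 1"
    by (simp add: matrix_mul_assoc)
  have "invertible G" using dG by (simp add: invertible_det_nz)
  have "matrix_inv G = matrix_inv G ** (G ** (Em ** transpose Em))"
    by (simp add: GE)
  also have "\<dots> = (matrix_inv G ** G) ** (Em ** transpose Em)"
    by (simp add: matrix_mul_assoc)
  also have "matrix_inv G ** G = mat 1"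
    by (rule matrix_inv_mult(1)[OF \<open>invertible G\<close>])
  finally have "matrix_inv G = Em ** transpose Em" by simp
  then have "matrix_inv G $ i $ j = (\<Sum>k\<in>UNIV. E k $ i * E k $ j)" for i j
    by (simp add: matrix_matrix_mult_def transpose_def Em_def)
  moreover have "orthonormal_frame (\<lambda>k. D (E k))" using on by (simp add: DE)
  ultimately show ?thesis using dG that by blast
qed

section \<open>Second derivatives\<close>

text \<open>Pointwise differentiability of every directional derivative is enough for everything below, and it passes
  through the algebraic operations more easily than continuity of the second derivatives.\<close>

definition twice_differentiable_at :: "('a::real_normed_vector \<Rightarrow> 'b::real_normed_vector) \<Rightarrow> 'a \<Rightarrow> bool" where
  "twice_differentiable_at f x \<longleftrightarrow>
     (\<forall>\<^sub>F z in nhds x. f differentiable (at z)) \<and>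
     (\<forall>v. (\<lambda>z. frechet_derivative f (at z) v) differentiable (at x))"

definition second_derivative :: "('a::real_normed_vector \<Rightarrow> 'b::real_normed_vector) \<Rightarrow> 'a \<Rightarrow> 'a \<Rightarrow> 'a \<Rightarrow> 'b" where
  "second_derivative f x v w = frechet_derivative (\<lambda>z. frechet_derivative f (at z) v) (at x) w"

lemma twice_differentiable_atD:
  assumes "twice_differentiable_at f x"
  shows "f differentiable (at x)" "\<forall>\<^sub>F z in nhds x. f differentiable (at z)"
    "((\<lambda>z. frechet_derivative f (at z) v) has_derivative second_derivative f x v) (at x)"
  using assms eventually_nhds_x_imp_x
  unfolding twice_differentiable_at_def second_derivative_def by (auto simp: frechet_derivative_works)

lemma frechet_derivative_linear: "f differentiable (at z) \<Longrightarrow> linear (frechet_derivative f (at z))"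
  using frechet_derivative_works has_derivative_linear by blast

lemma second_derivative_linear_right:
  "twice_differentiable_at f x \<Longrightarrow> linear (second_derivative f x v)"
  using twice_differentiable_atD(3) has_derivative_linear by blast

text \<open>Near $x$ the derivative $Df(z)$ is linear, so the derivatives at $x$ of both sides of the linearity
  equations agree.\<close>

lemma second_derivative_linear_left:
  assumes f: "twice_differentiable_at f x"
  shows "linear (\<lambda>v. second_derivative f x v w)"
proof (rule linearI)
  have ev: "\<forall>\<^sub>F z in nhds x. linear (frechet_derivative f (at z))"
    using twice_differentiable_atD(2)[OF f] by eventually_elim (rule frechet_derivative_linear)
  have x: "linear (frechet_derivative f (at x))"
    using ev eventually_nhds_x_imp_x by blast
  note D = twice_differentiable_atD(3)[OF f]
  have tr: "((\<lambda>z. frechet_derivative f (at z) u) has_derivative g') (at x)"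
    if "(g has_derivative g') (at x)" "\<And>z. linear (frechet_derivative f (at z)) \<Longrightarrow> g z = frechet_derivative f (at z) u" for g g' u
    by (rule has_derivative_transform_eventually[OF that(1)])
      (use ev that(2) x in \<open>auto simp: eventually_at_filter elim: eventually_mono\<close>)
  fix a b :: 'a and r :: real
  have "((\<lambda>z. frechet_derivative f (at z) (a + b)) has_derivative (\<lambda>w. second_derivative f x a w + second_derivative f x b w)) (at x)"
    by (rule tr[OF has_derivative_add[OF D D]]) (simp add: linear_add)
  then show "second_derivative f x (a + b) w = second_derivative f x a w + second_derivative f x b w"
    using has_derivative_unique[OF D] by (metis (mono_tags))
  have "((\<lambda>z. frechet_derivative f (at z) (r *\<^sub>R a)) has_derivative (\<lambda>w. r *\<^sub>R second_derivative f x a w)) (at x)"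
    by (rule tr[OF has_derivative_scaleR_right[OF D]]) (simp add: linear_cmul)
  then show "second_derivative f x (r *\<^sub>R a) w = r *\<^sub>R second_derivative f x a w"
    using has_derivative_unique[OF D] by (metis (mono_tags))
qed

lemma second_derivative_bilinear:
  "twice_differentiable_at f x \<Longrightarrow> bilinear (second_derivative f x)"
  by (simp add: bilinear_def second_derivative_linear_right second_derivative_linear_left)

text \<open>The estimate for the finitely many basis vectors $v$ extends to all $v$ by linearity, so the neighbourhood can
  be chosen independently of $v$.\<close>

lemma derivative_first_order:
  fixes f :: "'a::euclidean_space \<Rightarrow> 'b::real_normed_vector"
  assumes f: "twice_differentiable_at f x" and e: "e > 0"
  shows "\<forall>\<^sub>F z in nhds x. \<forall>v. norm (frechet_derivative f (at z) v - frechet_derivative f (at x) v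
           - second_derivative f x v (z - x)) \<le> e * norm (z - x) * norm v"
proof -
  define e' where "e' = e / DIM('a)"
  have e': "e' > 0" using e by (simp add: e'_def)
  define R where "R z v = frechet_derivative f (at z) v - frechet_derivative f (at x) v
           - second_derivative f x v (z - x)" for z v
  have "\<forall>\<^sub>F z in nhds x. norm (R z b) \<le> e' * norm (z - x)" for b
    using twice_differentiable_atD(3)[OF f, of b] e'
    unfolding has_derivative_at_alt R_def eventually_nhds_metric dist_norm by blast
  then have "\<forall>\<^sub>F z in nhds x. \<forall>b\<in>Basis. norm (R z b) \<le> e' * norm (z - x)"
    by (simp add: eventually_ball_finite_distrib)
  then show ?thesis
    using twice_differentiable_atD(2)[OF f]
  proof eventually_elim
    case (elim z)
    have linR: "linear (R z)"
      unfolding R_def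
      by (intro linear_compose_sub frechet_derivative_linear second_derivative_linear_left f elim
          twice_differentiable_atD(1)[OF f])
    have "norm (R z v) \<le> e * norm (z - x) * norm v" for v
    proof -
      have "R z v = R z (\<Sum>b\<in>Basis. (v \<bullet> b) *\<^sub>R b)" by (simp add: euclidean_representation)
      also have "\<dots> = (\<Sum>b\<in>Basis. (v \<bullet> b) *\<^sub>R R z b)"
        by (simp add: linear_sum[OF linR] linear_cmul[OF linR])
      also have "norm \<dots> \<le> (\<Sum>b\<in>(Basis::'a set). norm v * (e' * norm (z - x)))"
      proof (rule sum_norm_le)
        fix b :: 'a assume b: "b \<in> Basis"
        show "norm ((v \<bullet> b) *\<^sub>R R z b) \<le> norm v * (e' * norm (z - x))"
          using elim(1) b Basis_le_norm[OF b, of v] by (auto intro!: mult_mono)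
      qed
      also have "\<dots> = e * norm (z - x) * norm v" by (simp add: e'_def)
      finally show ?thesis .
    qed
    then show ?case by (simp add: R_def)
  qed
qed

text \<open>Apply the mean value inequality on the segment from $x$ to $x+h$ to the difference of $f$ and its Taylor
  polynomial; \<open>derivative_first_order\<close> bounds the derivative of this difference uniformly in the direction of $h$.\<close>

lemma Taylor_second_order:
  fixes f :: "'a::euclidean_space \<Rightarrow> 'b::real_normed_vector"
  assumes f: "twice_differentiable_at f x" and e: "e > 0"
  shows "\<forall>\<^sub>F h in nhds 0. norm (f (x + h) - f x - frechet_derivative f (at x) h
           - (1/2) *\<^sub>R second_derivative f x h h) \<le> e * (norm h)\<^sup>2"
proof -
  have "\<forall>\<^sub>F z in nhds x. f differentiable (at z) \<and>
     (\<forall>v. norm (frechet_derivative f (at z) v - frechet_derivative f (at x) v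
           - second_derivative f x v (z - x)) \<le> e * norm (z - x) * norm v)"
    using derivative_first_order[OF f e] twice_differentiable_atD(2)[OF f] by (auto intro: eventually_conj)
  then obtain d where d: "d > 0" "\<And>z. dist z x < d \<Longrightarrow> f differentiable (at z) \<and>
     (\<forall>v. norm (frechet_derivative f (at z) v - frechet_derivative f (at x) v
           - second_derivative f x v (z - x)) \<le> e * norm (z - x) * norm v)"
    unfolding eventually_nhds_metric by blast
  have "norm (f (x + h) - f x - frechet_derivative f (at x) h
           - (1/2) *\<^sub>R second_derivative f x h h) \<le> e * (norm h)\<^sup>2" if h: "norm h < d" for h
  proof -
    define \<phi> where "\<phi> s = f (x + s *\<^sub>R h) - s *\<^sub>R frechet_derivative f (at x) h - (s\<^sup>2/2) *\<^sub>R second_derivative f x h h" for s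
    define \<phi>' where "\<phi>' s = frechet_derivative f (at (x + s *\<^sub>R h)) h - frechet_derivative f (at x) h - s *\<^sub>R second_derivative f x h h" for s
    have der: "(\<phi> has_derivative (\<lambda>r. r *\<^sub>R \<phi>' s)) (at s within {0..1})" if "s \<in> {0..1}" for s
    proof -
      have "dist (x + s *\<^sub>R h) x < d"
        using h that mult_left_le_one_le[of "norm h" s] by (simp add: dist_norm)
      then have Df: "(f has_derivative frechet_derivative f (at (x + s *\<^sub>R h))) (at (x + s *\<^sub>R h))"
        using d(2) frechet_derivative_works by blast
      have "((\<lambda>s. f (x + s *\<^sub>R h)) has_derivative (\<lambda>r. frechet_derivative f (at (x + s *\<^sub>R h)) (r *\<^sub>R h))) (at s within {0..1})"
        by (rule has_derivative_compose[where f = "\<lambda>s. x + s *\<^sub>R h" and g = f, OF _ Df]) (auto intro!: derivative_eq_intros)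
      moreover have "frechet_derivative f (at (x + s *\<^sub>R h)) (r *\<^sub>R h) = r *\<^sub>R frechet_derivative f (at (x + s *\<^sub>R h)) h" for r
        using has_derivative_linear[OF Df] by (simp add: linear_cmul)
      ultimately have "((\<lambda>s. f (x + s *\<^sub>R h)) has_derivative (\<lambda>r. r *\<^sub>R frechet_derivative f (at (x + s *\<^sub>R h)) h)) (at s within {0..1})"
        by simp
      then show ?thesis
        unfolding \<phi>_def \<phi>'_def by (auto intro!: derivative_eq_intros simp: algebra_simps)
    qed
    have bd: "norm (\<phi>' s) \<le> e * (norm h)\<^sup>2" if "s \<in> {0..1}" for s
    proof -
      have s: "\<bar>s\<bar> * norm h \<le> norm h"
        using that by (simp add: mult_left_le_one_le)
      have "dist (x + s *\<^sub>R h) x < d" using s h by (simp add: dist_norm)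
      then have "norm (frechet_derivative f (at (x + s *\<^sub>R h)) h - frechet_derivative f (at x) h
           - second_derivative f x h (s *\<^sub>R h)) \<le> e * norm (s *\<^sub>R h) * norm h"
        using d(2)[of "x + s *\<^sub>R h"] by simp
      also have "\<dots> \<le> e * (norm h)\<^sup>2"
        using mult_right_mono[OF s, of "norm h"] e by (simp add: power2_eq_square mult.assoc)
      finally show ?thesis
        unfolding \<phi>'_def using second_derivative_linear_right[OF f, of h] by (simp add: linear_cmul)
    qed
    have "norm (\<phi> 1 - \<phi> 0) \<le> e * (norm h)\<^sup>2 * norm (1 - 0 :: real)"
    proof (rule differentiable_bound[of "{0..1}"])
      show "onorm (\<lambda>r. r *\<^sub>R \<phi>' s) \<le> e * (norm h)\<^sup>2" if "s \<in> {0..1}" for s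
        using bd[OF that] e by (intro onorm_bound) (auto simp: mult.commute[of _ "\<bar>_\<bar>"] intro!: mult_left_mono)
    qed (use der in auto)
    then show ?thesis by (simp add: \<phi>_def algebra_simps)
  qed
  then show ?thesis
    unfolding eventually_nhds_metric using d(1) by (auto intro!: exI[of _ d])
qed

text \<open>The second difference is an increment along $su$ of the function $z\mapsto f(z+sv)-f(z)$, whose derivative in the
  direction $u$ is $s\,D^2f(u,v)$ up to a small multiple of $s$.\<close>

lemma second_derivative_difference_quotient:
  fixes f :: "'a::euclidean_space \<Rightarrow> 'b::real_normed_vector"
  assumes f: "twice_differentiable_at f x" and e: "e > 0"
  shows "\<forall>\<^sub>F s in at_right 0. norm (f (x + s *\<^sub>R u + s *\<^sub>R v) - f (x + s *\<^sub>R u) - f (x + s *\<^sub>R v) + f x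
           - s\<^sup>2 *\<^sub>R second_derivative f x u v) \<le> e * s\<^sup>2"
proof -
  define c where "c = norm u + norm v"
  \<comment> \<open>The two evaluations of the remainder below contribute \<open>2 * k * c * norm u\<close>, which must be at most \<open>e\<close>.\<close>
  define k where "k = e / (2 * c * norm u + 1)"
  have c: "c \<ge> 0" by (simp add: c_def)
  have k: "k > 0" using e c by (simp add: k_def add_nonneg_pos)
  have "\<forall>\<^sub>F z in nhds x. f differentiable (at z) \<and>
     (\<forall>v. norm (frechet_derivative f (at z) v - frechet_derivative f (at x) v
           - second_derivative f x v (z - x)) \<le> k * norm (z - x) * norm v)"
    using derivative_first_order[OF f k] twice_differentiable_atD(2)[OF f] by (auto intro: eventually_conj)
  then obtain d where d: "d > 0" "\<And>z. dist z x < d \<Longrightarrow> f differentiable (at z) \<and>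
     (\<forall>v. norm (frechet_derivative f (at z) v - frechet_derivative f (at x) v
           - second_derivative f x v (z - x)) \<le> k * norm (z - x) * norm v)"
    unfolding eventually_nhds_metric by blast
  note lin = second_derivative_linear_right[OF f, of u]
  have "norm (f (x + s *\<^sub>R u + s *\<^sub>R v) - f (x + s *\<^sub>R u) - f (x + s *\<^sub>R v) + f x
           - s\<^sup>2 *\<^sub>R second_derivative f x u v) \<le> e * s\<^sup>2" if s: "0 < s" "s < d / (c + 1)" for s
  proof -
    have sc: "s * c < d"
    proof -
      have "s * c \<le> s * (c + 1)" using s by simp
      also have "\<dots> < d" using s c by (simp add: pos_less_divide_eq)
      finally show ?thesis .
    qed
    have near: "norm (r *\<^sub>R u + q *\<^sub>R v) \<le> s * c" if "r \<in> {0..s}" "q \<in> {0..s}" for r q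
    proof -
      have "norm (r *\<^sub>R u + q *\<^sub>R v) \<le> r * norm u + q * norm v"
        using norm_triangle_ineq[of "r *\<^sub>R u" "q *\<^sub>R v"] that by simp
      also have "\<dots> \<le> s * norm u + s * norm v"
        using that by (intro add_mono mult_right_mono) auto
      finally show ?thesis by (simp add: c_def algebra_simps)
    qed
    define D where "D r q = frechet_derivative f (at (x + r *\<^sub>R u + q *\<^sub>R v)) u" for r q
    define \<phi> where "\<phi> r = f (x + r *\<^sub>R u + s *\<^sub>R v) - f (x + r *\<^sub>R u) - r *\<^sub>R (s *\<^sub>R second_derivative f x u v)" for r
    define \<phi>' where "\<phi>' r = D r s - D r 0 - s *\<^sub>R second_derivative f x u v" for r
    have der1: "((\<lambda>r. f (x + r *\<^sub>R u + q *\<^sub>R v)) has_derivative (\<lambda>t. t *\<^sub>R D r q)) (at r within {0..s})"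
      if "r \<in> {0..s}" "q \<in> {0..s}" for r q
    proof -
      have "dist (x + r *\<^sub>R u + q *\<^sub>R v) x < d"
        using near[OF that] sc by (simp add: dist_norm add.assoc)
      then have Df: "(f has_derivative frechet_derivative f (at (x + r *\<^sub>R u + q *\<^sub>R v))) (at (x + r *\<^sub>R u + q *\<^sub>R v))"
        using d(2) frechet_derivative_works by blast
      have "((\<lambda>r. f (x + r *\<^sub>R u + q *\<^sub>R v)) has_derivative
          (\<lambda>t. frechet_derivative f (at (x + r *\<^sub>R u + q *\<^sub>R v)) (t *\<^sub>R u))) (at r within {0..s})"
        by (rule has_derivative_compose[where f = "\<lambda>r. x + r *\<^sub>R u + q *\<^sub>R v" and g = f, OF _ Df])
          (auto intro!: derivative_eq_intros)
      then show ?thesis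
        using has_derivative_linear[OF Df] by (simp add: linear_cmul D_def)
    qed
    have der: "(\<phi> has_derivative (\<lambda>t. t *\<^sub>R \<phi>' r)) (at r within {0..s})" if r: "r \<in> {0..s}" for r
      unfolding \<phi>_def \<phi>'_def
      using der1[OF r, of s] der1[OF r, of 0] s
      by (auto intro!: derivative_eq_intros simp: algebra_simps)
    have bd: "norm (\<phi>' r) \<le> e * s" if r: "r \<in> {0..s}" for r
    proof -
      have R: "norm (D r q - frechet_derivative f (at x) u - second_derivative f x u (r *\<^sub>R u + q *\<^sub>R v)) \<le> k * (s * c) * norm u"
        if q: "q \<in> {0..s}" for q
      proof -
        have "dist (x + r *\<^sub>R u + q *\<^sub>R v) x < d"
          using near[OF r q] sc by (simp add: dist_norm add.assoc)
        then have "norm (D r q - frechet_derivative f (at x) u - second_derivative f x u (r *\<^sub>R u + q *\<^sub>R v))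
            \<le> k * norm (r *\<^sub>R u + q *\<^sub>R v) * norm u"
          using d(2)[of "x + r *\<^sub>R u + q *\<^sub>R v"] by (simp add: D_def add.assoc)
        also have "\<dots> \<le> k * (s * c) * norm u"
          using near[OF r q] k by (intro mult_right_mono mult_left_mono) auto
        finally show ?thesis .
      qed
      have "\<phi>' r = (D r s - frechet_derivative f (at x) u - second_derivative f x u (r *\<^sub>R u + s *\<^sub>R v))
          - (D r 0 - frechet_derivative f (at x) u - second_derivative f x u (r *\<^sub>R u + 0 *\<^sub>R v))"
        by (simp add: \<phi>'_def linear_add[OF lin] linear_cmul[OF lin])
      then have "norm (\<phi>' r) \<le> k * (s * c) * norm u + k * (s * c) * norm u"
        using norm_triangle_ineq4 R[of s] R[of 0] s by (smt (verit) atLeastAtMost_iff)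
      also have "\<dots> = k * (2 * c * norm u) * s" by simp
      also have "\<dots> \<le> k * (2 * c * norm u + 1) * s"
        using k s by simp
      also have "k * (2 * c * norm u + 1) = e"
        using c by (simp add: k_def add_nonneg_eq_0_iff)
      finally show ?thesis by simp
    qed
    have "norm (\<phi> s - \<phi> 0) \<le> e * s * norm (s - 0)"
    proof (rule differentiable_bound[of "{0..s}"])
      show "onorm (\<lambda>t. t *\<^sub>R \<phi>' r) \<le> e * s" if "r \<in> {0..s}" for r
        using bd[OF that] e s by (intro onorm_bound) (auto simp: mult.commute[of _ "\<bar>_\<bar>"] intro!: mult_left_mono)
    qed (use der s in auto)
    then show ?thesis using s by (simp add: \<phi>_def algebra_simps power2_eq_square)
  qed
  moreover have "d / (c + 1) > 0" using d(1) c by simp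
  ultimately show ?thesis
    unfolding eventually_at_right_field by auto
qed

text \<open>The second difference in \<open>second_derivative_difference_quotient\<close> is symmetric in $u$ and $v$.\<close>

lemma second_derivative_symmetric:
  fixes f :: "'a::euclidean_space \<Rightarrow> 'b::real_normed_vector"
  assumes f: "twice_differentiable_at f x"
  shows "second_derivative f x u v = second_derivative f x v u"
proof (rule ccontr)
  define D where "D = second_derivative f x u v - second_derivative f x v u"
  assume "\<not> ?thesis"
  then have D: "norm D > 0" by (simp add: D_def)
  define e where "e = norm D / 4"
  have e: "e > 0" using D by (simp add: e_def)
  have "\<forall>\<^sub>F s in at_right (0::real). False"
    using second_derivative_difference_quotient[OF f e, of u v]
      second_derivative_difference_quotient[OF f e, of v u] eventually_at_right_less[of 0]
  proof eventually_elim
    case (elim s)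
    define Q where "Q = f (x + s *\<^sub>R u + s *\<^sub>R v) - f (x + s *\<^sub>R u) - f (x + s *\<^sub>R v) + f x"
    have 1: "norm (Q - s\<^sup>2 *\<^sub>R second_derivative f x u v) \<le> e * s\<^sup>2"
      using elim(1) by (simp add: Q_def)
    have 2: "norm (Q - s\<^sup>2 *\<^sub>R second_derivative f x v u) \<le> e * s\<^sup>2"
      using elim(2) by (simp add: Q_def algebra_simps)
    have "norm (s\<^sup>2 *\<^sub>R D) = norm ((Q - s\<^sup>2 *\<^sub>R second_derivative f x v u) - (Q - s\<^sup>2 *\<^sub>R second_derivative f x u v))"
      by (simp add: D_def algebra_simps)
    then have "norm (s\<^sup>2 *\<^sub>R D) \<le> e * s\<^sup>2 + e * s\<^sup>2"
      using norm_triangle_ineq4 1 2 by (smt (verit))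
    then show False using D elim(3) by (simp add: e_def)
  qed
  then show False by simp
qed

lemma local_min_second_order:
  fixes f :: "'a::euclidean_space \<Rightarrow> real"
  assumes f: "twice_differentiable_at f x" and min: "\<forall>\<^sub>F z in nhds x. f x \<le> f z"
  shows "frechet_derivative f (at x) = (\<lambda>v. 0)" "second_derivative f x v v \<ge> 0"
proof -
  obtain S where S: "open S" "x \<in> S" "\<forall>z\<in>S. f x \<le> f z"
    using min unfolding eventually_nhds by blast
  have Df: "(f has_derivative frechet_derivative f (at x)) (at x)"
    using twice_differentiable_atD(1)[OF f] frechet_derivative_works by blast
  show D0: "frechet_derivative f (at x) = (\<lambda>v. 0)"
    by (rule differential_zero_maxmin[OF S(2,1) Df]) (use S in auto)
  show "second_derivative f x v v \<ge> 0"
  proof (rule ccontr)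
    assume "\<not> ?thesis"
    then have neg: "second_derivative f x v v < 0" by simp
    then have v: "v \<noteq> 0"
      using second_derivative_linear_right[OF f, of v] linear_0 by fastforce
    define e where "e = - second_derivative f x v v / (4 * (norm v)\<^sup>2)"
    have e: "e > 0" using neg v by (auto simp: e_def intro!: divide_neg_pos)
    have tend: "((\<lambda>s. s *\<^sub>R v) \<longlongrightarrow> 0) (at_right (0::real))"
      by (auto intro!: tendsto_eq_intros)
    have "((\<lambda>s. x + s *\<^sub>R v) \<longlongrightarrow> x) (at_right (0::real))"
      by (auto intro!: tendsto_eq_intros)
    then have 1: "\<forall>\<^sub>F s in at_right 0. f x \<le> f (x + s *\<^sub>R v)"
      using min by (rule eventually_compose_filterlim[rotated])
    have 2: "\<forall>\<^sub>F s in at_right 0. norm (f (x + s *\<^sub>R v) - f x - frechet_derivative f (at x) (s *\<^sub>R v)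
           - (1/2) *\<^sub>R second_derivative f x (s *\<^sub>R v) (s *\<^sub>R v)) \<le> e * (norm (s *\<^sub>R v))\<^sup>2"
      by (rule eventually_compose_filterlim[OF Taylor_second_order[OF f e] tend])
    have "\<forall>\<^sub>F s in at_right (0::real). False"
      using 1 2 eventually_at_right_less[of 0]
    proof eventually_elim
      case (elim s)
      have "second_derivative f x (s *\<^sub>R v) (s *\<^sub>R v) = s\<^sup>2 * second_derivative f x v v"
        using second_derivative_bilinear[OF f] by (simp add: bilinear_lmul bilinear_rmul power2_eq_square)
      moreover have "f (x + s *\<^sub>R v) - f x - (1/2) * second_derivative f x (s *\<^sub>R v) (s *\<^sub>R v) \<le> e * (norm (s *\<^sub>R v))\<^sup>2"
        using elim(2) by (simp add: D0 abs_le_iff)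
      moreover have "e * (norm (s *\<^sub>R v))\<^sup>2 = s\<^sup>2 * (- second_derivative f x v v / 4)"
        using v by (simp add: e_def power_mult_distrib)
      ultimately have "- (1/2) * (s\<^sup>2 * second_derivative f x v v) \<le> s\<^sup>2 * (- second_derivative f x v v / 4)"
        using elim(1) by linarith
      then have "s\<^sup>2 * second_derivative f x v v \<ge> 0" by (simp add: mult.commute)
      then show False using neg elim(3) by (simp add: zero_le_mult_iff)
    qed
    then show False by simp
  qed
qed

lemma frechet_derivative_partial:
  fixes f :: "real^'m::finite \<Rightarrow> 'b::real_normed_vector"
  assumes "f differentiable (at x)"
  shows "frechet_derivative f (at x) v = (\<Sum>i\<in>UNIV. v $ i *\<^sub>R partial i f x)"
proof -
  note lin = frechet_derivative_linear[OF assms]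
  have "frechet_derivative f (at x) v = frechet_derivative f (at x) (\<Sum>i\<in>UNIV. v $ i *\<^sub>R axis i 1)"
    by (simp add: basis_expansion flip: scalar_mult_eq_scaleR)
  then show ?thesis by (simp add: linear_sum[OF lin] linear_cmul[OF lin] partial_def)
qed

lemma partial_partial:
  "partial i (partial j f) x = second_derivative f x (axis j 1) (axis i 1)"
  unfolding partial_def second_derivative_def by (simp add: partial_def[abs_def])

lemma second_derivative_partial:
  fixes f :: "real^'m::finite \<Rightarrow> 'b::real_normed_vector"
  assumes "twice_differentiable_at f x"
  shows "second_derivative f x v w = (\<Sum>i\<in>UNIV. \<Sum>j\<in>UNIV. (v $ i * w $ j) *\<^sub>R partial j (partial i f) x)"
proof -
  have b: "bilinear (second_derivative f x)" by (rule second_derivative_bilinear[OF assms])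
  have ex: "u = (\<Sum>i\<in>UNIV. u $ i *\<^sub>R axis i 1)" for u :: "real^'m"
    by (simp add: basis_expansion flip: scalar_mult_eq_scaleR)
  have "second_derivative f x v w = second_derivative f x (\<Sum>i\<in>UNIV. v $ i *\<^sub>R axis i 1) (\<Sum>j\<in>UNIV. w $ j *\<^sub>R axis j 1)"
    using ex[of v] ex[of w] by simp
  also have "\<dots> = (\<Sum>i\<in>UNIV. \<Sum>j\<in>UNIV. (v $ i * w $ j) *\<^sub>R partial j (partial i f) x)"
    by (simp add: bilinear_sum[OF b] bilinear_lmul[OF b] bilinear_rmul[OF b] partial_partial
        sum.cartesian_product case_prod_unfold mult.commute)
  finally show ?thesis .
qed

text \<open>Together with \<open>exists_orthonormalizing_frame\<close> this turns $\sum_{i,j}g^{ij}\partial_i\partial_jf$ into a sum of pure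
  second derivatives, to which the second derivative test applies.\<close>

lemma sum_frame_second_derivative:
  fixes f :: "real^'m::finite \<Rightarrow> 'b::real_normed_vector"
  assumes "twice_differentiable_at f x"
  shows "(\<Sum>k\<in>UNIV. second_derivative f x (E k) (E k))
     = (\<Sum>i\<in>UNIV. \<Sum>j\<in>UNIV. (\<Sum>k\<in>(UNIV::'k::finite set). E k $ i * E k $ j) *\<^sub>R partial i (partial j f) x)"
proof -
  have "(\<Sum>k\<in>UNIV. second_derivative f x (E k) (E k))
     = (\<Sum>k\<in>UNIV. \<Sum>i\<in>UNIV. \<Sum>j\<in>UNIV. (E k $ j * E k $ i) *\<^sub>R partial i (partial j f) x)"
    unfolding second_derivative_partial[OF assms] by (rule sum.cong[OF refl], rule sum.swap)
  also have "\<dots> = (\<Sum>i\<in>UNIV. \<Sum>k\<in>UNIV. \<Sum>j\<in>UNIV. (E k $ j * E k $ i) *\<^sub>R partial i (partial j f) x)"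
    by (rule sum.swap)
  also have "\<dots> = (\<Sum>i\<in>UNIV. \<Sum>j\<in>UNIV. \<Sum>k\<in>UNIV. (E k $ j * E k $ i) *\<^sub>R partial i (partial j f) x)"
    by (rule sum.cong[OF refl], rule sum.swap)
  finally show ?thesis by (simp add: scaleR_sum_left mult.commute)
qed

lemma Ck_on_2_twice_differentiable_at:
  assumes "Ck_on 2 U f" "open U" "x \<in> U"
  shows "twice_differentiable_at f x"
  using assms eventually_nhds_in_open[OF assms(2,3)]
  unfolding twice_differentiable_at_def numeral_2_eq_2 by (auto elim: eventually_mono)

section \<open>Derivatives of determinants and inverse matrices\<close>

lemma det_has_derivative:
  fixes G :: "'a::real_normed_vector \<Rightarrow> real^'m::finite^'m"
  assumes G: "\<And>i j. ((\<lambda>z. G z $ i $ j) has_derivative (\<lambda>h. G' h $ i $ j)) (at x)"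
  shows "((\<lambda>z. det (G z)) has_derivative
           (\<lambda>h. \<Sum>k\<in>UNIV. det (\<chi> i. if i = k then G' h $ i else G x $ i))) (at x)"
proof -
  let ?P = "{p. p permutes (UNIV :: 'm set)}"
  have "(\<Sum>k\<in>UNIV. det (\<chi> i. if i = k then G' h $ i else G x $ i))
      = (\<Sum>p\<in>?P. of_int (sign p) * (\<Sum>k\<in>UNIV. G' h $ k $ p k * (\<Prod>i\<in>UNIV - {k}. G x $ i $ p i)))" for h
  proof -
    have "(\<Prod>i\<in>UNIV. (\<chi> i. if i = k then G' h $ i else G x $ i) $ i $ p i)
        = G' h $ k $ p k * (\<Prod>i\<in>UNIV - {k}. G x $ i $ p i)" for k p
      by (simp add: prod.remove[of UNIV k])
    then show ?thesis
      unfolding det_def by (subst sum.swap) (simp add: sum_distrib_left)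
  qed
  then show ?thesis
    unfolding det_def[of "G _"] by (auto intro!: derivative_eq_intros G sum.cong)
qed

text \<open>Row $k$ of $H=(HG^{-1})G$ is a linear combination of the rows of $G$, in which the row $k$ of $G$ has the
  coefficient $(HG^{-1})_{kk}$; the other rows do not contribute to the determinant.\<close>

lemma det_replace_row:
  fixes G H :: "real^'m::finite^'m"
  assumes "invertible G"
  shows "det (\<chi> i. if i = k then H $ i else G $ i) = det G * (H ** matrix_inv G) $ k $ k"
proof -
  define x where "x = (H ** matrix_inv G) $ k"
  have "x v* G = (H ** matrix_inv G ** G) $ k"
    by (simp add: x_def vec_eq_iff matrix_matrix_mult_def vector_matrix_mult_def mult.commute)
  also have "H ** matrix_inv G ** G = H"
    by (simp add: matrix_inv_mult[OF assms] flip: matrix_mul_assoc)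
  finally have xG: "x v* G = H $ k" .
  have "det (\<chi> i. if i = k then H $ i else G $ i)
      = det (\<chi> i. if i = k then (\<Sum>l\<in>UNIV. x $ l *s row l G) else row i G)"
    by (rule arg_cong[where f = det])
      (simp add: vec_eq_iff row_def xG[symmetric] vector_matrix_mult_def mult.commute)
  then show ?thesis
    using cramer_lemma_transpose[of k x G] by (simp add: x_def mult.commute)
qed

lemma Jacobi_formula:
  fixes G :: "'a::real_normed_vector \<Rightarrow> real^'m::finite^'m"
  assumes G: "\<And>i j. ((\<lambda>z. G z $ i $ j) has_derivative (\<lambda>h. G' h $ i $ j)) (at x)"
    and inv: "invertible (G x)"
  shows "((\<lambda>z. det (G z)) has_derivative
           (\<lambda>h. det (G x) * trace (G' h ** matrix_inv (G x)))) (at x)"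
  using det_has_derivative[OF G] unfolding det_replace_row[OF inv] trace_def sum_distrib_left .

text \<open>Cramer's rule for column $j$ of the inverse; it makes the entries of the inverse visibly differentiable.\<close>

lemma matrix_inv_entry:
  fixes G :: "real^'m::finite^'m"
  assumes "invertible G"
  shows "matrix_inv G $ i $ j = det (\<chi> r c. if c = i then axis j 1 $ r else G $ r $ c) / det G"
proof -
  have ax: "G *v (matrix_inv G *v axis j 1) = axis j 1"
    by (simp add: matrix_vector_mul_assoc matrix_inv_mult[OF assms])
  have "det (\<chi> r c. if c = i then axis j 1 $ r else G $ r $ c) = (matrix_inv G *v axis j 1) $ i * det G"
    using cramer_lemma[of i G "matrix_inv G *v axis j 1"] unfolding ax .
  moreover have "(matrix_inv G *v axis j 1) $ i = matrix_inv G $ i $ j"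
    by (simp add: matrix_vector_mult_basis column_def)
  ultimately show ?thesis using assms by (simp add: invertible_det_nz)
qed

lemma det_differentiable:
  fixes G :: "'a::real_normed_vector \<Rightarrow> real^'m::finite^'m"
  assumes "\<And>i j. (\<lambda>z. G z $ i $ j) differentiable (at x)"
  shows "(\<lambda>z. det (G z)) differentiable (at x)"
proof -
  define G' where "G' h = (\<chi> i j. frechet_derivative (\<lambda>z. G z $ i $ j) (at x) h)" for h
  have "((\<lambda>z. G z $ i $ j) has_derivative (\<lambda>h. G' h $ i $ j)) (at x)" for i j
    using assms[of i j] by (simp add: G'_def frechet_derivative_works)
  from det_has_derivative[OF this] show ?thesis
    unfolding differentiable_def by blast
qed

lemma eventually_invertible:
  fixes G :: "'a::real_normed_vector \<Rightarrow> real^'m::finite^'m"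
  assumes "\<And>i j. (\<lambda>z. G z $ i $ j) differentiable (at x)" "invertible (G x)"
  shows "\<forall>\<^sub>F z in nhds x. invertible (G z)"
proof -
  have "isCont (\<lambda>z. det (G z)) x"
    using det_differentiable[OF assms(1)] by (rule differentiable_imp_continuous_within)
  then have "((\<lambda>z. det (G z)) \<longlongrightarrow> det (G x)) (nhds x)"
    using tendsto_at_iff_tendsto_nhds[of "\<lambda>z. det (G z)" x] unfolding isCont_def by blast
  moreover have "det (G x) \<noteq> 0" using assms(2) by (simp add: invertible_det_nz)
  ultimately have "\<forall>\<^sub>F z in nhds x. det (G z) \<noteq> 0"
    by (rule tendsto_imp_eventually_ne)
  then show ?thesis by (simp add: invertible_det_nz)
qed

lemma has_derivative_transform_nhds:
  assumes "(f has_derivative f') (at x)" "\<forall>\<^sub>F z in nhds x. f z = g z"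
  shows "(g has_derivative f') (at x)"
proof (rule has_derivative_transform_eventually[OF assms(1)])
  show "\<forall>\<^sub>F z in at x. f z = g z"
    using assms(2) unfolding eventually_at_filter by (rule eventually_mono) simp
  show "f x = g x" using eventually_nhds_x_imp_x[OF assms(2)] .
qed simp

lemma differentiable_transform_eventually:
  assumes "f differentiable (at x)" "\<forall>\<^sub>F z in nhds x. f z = g z"
  shows "g differentiable (at x)"
  using assms has_derivative_transform_nhds unfolding differentiable_def by blast

lemma matrix_inv_differentiable:
  fixes G :: "'a::real_normed_vector \<Rightarrow> real^'m::finite^'m"
  assumes G: "\<And>i j. (\<lambda>z. G z $ i $ j) differentiable (at x)" and inv: "invertible (G x)"
  shows "(\<lambda>z. matrix_inv (G z) $ i $ j) differentiable (at x)"
proof (rule differentiable_transform_eventually)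
  show "\<forall>\<^sub>F z in nhds x. det (\<chi> r c. if c = i then axis j 1 $ r else G z $ r $ c) / det (G z) = matrix_inv (G z) $ i $ j"
    using eventually_invertible[OF G inv] by eventually_elim (simp add: matrix_inv_entry)
  have "(\<lambda>z. (\<chi> r c. if c = i then axis j 1 $ r else G z $ r $ c) $ r $ c) differentiable (at x)" for r c
    using G by (cases "c = i") simp_all
  then have "(\<lambda>z. det (\<chi> r c. if c = i then axis j 1 $ r else G z $ r $ c)) differentiable (at x)"
    by (rule det_differentiable)
  then show "(\<lambda>z. det (\<chi> r c. if c = i then axis j 1 $ r else G z $ r $ c) / det (G z)) differentiable (at x)"
    using det_differentiable[OF G] inv by (intro differentiable_divide) (simp_all add: invertible_det_nz)
qed

section \<open>The Laplace--Beltrami operator of an induced metric\<close>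

lemma partial_has_derivative: "(f has_derivative f') (at x) \<Longrightarrow> partial i f x = f' (axis i 1)"
  by (metis frechet_derivative_at partial_def)

lemma has_derivative_frechet: "f differentiable (at x) \<Longrightarrow> (f has_derivative frechet_derivative f (at x)) (at x)"
  by (simp add: frechet_derivative_works)

lemma partial_mult:
  fixes f g :: "real^'m::finite \<Rightarrow> real"
  assumes "f differentiable (at x)" "g differentiable (at x)"
  shows "partial i (\<lambda>z. f z * g z) x = f x * partial i g x + partial i f x * g x"
  using partial_has_derivative[OF has_derivative_mult[OF assms[THEN has_derivative_frechet]]]
  by (simp add: partial_def)

lemma partial_inner:
  fixes f g :: "real^'m::finite \<Rightarrow> 'b::real_inner"
  assumes "f differentiable (at x)" "g differentiable (at x)"
  shows "partial i (\<lambda>z. f z \<bullet> g z) x = f x \<bullet> partial i g x + partial i f x \<bullet> g x"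
  using partial_has_derivative[OF has_derivative_inner[OF assms[THEN has_derivative_frechet]]]
  by (simp add: partial_def)

lemma partial_sum:
  fixes f :: "'k \<Rightarrow> real^'m::finite \<Rightarrow> 'b::real_normed_vector"
  assumes "\<And>k. k \<in> K \<Longrightarrow> f k differentiable (at x)"
  shows "partial i (\<lambda>z. \<Sum>k\<in>K. f k z) x = (\<Sum>k\<in>K. partial i (f k) x)"
  using partial_has_derivative[OF has_derivative_sum[of K f, OF has_derivative_frechet[OF assms]]]
  by (simp add: partial_def)

lemma partial_transform_eventually:
  assumes "f differentiable (at x)" "\<forall>\<^sub>F z in nhds x. f z = g z"
  shows "partial i f x = partial i g x"
proof -
  have "(g has_derivative frechet_derivative f (at x)) (at x)"
    by (rule has_derivative_transform_nhds[OF has_derivative_frechet[OF assms(1)] assms(2)])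
  then show ?thesis
    unfolding partial_def[of i f] by (rule partial_has_derivative[symmetric])
qed

lemma twice_differentiable_partial:
  "twice_differentiable_at f x \<Longrightarrow> partial i f differentiable (at x)"
  unfolding twice_differentiable_at_def by (simp add: partial_def[abs_def])

text \<open>The coefficients of the first order part $\sum_j b_j\partial_j$ of the Laplace--Beltrami operator in nondivergence form.\<close>

definition drift :: "(real^'m::finite \<Rightarrow> real^'m^'m) \<Rightarrow> real^'m \<Rightarrow> 'm \<Rightarrow> real" where
  "drift G y j = (\<Sum>i\<in>UNIV. partial i (\<lambda>z. sqrt (det (G z)) * matrix_inv (G z) $ i $ j) y) / sqrt (det (G y))"

lemma sqrt_det_differentiable:
  fixes G :: "'a::real_normed_vector \<Rightarrow> real^'m::finite^'m"
  assumes G: "\<And>i j. (\<lambda>z. G z $ i $ j) differentiable (at x)" and pos: "det (G x) > 0"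
  shows "(\<lambda>z. sqrt (det (G z))) differentiable (at x)"
  using has_derivative_real_sqrt[OF pos has_derivative_frechet[OF det_differentiable[OF G]]]
  unfolding differentiable_def by blast

lemma laplace_beltrami_nondivergence:
  fixes G :: "real^'m::finite \<Rightarrow> real^'m^'m"
  assumes G: "\<And>i j. (\<lambda>z. G z $ i $ j) differentiable (at y)" and pos: "det (G y) > 0"
    and u: "twice_differentiable_at u y"
  shows "laplace_beltrami G u y
     = (\<Sum>i\<in>UNIV. \<Sum>j\<in>UNIV. matrix_inv (G y) $ i $ j * partial i (partial j u) y)
       + (\<Sum>j\<in>UNIV. drift G y j * partial j u y)"
proof -
  define w where "w z = sqrt (det (G z))" for z
  define c where "c i j z = w z * matrix_inv (G z) $ i $ j" for i j z
  have inv: "invertible (G y)" using pos by (simp add: invertible_det_nz)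
  have w: "w differentiable (at y)" unfolding w_def by (rule sqrt_det_differentiable[OF G pos])
  have c: "c i j differentiable (at y)" for i j
    unfolding c_def by (intro differentiable_mult w matrix_inv_differentiable[OF G inv])
  note pu = twice_differentiable_partial[OF u]
  have "w z * (\<Sum>j\<in>UNIV. matrix_inv (G z) $ i $ j * partial j u z) = (\<Sum>j\<in>UNIV. c i j z * partial j u z)" for i z
    by (simp add: c_def sum_distrib_left mult.assoc)
  then have "laplace_beltrami G u y = (\<Sum>i\<in>UNIV. partial i (\<lambda>z. \<Sum>j\<in>UNIV. c i j z * partial j u z) y) / w y"
    by (simp add: laplace_beltrami_def w_def)
  also have "\<dots> = (\<Sum>i\<in>UNIV. \<Sum>j\<in>UNIV. c i j y * partial i (partial j u) y + partial i (c i j) y * partial j u y) / w y"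
    using c pu by (subst partial_sum) (auto intro!: differentiable_mult simp: partial_mult)
  also have "\<dots> = (\<Sum>i\<in>UNIV. \<Sum>j\<in>UNIV. c i j y * partial i (partial j u) y / w y)
      + (\<Sum>i\<in>UNIV. \<Sum>j\<in>UNIV. partial i (c i j) y * partial j u y / w y)"
    by (simp add: sum.distrib sum_divide_distrib add_divide_distrib)
  also have "(\<Sum>i\<in>UNIV. \<Sum>j\<in>UNIV. partial i (c i j) y * partial j u y / w y) = (\<Sum>j\<in>UNIV. drift G y j * partial j u y)"
    by (subst sum.swap) (simp add: drift_def c_def[abs_def] w_def sum_divide_distrib sum_distrib_right)
  also have "(\<Sum>i\<in>UNIV. \<Sum>j\<in>UNIV. c i j y * partial i (partial j u) y / w y)
      = (\<Sum>i\<in>UNIV. \<Sum>j\<in>UNIV. matrix_inv (G y) $ i $ j * partial i (partial j u) y)"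
    using pos by (simp add: c_def w_def)
  finally show ?thesis .
qed

lemma first_fundamental_form_differentiable:
  assumes "twice_differentiable_at X y"
  shows "(\<lambda>z. first_fundamental_form X z $ i $ j) differentiable (at y)"
proof -
  have "((\<lambda>z. partial i X z \<bullet> partial j X z) has_derivative
     (\<lambda>h. partial i X y \<bullet> frechet_derivative (partial j X) (at y) h + frechet_derivative (partial i X) (at y) h \<bullet> partial j X y)) (at y)"
    by (intro has_derivative_inner has_derivative_frechet twice_differentiable_partial assms)
  then show ?thesis
    unfolding first_fundamental_form_def differentiable_def by auto
qed

lemma partial_first_fundamental_form:
  assumes "twice_differentiable_at X y"
  shows "partial k (\<lambda>z. first_fundamental_form X z $ i $ j) y
     = partial i X y \<bullet> partial k (partial j X) y + partial k (partial i X) y \<bullet> partial j X y"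
  using partial_inner[OF twice_differentiable_partial[OF assms] twice_differentiable_partial[OF assms]]
  by (simp add: first_fundamental_form_def)

lemma partial_sqrt_det:
  fixes G :: "real^'m::finite \<Rightarrow> real^'m^'m"
  assumes G: "\<And>i j. (\<lambda>z. G z $ i $ j) differentiable (at y)" and pos: "det (G y) > 0"
  shows "partial k (\<lambda>z. sqrt (det (G z))) y
     = sqrt (det (G y)) / 2 * (\<Sum>i\<in>UNIV. \<Sum>j\<in>UNIV. partial k (\<lambda>z. G z $ i $ j) y * matrix_inv (G y) $ j $ i)"
proof -
  define G' where "G' h = (\<chi> i j. frechet_derivative (\<lambda>z. G z $ i $ j) (at y) h)" for h
  have inv: "invertible (G y)" using pos by (simp add: invertible_det_nz)
  have "((\<lambda>z. G z $ i $ j) has_derivative (\<lambda>h. G' h $ i $ j)) (at y)" for i j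
    using G[of i j] by (simp add: G'_def frechet_derivative_works)
  then have "((\<lambda>z. det (G z)) has_derivative (\<lambda>h. det (G y) * trace (G' h ** matrix_inv (G y)))) (at y)"
    using inv by (rule Jacobi_formula)
  from partial_has_derivative[OF has_derivative_real_sqrt[OF pos this]]
  have "partial k (\<lambda>z. sqrt (det (G z))) y = det (G y) / sqrt (det (G y)) / 2 * trace (G' (axis k 1) ** matrix_inv (G y))"
    by (simp add: field_simps)
  also have "det (G y) / sqrt (det (G y)) = sqrt (det (G y))"
    using pos by (simp add: real_div_sqrt)
  finally show ?thesis
    by (simp add: trace_def matrix_matrix_mult_def G'_def partial_def)
qed

text \<open>For $g_{ij}=\partial_iX\cdot\partial_jX$ the metric derivatives are expressed by the products
  $S_{ijk}=\partial_i\partial_jX\cdot\partial_kX$. Differentiating $\sum_j(\sqrt g\,g^{ij})g_{jk}=\sqrt g\,\delta_{ik}$ in the direction $i$ and summing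
  over $i$ yields the drift; Jacobi's formula for $\partial_k\sqrt g$ cancels everything but $-\sum g^{ij}S_{ijk}$.
  The meaning of the equation is that the Laplacian of $X$ has no tangential component.\<close>

lemma drift_first_fundamental_form:
  fixes X :: "real^'m::finite \<Rightarrow> real^'n"
  assumes X: "twice_differentiable_at X y" and pos: "det (first_fundamental_form X y) > 0"
    and sym: "\<And>i j. matrix_inv (first_fundamental_form X y) $ i $ j = matrix_inv (first_fundamental_form X y) $ j $ i"
  shows "(\<Sum>j\<in>UNIV. drift (first_fundamental_form X) y j * (partial j X y \<bullet> partial k X y))
     = - (\<Sum>i\<in>UNIV. \<Sum>j\<in>UNIV. matrix_inv (first_fundamental_form X y) $ i $ j * (partial i (partial j X) y \<bullet> partial k X y))"
proof -
  define G where "G = first_fundamental_form X"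
  define w where "w z = sqrt (det (G z))" for z
  define c where "c i j z = w z * matrix_inv (G z) $ i $ j" for i j z
  define I where "I i j = matrix_inv (G y) $ i $ j" for i j
  define S where "S i j k = partial i (partial j X) y \<bullet> partial k X y" for i j k
  have S: "S i j k = S j i k" for i j k
    unfolding S_def partial_partial second_derivative_symmetric[OF X, of "axis i 1"] ..
  have I: "I i j = I j i" for i j using sym by (simp add: I_def G_def)
  have G: "(\<lambda>z. G z $ i $ j) differentiable (at y)" for i j
    unfolding G_def by (rule first_fundamental_form_differentiable[OF X])
  have pos: "det (G y) > 0" using pos by (simp add: G_def)
  have inv: "invertible (G y)" using pos by (simp add: invertible_det_nz)
  have wpos: "w y > 0" using pos by (simp add: w_def)
  have w: "w differentiable (at y)" unfolding w_def by (rule sqrt_det_differentiable[OF G pos])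
  have c: "c i j differentiable (at y)" for i j
    unfolding c_def by (intro differentiable_mult w matrix_inv_differentiable[OF G inv])
  have dG: "partial l (\<lambda>z. G z $ i $ j) y = S l j i + S l i j" for l i j
    unfolding G_def partial_first_fundamental_form[OF X] S_def by (simp add: inner_commute)
  have row: "(\<Sum>j\<in>UNIV. partial i (c i j) y * G y $ j $ k) + w y * (\<Sum>j\<in>UNIV. I i j * (S i k j + S i j k))
      = (if i = k then partial k w y else 0)" for i
  proof -
    have ev: "\<forall>\<^sub>F z in nhds y. (\<Sum>j\<in>UNIV. c i j z * G z $ j $ k) = w z * (if i = k then 1 else 0)"
      using eventually_invertible[OF G inv]
    proof eventually_elim
      case (elim z)
      have "(\<Sum>j\<in>UNIV. matrix_inv (G z) $ i $ j * G z $ j $ k) = (matrix_inv (G z) ** G z) $ i $ k"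
        by (simp add: matrix_matrix_mult_def)
      also have "\<dots> = (if i = k then 1 else 0)"
        by (simp add: matrix_inv_mult[OF elim] mat_def)
      finally show ?case
        by (simp add: c_def mult.assoc flip: sum_distrib_left)
    qed
    have "partial i (\<lambda>z. \<Sum>j\<in>UNIV. c i j z * G z $ j $ k) y = partial i (\<lambda>z. w z * (if i = k then 1 else 0)) y"
      by (rule partial_transform_eventually[OF _ ev]) (auto intro!: differentiable_sum differentiable_mult c G)
    also have "\<dots> = (if i = k then partial k w y else 0)"
      by (simp add: partial_def)
    also have "partial i (\<lambda>z. \<Sum>j\<in>UNIV. c i j z * G z $ j $ k) y
        = (\<Sum>j\<in>UNIV. c i j y * (S i k j + S i j k) + partial i (c i j) y * G y $ j $ k)"
      by (subst partial_sum) (auto intro!: differentiable_mult c G simp: partial_mult c G dG)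
    also have "\<dots> = (\<Sum>j\<in>UNIV. partial i (c i j) y * G y $ j $ k) + w y * (\<Sum>j\<in>UNIV. I i j * (S i k j + S i j k))"
      by (simp add: sum.distrib c_def I_def sum_distrib_left mult.assoc)
    finally show ?thesis .
  qed
  have pw: "partial k w y = w y * (\<Sum>i\<in>UNIV. \<Sum>j\<in>UNIV. I i j * S k i j)"
  proof -
    have "partial k w y = w y / 2 * (\<Sum>i\<in>UNIV. \<Sum>j\<in>UNIV. (S k j i + S k i j) * I j i)"
      using partial_sqrt_det[OF G pos, of k] by (simp add: w_def[abs_def] I_def dG)
    also have "(\<Sum>i\<in>UNIV. \<Sum>j\<in>UNIV. (S k j i + S k i j) * I j i)
        = (\<Sum>i\<in>UNIV. \<Sum>j\<in>UNIV. I j i * S k j i) + (\<Sum>i\<in>UNIV. \<Sum>j\<in>UNIV. I i j * S k i j)"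
      by (simp add: sum.distrib algebra_simps I[of _ _])
    also have "(\<Sum>i\<in>UNIV. \<Sum>j\<in>UNIV. I j i * S k j i) = (\<Sum>i\<in>UNIV. \<Sum>j\<in>UNIV. I i j * S k i j)"
      by (rule sum.swap)
    finally show ?thesis by simp
  qed
  have "w y * (\<Sum>j\<in>UNIV. drift G y j * G y $ j $ k) = (\<Sum>i\<in>UNIV. \<Sum>j\<in>UNIV. partial i (c i j) y * G y $ j $ k)"
    using wpos by (subst sum.swap) (simp add: drift_def c_def[abs_def] w_def sum_distrib_left sum_distrib_right sum_divide_distrib)
  also have "\<dots> = (\<Sum>i\<in>UNIV. (if i = k then partial k w y else 0) - w y * (\<Sum>j\<in>UNIV. I i j * (S i k j + S i j k)))"
    using row by (intro sum.cong) (auto simp: algebra_simps)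
  also have "\<dots> = partial k w y - w y * (\<Sum>i\<in>UNIV. \<Sum>j\<in>UNIV. I i j * (S i k j + S i j k))"
    by (simp add: sum_subtractf sum_distrib_left)
  also have "\<dots> = w y * ((\<Sum>i\<in>UNIV. \<Sum>j\<in>UNIV. I i j * S k i j) - (\<Sum>i\<in>UNIV. \<Sum>j\<in>UNIV. I i j * (S i k j + S i j k)))"
    by (simp add: pw algebra_simps)
  finally have "(\<Sum>j\<in>UNIV. drift G y j * G y $ j $ k) = (\<Sum>i\<in>UNIV. \<Sum>j\<in>UNIV. I i j * S k i j) - (\<Sum>i\<in>UNIV. \<Sum>j\<in>UNIV. I i j * (S i k j + S i j k))"
    using wpos by simp
  also have "\<dots> = - (\<Sum>i\<in>UNIV. \<Sum>j\<in>UNIV. I i j * S i j k)"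
    by (simp add: S[of k] algebra_simps sum.distrib)
  finally show ?thesis
    by (simp add: I_def S_def G_def first_fundamental_form_def)
qed

section \<open>Harmonicity of the coordinates of a minimal hypersurface\<close>

text \<open>All that is used of a minimal hypersurface near a point, for a parametrization $X$.\<close>

definition minimal_at :: "(real^'m::finite \<Rightarrow> real^'n) \<Rightarrow> real^'m \<Rightarrow> bool" where
  "minimal_at X y \<longleftrightarrow> CARD('n) = CARD('m) + 1 \<and> twice_differentiable_at X y \<and>
     inj (frechet_derivative X (at y)) \<and> (\<forall>\<nu>. unit_normal X y \<nu> \<longrightarrow> mean_curvature X y \<nu> = 0)"

lemma unit_normal_iff:
  assumes "X differentiable (at y)"
  shows "unit_normal X y \<nu> \<longleftrightarrow> norm \<nu> = 1 \<and> (\<forall>v. frechet_derivative X (at y) v \<bullet> \<nu> = 0)"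
proof
  assume "unit_normal X y \<nu>"
  then show "norm \<nu> = 1 \<and> (\<forall>v. frechet_derivative X (at y) v \<bullet> \<nu> = 0)"
    unfolding unit_normal_def frechet_derivative_partial[OF assms] by (simp add: inner_sum_left)
next
  assume "norm \<nu> = 1 \<and> (\<forall>v. frechet_derivative X (at y) v \<bullet> \<nu> = 0)"
  then show "unit_normal X y \<nu>" by (simp add: unit_normal_def partial_def)
qed

lemma exists_tangent_frame:
  fixes X :: "real^'m::finite \<Rightarrow> real^'n"
  assumes X: "X differentiable (at y)" "inj (frechet_derivative X (at y))"
  obtains E :: "'m \<Rightarrow> real^'m"
    where "orthonormal_frame (\<lambda>k. frechet_derivative X (at y) (E k))"
      "det (first_fundamental_form X y) > 0"
      "\<And>i j. matrix_inv (first_fundamental_form X y) $ i $ j = (\<Sum>k\<in>UNIV. E k $ i * E k $ j)"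
proof -
  have G: "first_fundamental_form X y
      = (\<chi> i j. frechet_derivative X (at y) (axis i 1) \<bullet> frechet_derivative X (at y) (axis j 1))"
    by (simp add: first_fundamental_form_def partial_def)
  show ?thesis
    by (rule exists_orthonormalizing_frame[OF frechet_derivative_linear[OF X(1)] X(2)])
      (rule that; simp add: G)
qed

lemma mean_curvature_frame:
  fixes X :: "real^'m::finite \<Rightarrow> real^'n"
  assumes X: "twice_differentiable_at X y"
    and E: "\<And>i j. matrix_inv (first_fundamental_form X y) $ i $ j = (\<Sum>k\<in>UNIV. E k $ i * E k $ j)"
  shows "mean_curvature X y \<nu> = (\<Sum>k\<in>(UNIV::'k::finite set). second_derivative X y (E k) (E k)) \<bullet> \<nu> / CARD('m)"
  unfolding mean_curvature_def E sum_frame_second_derivative[OF X] by (simp add: inner_sum_left)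

text \<open>The left hand side is the Laplace--Beltrami operator applied to the components of $X$. Its tangential part
  vanishes by \<open>drift_first_fundamental_form\<close>, its normal part by minimality.\<close>

lemma minimal_coordinates_harmonic:
  fixes X :: "real^'m::finite \<Rightarrow> real^'n"
  assumes min: "minimal_at X y"
    and E: "orthonormal_frame (\<lambda>k. frechet_derivative X (at y) (E k))"
      "\<And>i j. matrix_inv (first_fundamental_form X y) $ i $ j = (\<Sum>k\<in>(UNIV::'m set). E k $ i * E k $ j)"
    and pos: "det (first_fundamental_form X y) > 0"
  shows "(\<Sum>k\<in>UNIV. second_derivative X y (E k) (E k))
     + (\<Sum>j\<in>UNIV. drift (first_fundamental_form X) y j *\<^sub>R partial j X y) = 0" (is "?V = 0")
proof -
  have card: "CARD('n) = CARD('m) + 1" and X: "twice_differentiable_at X y"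
    and mc: "\<And>\<nu>. unit_normal X y \<nu> \<Longrightarrow> mean_curvature X y \<nu> = 0"
    using min by (auto simp: minimal_at_def)
  note dX = twice_differentiable_atD(1)[OF X]
  let ?D = "frechet_derivative X (at y)"
  obtain n where n: "norm n = 1" "\<And>v. ?D v \<bullet> n = 0"
    using exists_unit_normal[OF frechet_derivative_linear[OF dX] card] by blast
  have un: "unit_normal X y n" using n by (simp add: unit_normal_iff[OF dX])
  have "(\<Sum>k\<in>UNIV. second_derivative X y (E k) (E k)) \<bullet> partial l X y
     = (\<Sum>i\<in>UNIV. \<Sum>j\<in>UNIV. matrix_inv (first_fundamental_form X y) $ i $ j * (partial i (partial j X) y \<bullet> partial l X y))" for l
    unfolding sum_frame_second_derivative[OF X] E(2) by (simp add: inner_sum_left)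
  moreover have "(\<Sum>j\<in>UNIV. drift (first_fundamental_form X) y j *\<^sub>R partial j X y) \<bullet> partial l X y
     = - (\<Sum>i\<in>UNIV. \<Sum>j\<in>UNIV. matrix_inv (first_fundamental_form X y) $ i $ j * (partial i (partial j X) y \<bullet> partial l X y))" for l
    using drift_first_fundamental_form[OF X pos, of l] by (simp add: inner_sum_left E(2) mult.commute)
  ultimately have "?V \<bullet> partial l X y = 0" for l
    by (simp add: inner_add_left)
  then have tan: "?V \<bullet> ?D v = 0" for v
    unfolding frechet_derivative_partial[OF dX] by (simp add: inner_sum_right)
  have "?V \<bullet> n = (\<Sum>k\<in>UNIV. second_derivative X y (E k) (E k)) \<bullet> n"
    using un by (simp add: inner_add_left inner_sum_left unit_normal_def)
  also have "\<dots> = 0"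
    using mc[OF un] by (simp add: mean_curvature_frame[OF X E(2)])
  finally have nor: "?V \<bullet> n = 0" .
  have "?V = (\<Sum>i\<in>UNIV. (?V \<bullet> ?D (E i)) *\<^sub>R ?D (E i)) + (?V \<bullet> n) *\<^sub>R n"
    using frame_and_normal_expand[OF card E(1) n(1) n(2), of ?V] by simp
  then show ?thesis
    by (simp only: tan nor) simp
qed

text \<open>The second order Taylor polynomial with gradient $a$ and Hessian $H$ (for symmetric $H$).\<close>

definition quadratic :: "real^'n \<Rightarrow> real^'n^'n \<Rightarrow> real^'n \<Rightarrow> real" where
  "quadratic a H \<xi> = a \<bullet> \<xi> + (\<xi> \<bullet> (H *v \<xi>)) / 2"

lemma quadratic_compose_has_derivative:
  fixes X :: "'a::real_normed_vector \<Rightarrow> real^'n"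
  assumes "(X has_derivative D) (at z)"
  shows "((\<lambda>z. quadratic a H (X z - x)) has_derivative
     (\<lambda>v. a \<bullet> D v + (D v \<bullet> (H *v (X z - x)) + (X z - x) \<bullet> (H *v D v)) / 2)) (at z)"
proof -
  have K: "((\<lambda>z. X z - x) has_derivative D) (at z)"
    using has_derivative_diff[OF assms has_derivative_const, of x] by simp
  then have HK: "((\<lambda>z. H *v (X z - x)) has_derivative (\<lambda>v. H *v D v)) (at z)"
    by (rule bounded_linear.has_derivative[OF matrix_vector_mul_bounded_linear])
  show ?thesis
    unfolding quadratic_def
    by (rule has_derivative_eq_rhs[OF has_derivative_add[OF has_derivative_inner_right[OF K]
            bounded_linear.has_derivative[OF bounded_linear_divide has_derivative_inner[OF K HK]]]])
      (simp add: add.commute)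
qed

lemma quadratic_compose_second_derivative:
  fixes X :: "'a::real_normed_vector \<Rightarrow> real^'n" and a :: "real^'n" and H :: "real^'n^'n"
  assumes X: "twice_differentiable_at X y"
  defines "q \<equiv> \<lambda>z. quadratic a H (X z - X y)"
  shows "twice_differentiable_at q y"
    and "frechet_derivative q (at y) v = a \<bullet> frechet_derivative X (at y) v"
    and "second_derivative q y v v = a \<bullet> second_derivative X y v v
       + frechet_derivative X (at y) v \<bullet> (H *v frechet_derivative X (at y) v)"
proof -
  define D where "D z = frechet_derivative X (at z)" for z
  define g where "g v z = a \<bullet> D z v + (D z v \<bullet> (H *v (X z - X y)) + (X z - X y) \<bullet> (H *v D z v)) / 2" for v z
  have der: "(q has_derivative (\<lambda>v. g v z)) (at z)" if "X differentiable (at z)" for z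
    unfolding q_def g_def D_def
    by (rule quadratic_compose_has_derivative[OF has_derivative_frechet[OF that]])
  then have Dq: "frechet_derivative q (at z) = (\<lambda>v. g v z)" if "X differentiable (at z)" for z
    using frechet_derivative_at[OF der[OF that]] by simp
  have ev: "\<forall>\<^sub>F z in nhds y. g v z = frechet_derivative q (at z) v" for v
    using twice_differentiable_atD(2)[OF X] by eventually_elim (simp add: Dq)
  have DX: "(X has_derivative D y) (at y)"
    unfolding D_def by (rule has_derivative_frechet[OF twice_differentiable_atD(1)[OF X]])
  have D2: "((\<lambda>z. D z v) has_derivative second_derivative X y v) (at y)" for v
    unfolding D_def by (rule twice_differentiable_atD(3)[OF X])
  have K: "((\<lambda>z. X z - X y) has_derivative D y) (at y)"
    using has_derivative_diff[OF DX has_derivative_const, of "X y"] by simp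
  then have HX: "((\<lambda>z. H *v (X z - X y)) has_derivative (\<lambda>w. H *v D y w)) (at y)"
    by (rule bounded_linear.has_derivative[OF matrix_vector_mul_bounded_linear])
  have HD: "((\<lambda>z. H *v D z v) has_derivative (\<lambda>w. H *v second_derivative X y v w)) (at y)" for v
    by (rule bounded_linear.has_derivative[OF matrix_vector_mul_bounded_linear D2])
  have dg: "(g v has_derivative (\<lambda>w. a \<bullet> second_derivative X y v w
      + (D y v \<bullet> (H *v D y w) + D y w \<bullet> (H *v D y v)) / 2)) (at y)" for v
    unfolding g_def
    by (rule has_derivative_eq_rhs[OF has_derivative_add[OF has_derivative_inner_right[OF D2]
            bounded_linear.has_derivative[OF bounded_linear_divide
              has_derivative_add[OF has_derivative_inner[OF D2 HX] has_derivative_inner[OF K HD]]]]])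
      simp
  then have dq: "((\<lambda>z. frechet_derivative q (at z) v) has_derivative (\<lambda>w. a \<bullet> second_derivative X y v w
      + (D y v \<bullet> (H *v D y w) + D y w \<bullet> (H *v D y v)) / 2)) (at y)" for v
    using ev by (rule has_derivative_transform_nhds)
  show "twice_differentiable_at q y"
    unfolding twice_differentiable_at_def
  proof (intro conjI allI)
    show "\<forall>\<^sub>F z in nhds y. q differentiable (at z)"
      using twice_differentiable_atD(2)[OF X] by eventually_elim (use der differentiable_def in blast)
    show "(\<lambda>z. frechet_derivative q (at z) v) differentiable (at y)" for v
      using dq unfolding differentiable_def by blast
  qed
  show "frechet_derivative q (at y) v = a \<bullet> frechet_derivative X (at y) v"
    by (simp add: Dq[OF twice_differentiable_atD(1)[OF X]] g_def D_def)
  show "second_derivative q y v v = a \<bullet> second_derivative X y v v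
       + frechet_derivative X (at y) v \<bullet> (H *v frechet_derivative X (at y) v)"
    unfolding second_derivative_def[of q] frechet_derivative_at[OF dq, symmetric] by (simp add: D_def)
qed

lemma second_derivative_diff:
  assumes f: "twice_differentiable_at f y" and g: "twice_differentiable_at g y"
  shows "twice_differentiable_at (\<lambda>z. f z - g z) y"
    and "frechet_derivative (\<lambda>z. f z - g z) (at y) v = frechet_derivative f (at y) v - frechet_derivative g (at y) v"
    and "second_derivative (\<lambda>z. f z - g z) y v w = second_derivative f y v w - second_derivative g y v w"
proof -
  have der: "((\<lambda>z. f z - g z) has_derivative (\<lambda>v. frechet_derivative f (at z) v - frechet_derivative g (at z) v)) (at z)"
    if "f differentiable (at z)" "g differentiable (at z)" for z
    using that by (intro has_derivative_diff has_derivative_frechet)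
  note D = frechet_derivative_at[OF der, symmetric]
  note near = twice_differentiable_atD(2)[OF f] twice_differentiable_atD(2)[OF g]
  have ev: "\<forall>\<^sub>F z in nhds y. frechet_derivative f (at z) v - frechet_derivative g (at z) v
      = frechet_derivative (\<lambda>z. f z - g z) (at z) v" for v
    using near by eventually_elim (simp add: D)
  have d2: "((\<lambda>z. frechet_derivative (\<lambda>z. f z - g z) (at z) v) has_derivative
      (\<lambda>w. second_derivative f y v w - second_derivative g y v w)) (at y)" for v
    by (rule has_derivative_transform_nhds[OF has_derivative_diff ev])
      (intro twice_differentiable_atD(3) f g)+
  show "twice_differentiable_at (\<lambda>z. f z - g z) y"
    unfolding twice_differentiable_at_def
  proof (intro conjI allI)
    show "\<forall>\<^sub>F z in nhds y. (\<lambda>z. f z - g z) differentiable (at z)"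
      using near by eventually_elim (rule differentiable_diff)
    show "(\<lambda>z. frechet_derivative (\<lambda>z. f z - g z) (at z) v) differentiable (at y)" for v
      using d2 unfolding differentiable_def by blast
  qed
  show "frechet_derivative (\<lambda>z. f z - g z) (at y) v = frechet_derivative f (at y) v - frechet_derivative g (at y) v"
    by (simp add: D twice_differentiable_atD(1) f g)
  show "second_derivative (\<lambda>z. f z - g z) y v w = second_derivative f y v w - second_derivative g y v w"
    unfolding second_derivative_def[of "\<lambda>z. f z - g z"] frechet_derivative_at[OF d2, symmetric] ..
qed

text \<open>The maximum principle at a point. The function $h-q$, with $q$ the quadratic polynomial along $X$, has a local
  minimum, so its gradient vanishes and its second derivatives along an orthonormal frame are nonnegative. Hence the
  Laplacian of $q$ is at most that of $h$, which is $0$. But by harmonicity of the coordinates the Laplacian of $q$ is the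
  trace of $H$ over the tangent space, which is positive.\<close>

lemma no_interior_touching:
  fixes X :: "real^'m::finite \<Rightarrow> real^'n"
  assumes min: "minimal_at X y"
    and h: "twice_differentiable_at h y" "laplace_beltrami (first_fundamental_form X) h y = 0"
    and H: "\<And>n. unit_normal X y n \<Longrightarrow> trace H - n \<bullet> (H *v n) > 0"
    and touch: "\<forall>\<^sub>F z in nhds y. quadratic a H (X z - X y) - h z \<le> - h y"
  shows False
proof -
  have card: "CARD('n) = CARD('m) + 1" and X: "twice_differentiable_at X y"
    and inj: "inj (frechet_derivative X (at y))"
    using min by (auto simp: minimal_at_def)
  note dX = twice_differentiable_atD(1)[OF X]
  let ?D = "frechet_derivative X (at y)"
  obtain E :: "'m \<Rightarrow> real^'m" where E: "orthonormal_frame (\<lambda>k. ?D (E k))"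
      "det (first_fundamental_form X y) > 0"
      "\<And>i j. matrix_inv (first_fundamental_form X y) $ i $ j = (\<Sum>k\<in>UNIV. E k $ i * E k $ j)"
    using exists_tangent_frame[OF dX inj] by blast
  obtain n where n: "norm n = 1" "\<And>v. ?D v \<bullet> n = 0"
    using exists_unit_normal[OF frechet_derivative_linear[OF dX] card] by blast
  define b where "b j = drift (first_fundamental_form X) y j" for j
  define q where "q z = quadratic a H (X z - X y)" for z
  have q: "twice_differentiable_at q y" "frechet_derivative q (at y) v = a \<bullet> ?D v"
    "second_derivative q y v v = a \<bullet> second_derivative X y v v + ?D v \<bullet> (H *v ?D v)" for v
    using quadratic_compose_second_derivative[OF X, of a H] by (simp_all add: q_def[abs_def])
  define f where "f z = h z - q z" for z
  have f: "twice_differentiable_at f y"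
    "frechet_derivative f (at y) v = frechet_derivative h (at y) v - frechet_derivative q (at y) v"
    "second_derivative f y v v = second_derivative h y v v - second_derivative q y v v" for v
    using second_derivative_diff[OF h(1) q(1)] by (simp_all add: f_def[abs_def])
  have "\<forall>\<^sub>F z in nhds y. f y \<le> f z"
    using touch by eventually_elim (simp add: f_def q_def quadratic_def)
  note f_min = local_min_second_order[OF f(1) this]
  have hq: "partial j h y = a \<bullet> partial j X y" for j
    using f(2) f_min(1) q(2) by (simp add: partial_def)
  define V where "V = (\<Sum>k\<in>UNIV. second_derivative X y (E k) (E k))"
  have LX: "(\<Sum>j\<in>UNIV. b j *\<^sub>R partial j X y) = - V"
    using minimal_coordinates_harmonic[OF min E(1) E(3) E(2)]
    by (simp add: b_def V_def add_eq_0_iff)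
  have "(\<Sum>j\<in>UNIV. b j * partial j h y) = a \<bullet> (\<Sum>j\<in>UNIV. b j *\<^sub>R partial j X y)"
    by (simp add: hq inner_sum_right)
  moreover have "0 = (\<Sum>k\<in>UNIV. second_derivative h y (E k) (E k)) + (\<Sum>j\<in>UNIV. b j * partial j h y)"
    using h laplace_beltrami_nondivergence[OF first_fundamental_form_differentiable[OF X] E(2) h(1)]
    by (simp add: sum_frame_second_derivative E(3) b_def)
  ultimately have "(\<Sum>k\<in>UNIV. second_derivative h y (E k) (E k)) = a \<bullet> V"
    by (simp add: LX)
  moreover have "(\<Sum>k\<in>UNIV. second_derivative q y (E k) (E k)) \<le> (\<Sum>k\<in>UNIV. second_derivative h y (E k) (E k))"
    using f_min(2) f(3) by (intro sum_mono) (simp add: algebra_simps)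
  moreover have "(\<Sum>k\<in>UNIV. second_derivative q y (E k) (E k)) = a \<bullet> V + (\<Sum>k\<in>UNIV. ?D (E k) \<bullet> (H *v ?D (E k)))"
    by (simp add: q(3) sum.distrib inner_sum_right V_def)
  moreover have "(\<Sum>k\<in>UNIV. ?D (E k) \<bullet> (H *v ?D (E k))) = trace H - n \<bullet> (H *v n)"
    by (rule trace_along_frame[OF card E(1) n(1) n(2)])
  ultimately have "trace H - n \<bullet> (H *v n) \<le> 0" by simp
  moreover have "unit_normal X y n" using n by (simp add: unit_normal_iff[OF dX])
  ultimately show False using H by fastforce
qed

section \<open>Charts\<close>

lemma smooth_manifold_chartD:
  assumes "smooth_manifold T A" "c \<in> A"
  shows "openin T (fst c)" "open (chart_image c)"
    "homeomorphic_map (subtopology T (fst c)) (top_of_set (chart_image c)) (snd c)"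
  using assms unfolding smooth_manifold_def by auto

lemma chart_inv_into:
  assumes "y \<in> chart_image c"
  shows "chart_inv c y \<in> fst c" "snd c (chart_inv c y) = y"
  using assms unfolding chart_image_def chart_inv_def by (auto simp: inv_into_into f_inv_into_f)

lemma chart_inv_chart:
  assumes "smooth_manifold T A" "c \<in> A" "r \<in> fst c"
  shows "chart_inv c (snd c r) = r"
proof -
  have "fst c \<subseteq> topspace T" using smooth_manifold_chartD(1)[OF assms(1,2)] by (rule openin_subset)
  then have "inj_on (snd c) (fst c)"
    using homeomorphic_imp_injective_map[OF smooth_manifold_chartD(3)[OF assms(1,2)]]
    by (simp add: Int_absorb1)
  then show ?thesis using assms(3) by (simp add: chart_inv_def)
qed

lemma open_chart_of_openin:
  assumes "smooth_manifold T A" "c \<in> A" "openin T U"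
  shows "open (snd c ` (fst c \<inter> U))"
proof -
  have "openin (subtopology T (fst c)) (fst c \<inter> U)"
    using assms(3) unfolding openin_subtopology by blast
  then have "openin (top_of_set (chart_image c)) (snd c ` (fst c \<inter> U))"
    using homeomorphic_imp_open_map[OF smooth_manifold_chartD(3)[OF assms(1,2)]]
    by (simp add: open_map_def)
  then show ?thesis
    using smooth_manifold_chartD(2)[OF assms(1,2)] openin_open_trans by blast
qed

lemma chart_exists:
  assumes "smooth_manifold T A" "r \<in> topspace T"
  obtains c where "c \<in> A" "r \<in> fst c" "snd c r \<in> chart_image c" "chart_inv c (snd c r) = r"
proof -
  obtain c where "c \<in> A" "r \<in> fst c"
    using assms unfolding smooth_manifold_def by blast
  then show ?thesis
    using that chart_inv_chart[OF assms(1)] by (auto simp: chart_image_def)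
qed

lemma open_chart_preimage:
  assumes "smooth_manifold T A" "c \<in> A" "open W"
  shows "openin T {r \<in> fst c. snd c r \<in> W}"
proof -
  have sub: "fst c \<subseteq> topspace T" using smooth_manifold_chartD(1)[OF assms(1,2)] by (rule openin_subset)
  have "continuous_map (subtopology T (fst c)) (top_of_set (chart_image c)) (snd c)"
    using smooth_manifold_chartD(3)[OF assms(1,2)] by (rule homeomorphic_imp_continuous_map)
  then have "continuous_map (subtopology T (fst c)) euclidean (snd c)"
    by (rule continuous_map_into_fulltopology)
  then have "openin (subtopology T (fst c)) {r \<in> topspace (subtopology T (fst c)). snd c r \<in> W}"
    using assms(3) by (intro openin_continuous_map_preimage) auto
  then have "openin T {r \<in> topspace (subtopology T (fst c)). snd c r \<in> W}"
    using smooth_manifold_chartD(1)[OF assms(1,2)] openin_trans_full by blast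
  then show ?thesis using sub by (simp add: Int_absorb1 Collect_conj_eq)
qed

lemma minimal_hypersurface_minimal_at:
  fixes A :: "('r, 'm::finite) chart set" and F :: "'r \<Rightarrow> real^'n"
  assumes "immersed_minimal_hypersurface T A F" "c \<in> A" "y \<in> chart_image c"
  shows "minimal_at (F \<circ> chart_inv c) y"
proof -
  have sm: "smooth_manifold T A" and im: "immersion A F" and "CARD('n) = CARD('m) + 1"
    and "\<forall>\<nu>. unit_normal (F \<circ> chart_inv c) y \<nu> \<longrightarrow> mean_curvature (F \<circ> chart_inv c) y \<nu> = 0"
    using assms unfolding immersed_minimal_hypersurface_def by auto
  moreover have "twice_differentiable_at (F \<circ> chart_inv c) y"
    using im assms(2,3) smooth_manifold_chartD(2)[OF sm assms(2)]
    unfolding immersion_def smooth_on_def by (blast intro: Ck_on_2_twice_differentiable_at)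
  moreover have "inj (frechet_derivative (F \<circ> chart_inv c) (at y))"
    using im assms(2,3) unfolding immersion_def by blast
  ultimately show ?thesis
    unfolding minimal_at_def by blast
qed

lemma minimal_at_differentiable: "minimal_at X y \<Longrightarrow> X differentiable (at y)"
  unfolding minimal_at_def by (blast dest: twice_differentiable_atD(1))

lemma minimal_hypersurface_continuous:
  assumes "immersed_minimal_hypersurface T A F"
  shows "continuous_map T euclidean F"
proof -
  have sm: "smooth_manifold T A" using assms by (simp add: immersed_minimal_hypersurface_def)
  have "openin T {x \<in> topspace T. F x \<in> W}" if W: "open W" for W
  proof (subst openin_subopen, intro ballI)
    fix x assume x: "x \<in> {x \<in> topspace T. F x \<in> W}"
    obtain c where c: "c \<in> A" "x \<in> fst c"
      using chart_exists[OF sm, of x] x by blast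
    let ?X = "F \<circ> chart_inv c"
    define V where "V = {r \<in> fst c. snd c r \<in> chart_image c \<inter> ?X -` W}"
    have "continuous_on (chart_image c) ?X"
      using minimal_hypersurface_minimal_at[OF assms c(1)]
      by (intro continuous_at_imp_continuous_on ballI differentiable_imp_continuous_within minimal_at_differentiable)
    then have "open (chart_image c \<inter> ?X -` W)"
      using smooth_manifold_chartD(2)[OF sm c(1)] W by (rule continuous_open_preimage)
    then have "openin T V"
      unfolding V_def by (rule open_chart_preimage[OF sm c(1)])
    moreover have "x \<in> V"
      using x c chart_inv_chart[OF sm c(1)] by (auto simp: V_def chart_image_def)
    moreover have "V \<subseteq> {x \<in> topspace T. F x \<in> W}"
      using chart_inv_chart[OF sm c(1)] openin_subset[OF \<open>openin T V\<close>] by (auto simp: V_def)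
    ultimately show "\<exists>V. openin T V \<and> x \<in> V \<and> V \<subseteq> {x \<in> topspace T. F x \<in> W}"
      by blast
  qed
  then show ?thesis by (simp add: continuous_map_def)
qed

section \<open>Second order lower bounds\<close>

text \<open>$(a,H)$ is a second order subjet of $w$ at $x$: the polynomial $w(x)+a\cdot\xi+\frac12\xi\cdot H\xi$ lies
  below $w(x+\xi)$ up to $o(|\xi|^2)$.\<close>

definition subjet :: "(real^'n \<Rightarrow> real) \<Rightarrow> real^'n \<Rightarrow> real^'n \<Rightarrow> real^'n^'n \<Rightarrow> bool" where
  "subjet w x a H \<longleftrightarrow>
     (\<forall>e>0. \<forall>\<^sub>F \<xi> in nhds 0. w x + quadratic a H \<xi> - e * (norm \<xi>)\<^sup>2 \<le> w (x + \<xi>))"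

definition outer :: "real^'n \<Rightarrow> real^'n^'n" where
  "outer a = (\<chi> i j. a $ i * a $ j)"

lemma outer_mult: "outer a *v \<xi> = (a \<bullet> \<xi>) *\<^sub>R a"
  by (simp add: vec_eq_iff outer_def matrix_vector_mult_def inner_vec_def sum_distrib_left sum_distrib_right mult_ac)

lemma trace_outer: "trace (outer a) = a \<bullet> a"
  by (simp add: trace_def outer_def inner_vec_def)

lemma trace_scaleR: "trace (r *\<^sub>R (H :: real^'n^'n)) = r * trace H"
  by (simp add: trace_def sum_distrib_left)

lemma quadratic_bound:
  fixes H :: "real^'n^'n"
  obtains C where "C \<ge> 0" "\<And>a \<xi>. \<bar>quadratic a H \<xi> - a \<bullet> \<xi>\<bar> \<le> C * (norm \<xi>)\<^sup>2"
proof
  let ?B = "onorm (\<lambda>x. H *v x)"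
  show "?B \<ge> 0" by (simp add: onorm_pos_le matrix_vector_mul_bounded_linear)
  show "\<bar>quadratic a H \<xi> - a \<bullet> \<xi>\<bar> \<le> ?B * (norm \<xi>)\<^sup>2" for a \<xi>
  proof -
    have "\<bar>quadratic a H \<xi> - a \<bullet> \<xi>\<bar> \<le> \<bar>\<xi> \<bullet> (H *v \<xi>)\<bar>"
      by (simp add: quadratic_def)
    also have "\<dots> \<le> norm \<xi> * norm (H *v \<xi>)" by (rule Cauchy_Schwarz_ineq2)
    also have "\<dots> \<le> norm \<xi> * (?B * norm \<xi>)"
      by (intro mult_left_mono onorm matrix_vector_mul_bounded_linear) simp
    finally show ?thesis by (simp add: power2_eq_square mult_ac)
  qed
qed

lemma quadratic_combine:
  "quadratic (r *\<^sub>R a) (r *\<^sub>R H + s *\<^sub>R outer b) \<xi> = r * quadratic a H \<xi> + s / 2 * (b \<bullet> \<xi>)\<^sup>2"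
  by (simp add: quadratic_def matrix_vector_mult_add_rdistrib outer_mult inner_add_right power2_eq_square
      inner_commute algebra_simps add_divide_distrib flip: scaleR_matrix_vector_assoc)

text \<open>Substitute the lower bound for $w$ into the Taylor expansion of the increasing function $\psi$. The square of
  $w(x+\xi)-w(x)$ produces the term $(a\cdot\xi)^2$ up to third order errors.\<close>

lemma subjet_compose:
  fixes w :: "real^'n \<Rightarrow> real" and \<psi> :: "real \<Rightarrow> real"
  assumes w: "subjet w x a H" "isCont w x"
    and mono: "\<delta> > 0" "mono_on (ball (w x) \<delta>) \<psi>" "d\<^sub>1 \<ge> 0"
    and \<psi>: "\<And>e. e > 0 \<Longrightarrow> \<forall>\<^sub>F t in nhds 0. \<psi> (w x) + d\<^sub>1 * t + d\<^sub>2 / 2 * t\<^sup>2 - e * t\<^sup>2 \<le> \<psi> (w x + t)"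
  shows "subjet (\<lambda>z. \<psi> (w z)) x (d\<^sub>1 *\<^sub>R a) (d\<^sub>1 *\<^sub>R H + d\<^sub>2 *\<^sub>R outer a)"
  unfolding subjet_def
proof (intro allI impI)
  fix e :: real assume e: "e > 0"
  obtain B where B: "B \<ge> 0" "\<And>\<xi>. \<bar>quadratic a H \<xi> - a \<bullet> \<xi>\<bar> \<le> B * (norm \<xi>)\<^sup>2"
    using quadratic_bound[of H] by metis
  \<comment> \<open>Each of the three sources of error (the lower bound for \<open>w\<close>, the remainder of \<open>\<psi>\<close>, the cubic terms) gets \<open>e / 3\<close>.\<close>
  define e\<^sub>1 where "e\<^sub>1 = e / (3 * (d\<^sub>1 + 1))"
  have e1: "e\<^sub>1 > 0" "d\<^sub>1 * e\<^sub>1 \<le> e / 3" using e mono(3) by (auto simp: e\<^sub>1_def field_simps)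
  define C where "C = B + e\<^sub>1"
  define K where "K = (norm a + C)\<^sup>2"
  define e\<^sub>2 where "e\<^sub>2 = e / (3 * (K + 1))"
  have C: "C > 0" using B e1 by (simp add: C_def)
  have K: "K \<ge> 0" by (simp add: K_def)
  have e2: "e\<^sub>2 > 0" "e\<^sub>2 * K \<le> e / 3" using e K by (auto simp: e\<^sub>2_def field_simps)
  define L where "L = \<bar>d\<^sub>2\<bar> / 2 * (C * (2 * norm a + C))"
  have L: "L \<ge> 0" using C by (simp add: L_def)
  define q where "q \<xi> = quadratic a H \<xi> - e\<^sub>1 * (norm \<xi>)\<^sup>2" for \<xi>
  have q: "\<bar>q \<xi> - a \<bullet> \<xi>\<bar> \<le> C * (norm \<xi>)\<^sup>2" for \<xi>
  proof -
    have "\<bar>q \<xi> - a \<bullet> \<xi>\<bar> \<le> \<bar>quadratic a H \<xi> - a \<bullet> \<xi>\<bar> + \<bar>e\<^sub>1 * (norm \<xi>)\<^sup>2\<bar>"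
      unfolding q_def by linarith
    also have "\<dots> \<le> C * (norm \<xi>)\<^sup>2" using B(2)[of \<xi>] e1 by (simp add: C_def distrib_right)
    finally show ?thesis .
  qed
  have "isCont q 0"
    unfolding q_def quadratic_def
    by (intro continuous_intros linear_continuous_at matrix_vector_mul_bounded_linear) simp
  then have "(q \<longlongrightarrow> q 0) (nhds 0)"
    using tendsto_at_iff_tendsto_nhds[of q 0] unfolding isCont_def by blast
  then have qlim: "(q \<longlongrightarrow> 0) (nhds 0)" by (simp add: q_def quadratic_def)
  have wlim: "((\<lambda>\<xi>. w (x + \<xi>)) \<longlongrightarrow> w x) (nhds 0)"
  proof (rule isCont_tendsto_compose[OF w(2)])
    show "((\<lambda>\<xi>. x + \<xi>) \<longlongrightarrow> x) (nhds 0)"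
      using tendsto_add[OF tendsto_const filterlim_ident, of x 0] by simp
  qed
  have ev1: "\<forall>\<^sub>F \<xi> in nhds 0. w x + quadratic a H \<xi> - e\<^sub>1 * (norm \<xi>)\<^sup>2 \<le> w (x + \<xi>)"
    using w(1) e1(1) unfolding subjet_def by blast
  have ev2: "\<forall>\<^sub>F \<xi> in nhds 0. w (x + \<xi>) \<in> ball (w x) \<delta>"
    using tendstoD[OF wlim mono(1)] by eventually_elim (simp add: dist_commute)
  have ev3: "\<forall>\<^sub>F \<xi> in nhds 0. w x + q \<xi> \<in> ball (w x) \<delta>"
    using tendstoD[OF qlim mono(1)] by eventually_elim (simp add: dist_norm)
  have ev4: "\<forall>\<^sub>F \<xi> in nhds 0. \<psi> (w x) + d\<^sub>1 * q \<xi> + d\<^sub>2 / 2 * (q \<xi>)\<^sup>2 - e\<^sub>2 * (q \<xi>)\<^sup>2 \<le> \<psi> (w x + q \<xi>)"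
    by (rule eventually_compose_filterlim[OF \<psi>[OF e2(1)] qlim])
  have ev5: "\<forall>\<^sub>F \<xi> in nhds (0::real^'n). norm \<xi> < min 1 (e / (3 * (L + 1)))"
    using e L eventually_nhds_metric[of "\<lambda>\<xi>. norm \<xi> < min 1 (e / (3 * (L + 1)))" "0::real^'n"]
    by (auto simp: dist_norm intro!: exI[of _ "min 1 (e / (3 * (L + 1)))"])
  show "\<forall>\<^sub>F \<xi> in nhds 0. \<psi> (w x) + quadratic (d\<^sub>1 *\<^sub>R a) (d\<^sub>1 *\<^sub>R H + d\<^sub>2 *\<^sub>R outer a) \<xi> - e * (norm \<xi>)\<^sup>2
      \<le> \<psi> (w (x + \<xi>))"
    using ev1 ev2 ev3 ev4 ev5
  proof eventually_elim
    case (elim \<xi>)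
    define s where "s = norm \<xi>"
    have s: "s \<ge> 0" "s \<le> 1" "L * s \<le> e / 3"
    proof -
      show "s \<ge> 0" "s \<le> 1" using elim(5) by (auto simp: s_def)
      have "(L + 1) * s \<le> e / 3" using elim(5) L by (simp add: s_def field_simps)
      then show "L * s \<le> e / 3" using \<open>s \<ge> 0\<close> by (simp add: algebra_simps)
    qed
    have aq: "\<bar>a \<bullet> \<xi>\<bar> \<le> norm a * s" by (simp add: s_def Cauchy_Schwarz_ineq2)
    have s2: "s\<^sup>2 \<le> s" using s by (simp add: power2_eq_square mult_left_le_one_le)
    have dq: "\<bar>q \<xi> - a \<bullet> \<xi>\<bar> \<le> C * s\<^sup>2" using q by (simp add: s_def)
    have Cs: "C * s\<^sup>2 \<le> C * s" using s2 C by simp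
    have "\<bar>q \<xi>\<bar> \<le> (norm a + C) * s" using aq dq Cs unfolding distrib_right by linarith
    then have "\<bar>q \<xi>\<bar> \<le> \<bar>(norm a + C) * s\<bar>" by linarith
    then have "(q \<xi>)\<^sup>2 \<le> ((norm a + C) * s)\<^sup>2" by (simp only: abs_le_square_iff)
    then have qq: "(q \<xi>)\<^sup>2 \<le> K * s\<^sup>2" by (simp add: K_def power_mult_distrib)
    have "\<bar>q \<xi> + a \<bullet> \<xi>\<bar> \<le> (2 * norm a + C) * s"
      using aq dq Cs unfolding distrib_right by linarith
    then have "\<bar>q \<xi> - a \<bullet> \<xi>\<bar> * \<bar>q \<xi> + a \<bullet> \<xi>\<bar> \<le> (C * s\<^sup>2) * ((2 * norm a + C) * s)"
      using dq C by (intro mult_mono) auto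
    moreover have "(q \<xi>)\<^sup>2 - (a \<bullet> \<xi>)\<^sup>2 = (q \<xi> - a \<bullet> \<xi>) * (q \<xi> + a \<bullet> \<xi>)"
      by (simp add: power2_eq_square algebra_simps)
    ultimately have "\<bar>(q \<xi>)\<^sup>2 - (a \<bullet> \<xi>)\<^sup>2\<bar> \<le> (C * s\<^sup>2) * ((2 * norm a + C) * s)"
      by (simp add: abs_mult)
    then have "\<bar>d\<^sub>2\<bar> / 2 * \<bar>(q \<xi>)\<^sup>2 - (a \<bullet> \<xi>)\<^sup>2\<bar> \<le> \<bar>d\<^sub>2\<bar> / 2 * ((C * s\<^sup>2) * ((2 * norm a + C) * s))"
      by (intro mult_left_mono) auto
    also have "\<dots> = L * s * s\<^sup>2" by (simp add: L_def)
    also have "\<dots> \<le> e / 3 * s\<^sup>2" using s by (intro mult_right_mono) auto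
    finally have "\<bar>d\<^sub>2 / 2 * ((q \<xi>)\<^sup>2 - (a \<bullet> \<xi>)\<^sup>2)\<bar> \<le> e / 3 * s\<^sup>2"
      unfolding abs_mult by simp
    then have b2: "\<bar>d\<^sub>2 / 2 * (q \<xi>)\<^sup>2 - d\<^sub>2 / 2 * (a \<bullet> \<xi>)\<^sup>2\<bar> \<le> e / 3 * s\<^sup>2"
      by (simp only: right_diff_distrib)
    have b3: "e\<^sub>2 * (q \<xi>)\<^sup>2 \<le> e / 3 * s\<^sup>2"
    proof -
      have "e\<^sub>2 * (q \<xi>)\<^sup>2 \<le> e\<^sub>2 * K * s\<^sup>2" using qq e2 by (simp add: mult.assoc)
      also have "\<dots> \<le> e / 3 * s\<^sup>2" using e2 by (intro mult_right_mono) auto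
      finally show ?thesis .
    qed
    have b1: "d\<^sub>1 * e\<^sub>1 * s\<^sup>2 \<le> e / 3 * s\<^sup>2" using e1 by (intro mult_right_mono) auto
    have "\<psi> (w x + q \<xi>) \<le> \<psi> (w (x + \<xi>))"
      using elim(1,2,3) by (intro mono_onD[OF mono(2)]) (auto simp: q_def)
    moreover have "d\<^sub>1 * q \<xi> = d\<^sub>1 * quadratic a H \<xi> - d\<^sub>1 * e\<^sub>1 * s\<^sup>2"
      by (simp add: q_def s_def algebra_simps)
    moreover have "e * (norm \<xi>)\<^sup>2 = e / 3 * s\<^sup>2 + e / 3 * s\<^sup>2 + e / 3 * s\<^sup>2"
      by (simp add: s_def)
    ultimately show ?case
      using b1 b2 b3 elim(4) unfolding quadratic_combine by linarith
  qed
qed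

lemma subjet_exact:
  assumes "\<And>\<xi>. w (x + \<xi>) = w x + quadratic a H \<xi>"
  shows "subjet w x a H"
  unfolding subjet_def using assms by (auto intro!: always_eventually)

section \<open>A criterion for subharmonicity on minimal hypersurfaces\<close>

text \<open>Suppose that $w\circ F>h$ at a point $x$ of $U$, although $w\circ F\le h$ on the boundary. For small $\eta>0$ the function
  $w\circ F-h+\eta|F|^2$ is smaller on the boundary than at $x$, so its maximum is attained in $U$. A subjet of $w$ there, with
  the Hessian increased by half of what $\eta|x|^2$ contributes, gives a quadratic polynomial whose trace over the tangent
  space is positive, contrary to \<open>no_interior_touching\<close>. The other half absorbs the error term of the subjet.\<close>

lemma subharmonic_if_subjets:
  fixes A :: "('r, 'm::finite) chart set" and F :: "'r \<Rightarrow> real^'n"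
  assumes min: "immersed_minimal_hypersurface T A F"
    and cont: "continuous_map T euclideanreal (\<lambda>r. w (F r))"
    and sub: "\<And>c y. \<lbrakk>c \<in> A; y \<in> chart_image c\<rbrakk> \<Longrightarrow> \<exists>a H. subjet w (F (chart_inv c y)) a H \<and>
        (\<forall>n. unit_normal (F \<circ> chart_inv c) y n \<longrightarrow> n \<bullet> (H *v n) \<le> trace H)"
  shows "subharmonic T A (induced_metric F) (\<lambda>r. ereal (w (F r)))"
  unfolding subharmonic_def
proof (intro conjI allI impI ballI)
  fix x assume "x \<in> topspace T"
  then show "ereal (w (F x)) < \<infinity>" by simp
next
  fix a :: ereal
  show "openin T {x \<in> topspace T. ereal (w (F x)) < a}"
  proof (cases a)
    case (real r)
    then show ?thesis
      using openin_continuous_map_preimage[OF cont, of "{..<r}"] by simp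
  qed auto
next
  have sm: "smooth_manifold T A" and card: "CARD('n) = CARD('m) + 1"
    using min by (simp_all add: immersed_minimal_hypersurface_def)
  fix U h x
  assume "openin T U \<and> connectedin T U \<and> compactin T (T closure_of U) \<and>
        T frontier_of U \<noteq> {} \<and>
        continuous_map (subtopology T (T closure_of U)) euclideanreal h \<and>
        harmonic_on A (induced_metric F) U h \<and>
        (\<forall>x \<in> T frontier_of U. ereal (w (F x)) \<le> ereal (h x))"
  then have U: "openin T U" "compactin T (T closure_of U)"
    and hc: "continuous_map (subtopology T (T closure_of U)) euclideanreal h"
    and harm: "harmonic_on A (induced_metric F) U h"
    and bd: "\<And>x. x \<in> T frontier_of U \<Longrightarrow> w (F x) \<le> h x"
    by auto
  define K where "K = T closure_of U"
  have KT: "K \<subseteq> topspace T" by (simp add: K_def closure_of_subset_topspace)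
  have UK: "U \<subseteq> K" unfolding K_def by (rule closure_of_subset[OF openin_subset[OF U(1)]])
  assume x: "x \<in> U"
  show "ereal (w (F x)) \<le> ereal (h x)"
  proof (rule ccontr)
    assume "\<not> ?thesis"
    then have gap: "w (F x) - h x > 0" by simp
    have Kc: "compactin (subtopology T K) K"
      using U(2) by (simp add: K_def compactin_subtopology)
    have Fc: "continuous_map (subtopology T K) euclidean F"
      by (rule continuous_map_from_subtopology[OF minimal_hypersurface_continuous[OF min]])
    have "compactin euclidean (F ` K)"
      using image_compactin[OF Kc Fc] .
    then have "bounded (F ` K)" by (simp add: compact_imp_bounded)
    then obtain R where R: "R > 0" "\<And>r. r \<in> K \<Longrightarrow> norm (F r) \<le> R"
      by (metis bounded_pos imageI)
    \<comment> \<open>So small that \<open>\<eta> * (norm (F r))\<^sup>2\<close> is at most half of the excess at \<open>x\<close>; the maximum is then not on the boundary.\<close>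
    define \<eta> where "\<eta> = (w (F x) - h x) / (2 * R\<^sup>2)"
    have \<eta>: "\<eta> > 0" using gap R by (simp add: \<eta>_def)
    define \<Phi> where "\<Phi> r = w (F r) - h r + \<eta> * (norm (F r))\<^sup>2" for r
    have "continuous_map (subtopology T K) euclideanreal \<Phi>"
      unfolding \<Phi>_def
      by (intro continuous_map_add continuous_map_diff continuous_map_real_mult continuous_map_real_pow
          continuous_map_norm continuous_map_from_subtopology[OF cont] Fc hc[folded K_def]) auto
    then have "compact (\<Phi> ` K)"
      using image_compactin[OF Kc] by (metis compactin_euclidean_iff)
    moreover have "K \<noteq> {}" using x UK by blast
    ultimately obtain p where p: "p \<in> K" "\<And>r. r \<in> K \<Longrightarrow> \<Phi> r \<le> \<Phi> p"
      using compact_attains_sup[of "\<Phi> ` K"] by (metis (no_types, lifting) image_iff image_is_empty)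
    have pU: "p \<in> U"
    proof (rule ccontr)
      assume "p \<notin> U"
      then have "p \<in> T frontier_of U"
        using p(1) U(1) by (simp add: K_def frontier_of_def interior_of_openin)
      then have "\<Phi> p \<le> \<eta> * (norm (F p))\<^sup>2" using bd by (simp add: \<Phi>_def)
      also have "\<dots> \<le> \<eta> * R\<^sup>2"
        using R(2)[OF p(1)] \<eta> by (intro mult_left_mono power_mono) auto
      also have "\<eta> * R\<^sup>2 = (w (F x) - h x) / 2" using R(1) by (simp add: \<eta>_def)
      also have "\<dots> < w (F x) - h x" using gap by simp
      also have "\<dots> \<le> \<Phi> x" using \<eta> by (simp add: \<Phi>_def)
      also have "\<Phi> x \<le> \<Phi> p" using p(2) x UK by blast
      finally show False by simp
    qed
    obtain c where c: "c \<in> A" "p \<in> fst c" "snd c p \<in> chart_image c" "chart_inv c (snd c p) = p"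
      using chart_exists[OF sm] p(1) KT by blast
    define X where "X = F \<circ> chart_inv c"
    define y where "y = snd c p"
    define V where "V = snd c ` (fst c \<inter> U)"
    have y: "y \<in> V" "y \<in> chart_image c" "chart_inv c y = p"
      using c pU by (auto simp: y_def V_def)
    have Xy: "X y = F p" by (simp add: X_def y)
    have Vopen: "open V" unfolding V_def by (rule open_chart_of_openin[OF sm c(1) U(1)])
    have Vinv: "chart_inv c z \<in> U" if "z \<in> V" for z
      using that chart_inv_chart[OF sm c(1)] by (auto simp: V_def)
    obtain a H where aH: "subjet w (F p) a H" and
      nn: "\<And>n. unit_normal X y n \<Longrightarrow> n \<bullet> (H *v n) \<le> trace H"
      using sub[OF c(1) y(2)] unfolding X_def y(3) by blast
    have mX: "minimal_at X y"
      unfolding X_def by (rule minimal_hypersurface_minimal_at[OF min c(1) y(2)])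
    define H' where "H' = H + \<eta> *\<^sub>R mat 1"
    define a' where "a' = a + (2 * \<eta>) *\<^sub>R F p"
    have q': "quadratic a' H' \<xi> = quadratic a H \<xi> + 2 * \<eta> * (F p \<bullet> \<xi>) + \<eta> / 2 * (norm \<xi>)\<^sup>2" for \<xi>
      by (simp add: quadratic_def a'_def H'_def inner_add_left inner_add_right matrix_vector_mult_add_rdistrib
          power2_norm_eq_inner add_divide_distrib flip: scaleR_matrix_vector_assoc)
    have hV: "Ck_on 2 V (h \<circ> chart_inv c)" "laplace_beltrami (first_fundamental_form X) (h \<circ> chart_inv c) y = 0"
      using harm c(1) y(1) unfolding harmonic_on_def V_def induced_metric_def X_def by blast+
    have pos: "trace H' - n \<bullet> (H' *v n) > 0" if "unit_normal X y n" for n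
    proof -
      have "norm n = 1" using that by (simp add: unit_normal_def)
      then have "n \<bullet> n = 1" by (simp add: norm_eq_1)
      moreover have "trace (mat 1 :: real^'n^'n) = CARD('n)" by (simp add: trace_def mat_def)
      ultimately have "trace H' - n \<bullet> (H' *v n) = trace H - n \<bullet> (H *v n) + \<eta> * CARD('m)"
        using card by (simp add: H'_def trace_add trace_scaleR matrix_vector_mult_add_rdistrib inner_add_right
            algebra_simps flip: scaleR_matrix_vector_assoc)
      then show ?thesis using nn[OF that] \<eta> by (simp add: add_nonneg_pos)
    qed
    have "isCont X y" using minimal_at_differentiable[OF mX] by (rule differentiable_imp_continuous_within)
    then have "((\<lambda>z. X z - X y) \<longlongrightarrow> X y - X y) (nhds y)"
      using tendsto_at_iff_tendsto_nhds[of X y] unfolding isCont_def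
      by (intro tendsto_diff tendsto_const) blast
    then have lim: "((\<lambda>z. X z - X y) \<longlongrightarrow> 0) (nhds y)" by simp
    have "\<forall>\<^sub>F \<xi> in nhds 0. w (F p) + quadratic a H \<xi> - \<eta> / 2 * (norm \<xi>)\<^sup>2 \<le> w (F p + \<xi>)"
      using aH[unfolded subjet_def, rule_format, OF half_gt_zero[OF \<eta>]] .
    then have "\<forall>\<^sub>F z in nhds y. w (F p) + quadratic a H (X z - X y) - \<eta> / 2 * (norm (X z - X y))\<^sup>2
        \<le> w (F p + (X z - X y))"
      using lim by (rule eventually_compose_filterlim)
    moreover have "\<forall>\<^sub>F z in nhds y. z \<in> V" using Vopen y(1) by (rule eventually_nhds_in_open)
    ultimately have "\<forall>\<^sub>F z in nhds y. quadratic a' H' (X z - X y) - (h \<circ> chart_inv c) z \<le> - (h \<circ> chart_inv c) y"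
    proof eventually_elim
      case (elim z)
      define \<xi> where "\<xi> = X z - X y"
      have "\<Phi> (chart_inv c z) \<le> \<Phi> p" using p(2) Vinv[OF elim(2)] UK by blast
      moreover have "F (chart_inv c z) = F p + \<xi>" by (simp add: \<xi>_def Xy) (simp add: X_def)
      moreover have "(norm (F p + \<xi>))\<^sup>2 = (norm (F p))\<^sup>2 + 2 * (F p \<bullet> \<xi>) + (norm \<xi>)\<^sup>2"
        by (simp add: power2_norm_eq_inner inner_add_left inner_add_right inner_commute)
      ultimately have "w (F p + \<xi>) - h (chart_inv c z) + \<eta> * ((norm (F p))\<^sup>2 + 2 * (F p \<bullet> \<xi>) + (norm \<xi>)\<^sup>2)
          \<le> w (F p) - h p + \<eta> * (norm (F p))\<^sup>2"
        by (simp add: \<Phi>_def)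
      then have "quadratic a' H' \<xi> - h (chart_inv c z) \<le> - h p"
        using elim(1) unfolding q' \<xi>_def[symmetric] by (simp add: algebra_simps)
      then show ?case by (simp add: \<xi>_def y(3))
    qed
    then show False
      using no_interior_touching[OF mX Ck_on_2_twice_differentiable_at[OF hV(1) Vopen y(1)] hV(2) pos] by blast
  qed
qed

section \<open>The distance to a minimal hypersurface\<close>

text \<open>$|\alpha\nu-z|^2\le\beta^2+|z|^2\le(\beta+|z|^2/2\beta)^2$ for $\beta=\alpha-\nu\cdot z$: to first order only the normal
  component of $z$ changes the length.\<close>

lemma norm_unit_normal_shift:
  fixes \<nu> z :: "'a::real_inner"
  assumes \<nu>: "norm \<nu> = 1" and \<beta>: "\<beta> > 0" "\<alpha> - \<nu> \<bullet> z = \<beta>"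
  shows "norm (\<alpha> *\<^sub>R \<nu> - z) \<le> \<beta> + (norm z)\<^sup>2 / (2 * \<beta>)"
proof (rule power2_le_imp_le)
  have nn: "\<nu> \<bullet> \<nu> = 1" using \<nu> by (simp add: norm_eq_1)
  have "(norm (\<alpha> *\<^sub>R \<nu> - z))\<^sup>2 = (\<alpha> - \<nu> \<bullet> z)\<^sup>2 + (norm z)\<^sup>2 - (\<nu> \<bullet> z)\<^sup>2"
    unfolding power2_norm_eq_inner
    by (simp add: inner_diff_left inner_diff_right nn inner_commute power2_eq_square algebra_simps)
  also have "\<dots> \<le> \<beta>\<^sup>2 + (norm z)\<^sup>2" using \<beta>(2) by simp
  also have "\<dots> \<le> (\<beta> + (norm z)\<^sup>2 / (2 * \<beta>))\<^sup>2"
    using \<beta>(1) by (simp add: power2_sum)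
  finally show "(norm (\<alpha> *\<^sub>R \<nu> - z))\<^sup>2 \<le> (\<beta> + (norm z)\<^sup>2 / (2 * \<beta>))\<^sup>2" .
qed (use \<beta> in simp)

text \<open>The point $y$ minimizes the distance of $X$ to the centre $X(y)+s\nu$ of the ball; these are the first and second
  derivative tests for the squared distance.\<close>

lemma minimal_touched_by_ball:
  fixes X :: "real^'m::finite \<Rightarrow> real^'n"
  assumes X: "twice_differentiable_at X y" and \<nu>: "norm \<nu> = 1"
    and s: "s > 0" and ball: "\<forall>\<^sub>F z in nhds y. s \<le> norm (X z - (X y + s *\<^sub>R \<nu>))"
  shows "frechet_derivative X (at y) v \<bullet> \<nu> = 0"
    and "s * (second_derivative X y v v \<bullet> \<nu>) \<le> (norm (frechet_derivative X (at y) v))\<^sup>2"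
proof -
  define a where "a = - (2 * s) *\<^sub>R \<nu>"
  define H :: "real^'n^'n" where "H = 2 *\<^sub>R mat 1"
  define q where "q z = quadratic a H (X z - X y)" for z
  note q = quadratic_compose_second_derivative[OF X, of a H, folded q_def[abs_def]]
  have "q y \<le> q z" if "s \<le> norm (X z - (X y + s *\<^sub>R \<nu>))" for z
  proof -
    have "s\<^sup>2 \<le> (norm ((X z - X y) - s *\<^sub>R \<nu>))\<^sup>2"
      using that s by (intro power_mono) (auto simp: diff_diff_eq)
    also have "\<dots> = (norm (X z - X y))\<^sup>2 - 2 * s * (\<nu> \<bullet> (X z - X y)) + s\<^sup>2 * (norm \<nu>)\<^sup>2"
      unfolding power2_norm_eq_inner by (simp add: inner_diff_left inner_diff_right inner_commute power2_eq_square algebra_simps)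
    finally have "0 \<le> (norm (X z - X y))\<^sup>2 - 2 * s * (\<nu> \<bullet> (X z - X y))"
      by (simp add: \<nu>)
    also have "\<dots> = q z"
      by (simp add: q_def quadratic_def a_def H_def power2_norm_eq_inner flip: scaleR_matrix_vector_assoc)
    finally show ?thesis by (simp add: q_def quadratic_def)
  qed
  then have "\<forall>\<^sub>F z in nhds y. q y \<le> q z"
    using ball by (rule eventually_mono[rotated])
  note m = local_min_second_order[OF q(1) this]
  show tan: "frechet_derivative X (at y) v \<bullet> \<nu> = 0" for v
    using q(2)[of v] m(1) s by (simp add: a_def inner_commute)
  show "s * (second_derivative X y v v \<bullet> \<nu>) \<le> (norm (frechet_derivative X (at y) v))\<^sup>2"
    using q(3)[of v] m(2)[of v] unfolding power2_norm_eq_inner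
    by (simp add: a_def H_def inner_commute flip: scaleR_matrix_vector_assoc)
qed

lemma infdist_attained:
  fixes M :: "'a::heine_borel set"
  assumes "closed M" "M \<noteq> {}"
  obtains p where "p \<in> M" "dist x p = infdist x M"
  using infdist_attains_inf[OF assms] by metis

text \<open>The distance of $x+\xi$ is estimated by the distance to the point $X(y+L\xi)$ of $M$, where $L$ is linear and
  $DX\circ L$ is the orthogonal projection to the tangent space of $M$ at $p$. To first order $x+\xi-X(y+L\xi)$ is a multiple
  of $\nu$, and the second order part of $X(y+L\xi)$ contributes the second fundamental form
  $B(\xi,\xi)=D^2X(L\xi,L\xi)\cdot\nu$. Its trace vanishes by minimality, and the bound comes from the balls of radius $s<\epsilon$
  that touch $M$ at $p$.\<close>

lemma distance_subjet:
  fixes M :: "(real^'n) set" and A :: "(real^'n, 'm::finite) chart set"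
  assumes M: "properly_embedded_minimal_hypersurface M A" and un: "unique_nearest_points M \<epsilon>"
    and x: "0 < infdist x M" "infdist x M < \<epsilon>"
  obtains \<nu> B where "norm \<nu> = 1" "subjet (\<lambda>z. - infdist z M) x (- \<nu>) B" "trace B = 0"
    "\<And>n. norm n = 1 \<Longrightarrow> \<epsilon> * (n \<bullet> (B *v n)) \<le> 1 - (n \<bullet> \<nu>)\<^sup>2"
proof -
  have cl: "closed M" and min: "immersed_minimal_hypersurface (top_of_set M) A (\<lambda>x. x)"
    using M by (auto simp: properly_embedded_minimal_hypersurface_def)
  have sm: "smooth_manifold (top_of_set M) A" and card: "CARD('n) = CARD('m) + 1" and ne: "M \<noteq> {}"
    using min by (auto simp: immersed_minimal_hypersurface_def)
  obtain p where p: "p \<in> M" "dist x p = infdist x M" using infdist_attained[OF cl ne] .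
  define t where "t = infdist x M"
  define \<nu> where "\<nu> = (x - p) /\<^sub>R t"
  have t: "t > 0" "t < \<epsilon>" using x by (auto simp: t_def)
  have \<nu>: "norm \<nu> = 1" using p(2) t by (simp add: \<nu>_def t_def dist_norm)
  then have \<nu>\<nu>: "\<nu> \<bullet> \<nu> = 1" by (simp add: norm_eq_1)
  have xp: "x = p + t *\<^sub>R \<nu>" using t by (simp add: \<nu>_def)
  have dt: "infdist (p + t *\<^sub>R \<nu>) M = t" unfolding xp[symmetric] by (simp add: t_def)
  obtain c where c: "c \<in> A" "p \<in> fst c" "snd c p \<in> chart_image c" "chart_inv c (snd c p) = p"
    using chart_exists[OF sm, of p] p(1) by auto
  define X where "X = chart_inv c"
  define y where "y = snd c p"
  have Xy: "X y = p" using c by (simp add: X_def y_def)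
  have mX: "minimal_at X y"
    using minimal_hypersurface_minimal_at[OF min c(1) c(3)] by (simp add: X_def y_def o_def)
  have X: "twice_differentiable_at X y" and inj: "inj (frechet_derivative X (at y))"
    using mX by (auto simp: minimal_at_def)
  note dX = twice_differentiable_atD(1)[OF X]
  let ?D = "frechet_derivative X (at y)"
  let ?D2 = "second_derivative X y"
  have cI: "open (chart_image c)" using smooth_manifold_chartD(2)[OF sm c(1)] .
  have "fst c \<subseteq> M"
    using openin_subset[OF smooth_manifold_chartD(1)[OF sm c(1)]] by simp
  then have XM: "X z \<in> M" if "z \<in> chart_image c" for z
    using chart_inv_into(1)[OF that] by (auto simp: X_def)
  have near: "\<forall>\<^sub>F z in nhds y. z \<in> chart_image c"
    using eventually_nhds_in_open[OF cI c(3)] by (simp add: y_def)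
  have ball: "\<forall>\<^sub>F z in nhds y. s \<le> norm (X z - (X y + s *\<^sub>R \<nu>))" if s: "0 < s" "s < \<epsilon>" for s
    using near
  proof eventually_elim
    case (elim z)
    have "infdist (p + s *\<^sub>R \<nu>) M = s"
      using normal_segment_full_length[OF cl ne un p(1) \<nu> t(1) dt _ s(2)] s by simp
    then show ?case
      using infdist_le[OF XM[OF elim], of "p + s *\<^sub>R \<nu>"] by (simp add: Xy dist_norm norm_minus_commute)
  qed
  have tan: "?D v \<bullet> \<nu> = 0" for v
    using minimal_touched_by_ball(1)[OF X \<nu> t(1) ball[OF t]] .
  have curv: "\<epsilon> * (?D2 v v \<bullet> \<nu>) \<le> (norm (?D v))\<^sup>2" for v
  proof (rule tendsto_upperbound)
    show "((\<lambda>s. s * (?D2 v v \<bullet> \<nu>)) \<longlongrightarrow> \<epsilon> * (?D2 v v \<bullet> \<nu>)) (at_left \<epsilon>)"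
      by (intro tendsto_intros)
    have "\<forall>\<^sub>F s in at_left \<epsilon>. 0 < s \<and> s < \<epsilon>"
      using t eventually_at_left_real[of 0 \<epsilon>] by simp
    then show "\<forall>\<^sub>F s in at_left \<epsilon>. s * (?D2 v v \<bullet> \<nu>) \<le> (norm (?D v))\<^sup>2"
    proof eventually_elim
      case (elim s)
      then show ?case using minimal_touched_by_ball(2)[OF X \<nu> _ ball, of s v] by simp
    qed
  qed simp
  obtain E :: "'m \<Rightarrow> real^'m" where E: "orthonormal_frame (\<lambda>k. ?D (E k))"
      "\<And>i j. matrix_inv (first_fundamental_form X y) $ i $ j = (\<Sum>k\<in>UNIV. E k $ i * E k $ j)"
    by (rule exists_tangent_frame[OF dX inj]) (rule that)
  define L where "L \<xi> = (\<Sum>k\<in>UNIV. (\<xi> \<bullet> ?D (E k)) *\<^sub>R E k)" for \<xi>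
  have linL: "linear L"
    unfolding L_def by (rule linearI) (simp_all add: inner_add_left scaleR_add_left sum.distrib scaleR_sum_right)
  note linD = frechet_derivative_linear[OF dX]
  have DL: "?D (L \<xi>) = \<xi> - (\<xi> \<bullet> \<nu>) *\<^sub>R \<nu>" for \<xi>
  proof -
    have "?D (L \<xi>) = (\<Sum>k\<in>UNIV. (\<xi> \<bullet> ?D (E k)) *\<^sub>R ?D (E k))"
      by (simp add: L_def linear_sum[OF linD] linear_cmul[OF linD])
    then show ?thesis
      using frame_and_normal_expand[OF card E(1) \<nu> tan, of \<xi>] by (simp add: eq_diff_eq)
  qed
  have bil: "bilinear ?D2" by (rule second_derivative_bilinear[OF X])
  define B :: "real^'n^'n" where "B = (\<chi> i j. ?D2 (L (axis i 1)) (L (axis j 1)) \<bullet> \<nu>)"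
  have BL: "\<xi> \<bullet> (B *v \<xi>) = ?D2 (L \<xi>) (L \<xi>) \<bullet> \<nu>" for \<xi>
  proof -
    have "L \<xi> = L (\<Sum>i\<in>UNIV. \<xi> $ i *\<^sub>R axis i 1)"
      by (simp add: basis_expansion flip: scalar_mult_eq_scaleR)
    then have "L \<xi> = (\<Sum>i\<in>UNIV. \<xi> $ i *\<^sub>R L (axis i 1))"
      by (simp add: linear_sum[OF linL] linear_cmul[OF linL])
    then have "?D2 (L \<xi>) (L \<xi>) \<bullet> \<nu> = ?D2 (\<Sum>i\<in>UNIV. \<xi> $ i *\<^sub>R L (axis i 1)) (\<Sum>i\<in>UNIV. \<xi> $ i *\<^sub>R L (axis i 1)) \<bullet> \<nu>"
      by simp
    also have "\<dots> = (\<Sum>i\<in>UNIV. \<Sum>j\<in>UNIV. \<xi> $ i * (\<xi> $ j * (?D2 (L (axis i 1)) (L (axis j 1)) \<bullet> \<nu>)))"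
      by (simp add: bilinear_sum[OF bil] bilinear_lmul[OF bil] bilinear_rmul[OF bil] inner_sum_left
          sum.cartesian_product case_prod_unfold mult_ac)
    also have "\<dots> = \<xi> \<bullet> (B *v \<xi>)"
      by (simp add: inner_vec_def matrix_vector_mult_def B_def sum_distrib_left mult_ac)
    finally show ?thesis by simp
  qed
  show ?thesis
  proof (rule that[OF \<nu>])
    have LE: "L (?D (E k)) = E k" for k
      using E(1) by (simp add: L_def orthonormal_frame_def if_distrib[of "\<lambda>r. r *\<^sub>R _"] cong: if_cong)
    have L\<nu>: "L \<nu> = 0" using tan by (simp add: L_def inner_commute)
    have "unit_normal X y \<nu>" using \<nu> tan by (simp add: unit_normal_iff[OF dX])
    then have "mean_curvature X y \<nu> = 0" using mX by (simp add: minimal_at_def)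
    then have "(\<Sum>k\<in>UNIV. ?D2 (E k) (E k) \<bullet> \<nu>) = 0"
      by (simp add: mean_curvature_frame[OF X E(2)] inner_sum_left)
    then have "(\<Sum>k\<in>UNIV. ?D (E k) \<bullet> (B *v ?D (E k))) = 0"
      by (simp add: BL LE)
    then show "trace B = 0"
      using trace_along_frame[OF card E(1) \<nu> tan, of B] BL[of \<nu>] by (simp add: L\<nu> bilinear_lzero[OF bil])
    show "\<epsilon> * (n \<bullet> (B *v n)) \<le> 1 - (n \<bullet> \<nu>)\<^sup>2" if "norm n = 1" for n
    proof -
      have "n \<bullet> n = 1" using that by (simp add: norm_eq_1)
      then have "(norm (?D (L n)))\<^sup>2 = 1 - (n \<bullet> \<nu>)\<^sup>2"
        unfolding power2_norm_eq_inner DL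
        by (simp add: inner_diff_left inner_diff_right \<nu>\<nu> inner_commute power2_eq_square)
      then show ?thesis using curv[of "L n"] by (simp add: BL)
    qed
    show "subjet (\<lambda>z. - infdist z M) x (- \<nu>) B"
      unfolding subjet_def
    proof (intro allI impI)
      fix e :: real assume e: "e > 0"
      obtain K where K: "K > 0" "\<And>\<xi>. norm (L \<xi>) \<le> K * norm \<xi>"
        using linear_bounded_pos[OF linL] by blast
      obtain C where C: "C > 0" "\<And>v w. norm (?D2 v w) \<le> C * norm v * norm w"
        using bilinear_bounded_pos[OF bil] by blast
      define e' where "e' = e / (2 * K\<^sup>2)"
      have e': "e' > 0" "e' * K\<^sup>2 = e / 2" using e K by (auto simp: e'_def)
      define Q where "Q = (C + e') * K\<^sup>2"
      have Q: "Q > 0" using C e' K by (simp add: Q_def)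
      have Llim: "(L \<longlongrightarrow> 0) (nhds 0)"
      proof -
        have "isCont L 0" using linear_continuous_at[of L 0] linL by (simp add: linear_conv_bounded_linear)
        then show ?thesis
          using tendsto_at_iff_tendsto_nhds[of L 0] linear_0[OF linL] unfolding isCont_def by simp
      qed
      then have yL: "((\<lambda>\<xi>. y + L \<xi>) \<longlongrightarrow> y) (nhds 0)"
        using tendsto_add[OF tendsto_const Llim, of y] by simp
      have ev1: "\<forall>\<^sub>F \<xi> in nhds 0. y + L \<xi> \<in> chart_image c"
        using near yL by (rule eventually_compose_filterlim)
      have ev2: "\<forall>\<^sub>F \<xi> in nhds 0. norm (X (y + L \<xi>) - X y - ?D (L \<xi>) - (1/2) *\<^sub>R ?D2 (L \<xi>) (L \<xi>)) \<le> e' * (norm (L \<xi>))\<^sup>2"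
        using Taylor_second_order[OF X e'(1)] Llim by (rule eventually_compose_filterlim)
      \<comment> \<open>The second entry keeps the normal component above \<open>t / 2\<close>, the third makes the square of the tangential one negligible.\<close>
      define d where "d = min 1 (min (t / (2 * (1 + Q))) (e * t / (2 * Q\<^sup>2)))"
      have d: "d > 0" using e t Q by (simp add: d_def)
      have ev3: "\<forall>\<^sub>F \<xi> in nhds (0::real^'n). norm \<xi> < d"
        using d unfolding eventually_nhds_metric by (auto simp: dist_norm)
      show "\<forall>\<^sub>F \<xi> in nhds 0. - infdist x M + quadratic (- \<nu>) B \<xi> - e * (norm \<xi>)\<^sup>2 \<le> - infdist (x + \<xi>) M"
        using ev1 ev2 ev3
      proof eventually_elim
        case (elim \<xi>)
        define s where "s = norm \<xi>"
        have s: "s \<ge> 0" "s \<le> 1" "s \<le> t / (2 * (1 + Q))" "s \<le> e * t / (2 * Q\<^sup>2)"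
          using elim(3) by (auto simp: s_def d_def)
        have s2: "s\<^sup>2 \<le> s" using s by (simp add: power2_eq_square mult_left_le_one_le)
        define \<rho> where "\<rho> = X (y + L \<xi>) - X y - ?D (L \<xi>) - (1/2) *\<^sub>R ?D2 (L \<xi>) (L \<xi>)"
        define z where "z = (1/2) *\<^sub>R ?D2 (L \<xi>) (L \<xi>) + \<rho>"
        have L2: "(norm (L \<xi>))\<^sup>2 \<le> K\<^sup>2 * s\<^sup>2"
          using power_mono[OF K(2)[of \<xi>], of 2] by (simp add: s_def power_mult_distrib)
        have \<rho>: "norm \<rho> \<le> e' * K\<^sup>2 * s\<^sup>2"
        proof -
          have "norm \<rho> \<le> e' * (norm (L \<xi>))\<^sup>2" using elim(2) by (simp add: \<rho>_def)
          also have "\<dots> \<le> e' * (K\<^sup>2 * s\<^sup>2)" using L2 e' by (intro mult_left_mono) auto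
          finally show ?thesis by (simp add: mult.assoc)
        qed
        have D2b: "norm (?D2 (L \<xi>) (L \<xi>)) \<le> C * K\<^sup>2 * s\<^sup>2"
        proof -
          have "norm (?D2 (L \<xi>) (L \<xi>)) \<le> C * (norm (L \<xi>))\<^sup>2" using C(2)[of "L \<xi>" "L \<xi>"] by (simp add: power2_eq_square)
          also have "\<dots> \<le> C * (K\<^sup>2 * s\<^sup>2)" using L2 C by (intro mult_left_mono) auto
          finally show ?thesis by (simp add: mult.assoc)
        qed
        have "norm z \<le> norm ((1/2) *\<^sub>R ?D2 (L \<xi>) (L \<xi>)) + norm \<rho>" unfolding z_def by (rule norm_triangle_ineq)
        also have "\<dots> \<le> Q * s\<^sup>2"
        proof -
          have "norm ((1/2) *\<^sub>R ?D2 (L \<xi>) (L \<xi>)) \<le> norm (?D2 (L \<xi>) (L \<xi>))" by simp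
          then show ?thesis using \<rho> D2b unfolding Q_def distrib_right by linarith
        qed
        finally have z: "norm z \<le> Q * s\<^sup>2" .
        have "\<bar>\<nu> \<bullet> z\<bar> \<le> norm z" using Cauchy_Schwarz_ineq2[of \<nu> z] \<nu> by simp
        moreover have "\<bar>\<xi> \<bullet> \<nu>\<bar> \<le> s" using Cauchy_Schwarz_ineq2[of \<xi> \<nu>] \<nu> by (simp add: s_def)
        moreover have "Q * s\<^sup>2 \<le> Q * s" using s2 Q by simp
        moreover have "(1 + Q) * s \<le> t / 2" using s(3) Q by (simp add: field_simps)
        ultimately have \<beta>: "t / 2 \<le> t + \<xi> \<bullet> \<nu> - \<nu> \<bullet> z"
          using z unfolding distrib_right by linarith
        define \<beta> where "\<beta> = t + \<xi> \<bullet> \<nu> - \<nu> \<bullet> z"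
        have \<beta>t: "\<beta> \<ge> t / 2" "\<beta> > 0" using \<beta> t by (auto simp: \<beta>_def)
        have "infdist (x + \<xi>) M \<le> norm (x + \<xi> - X (y + L \<xi>))"
          using infdist_le[OF XM[OF elim(1)], of "x + \<xi>"] by (simp add: dist_norm)
        also have "x + \<xi> - X (y + L \<xi>) = (t + \<xi> \<bullet> \<nu>) *\<^sub>R \<nu> - z"
          unfolding z_def \<rho>_def DL Xy xp by (simp add: algebra_simps)
        also have "norm \<dots> \<le> \<beta> + (norm z)\<^sup>2 / (2 * \<beta>)"
          by (rule norm_unit_normal_shift[OF \<nu> \<beta>t(2)]) (simp add: \<beta>_def)
        also have "(norm z)\<^sup>2 / (2 * \<beta>) \<le> (Q * s\<^sup>2)\<^sup>2 / t"
          using z \<beta>t t by (intro frac_le power_mono) auto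
        also have "(Q * s\<^sup>2)\<^sup>2 / t \<le> e / 2 * s\<^sup>2"
        proof -
          have "Q\<^sup>2 * s\<^sup>2 \<le> Q\<^sup>2 * s" using s2 by (intro mult_left_mono) auto
          also have "\<dots> \<le> e * t / 2" using s(4) Q by (simp add: field_simps)
          finally have "Q\<^sup>2 * s\<^sup>2 * s\<^sup>2 \<le> e * t / 2 * s\<^sup>2" by (intro mult_right_mono) auto
          then show ?thesis using t by (simp add: pos_divide_le_eq power_mult_distrib mult_ac power2_eq_square)
        qed
        finally have d1: "infdist (x + \<xi>) M \<le> \<beta> + e / 2 * s\<^sup>2" by simp
        have "\<bar>\<nu> \<bullet> \<rho>\<bar> \<le> norm \<rho>" using Cauchy_Schwarz_ineq2[of \<nu> \<rho>] \<nu> by simp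
        moreover have "norm \<rho> \<le> e / 2 * s\<^sup>2" using \<rho> e' by simp
        moreover have "\<nu> \<bullet> z = (\<xi> \<bullet> (B *v \<xi>)) / 2 + \<nu> \<bullet> \<rho>"
          by (simp add: z_def BL inner_add_right inner_commute)
        ultimately have "\<beta> \<le> t + \<xi> \<bullet> \<nu> - (\<xi> \<bullet> (B *v \<xi>)) / 2 + e / 2 * s\<^sup>2"
          unfolding \<beta>_def by linarith
        then have "infdist (x + \<xi>) M \<le> t - quadratic (- \<nu>) B \<xi> + e * s\<^sup>2"
          using d1 unfolding quadratic_def by (simp add: inner_commute)
        then show ?case by (simp add: t_def s_def)
      qed
    qed
  qed
qed

section \<open>Parabolic minimal hypersurfaces at constant distance\<close>

lemma subjet_translate:
  "subjet w (x - v) a H \<Longrightarrow> subjet (\<lambda>z. w (z - v)) x a H"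
  unfolding subjet_def by (simp add: algebra_simps)

text \<open>\<open>Taylor_second_order\<close> in terms of real derivatives, in the form that \<open>subjet_compose\<close> asks for.\<close>

lemma Taylor_lower_real:
  fixes \<psi> \<psi>' :: "real \<Rightarrow> real"
  assumes d1: "\<forall>\<^sub>F z in nhds s. (\<psi> has_real_derivative \<psi>' z) (at z)"
    and d2: "(\<psi>' has_real_derivative d\<^sub>2) (at s)" and e: "e > 0"
  shows "\<forall>\<^sub>F t in nhds 0. \<psi> s + \<psi>' s * t + d\<^sub>2 / 2 * t\<^sup>2 - e * t\<^sup>2 \<le> \<psi> (s + t)"
proof -
  have fr: "\<forall>\<^sub>F z in nhds s. \<psi>' z * v = frechet_derivative \<psi> (at z) v" for v
    using d1 by eventually_elim (metis frechet_derivative_at has_field_derivative_def)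
  have D: "((\<lambda>z. frechet_derivative \<psi> (at z) v) has_derivative (\<lambda>w. d\<^sub>2 * w * v)) (at s)" for v
    using fr by (rule has_derivative_transform_nhds[rotated])
      (use d2 in \<open>auto intro!: derivative_eq_intros simp: has_field_derivative_def\<close>)
  have tw: "twice_differentiable_at \<psi> s"
    unfolding twice_differentiable_at_def
  proof (intro conjI allI)
    show "\<forall>\<^sub>F z in nhds s. \<psi> differentiable (at z)"
      using d1 by eventually_elim (auto simp: differentiable_def has_field_derivative_def)
    show "(\<lambda>z. frechet_derivative \<psi> (at z) v) differentiable (at s)" for v
      using D differentiable_def by blast
  qed
  have 1: "frechet_derivative \<psi> (at s) t = \<psi>' s * t" for t
    using eventually_nhds_x_imp_x[OF fr] by simp
  have 2: "second_derivative \<psi> s t t = d\<^sub>2 * t * t" for t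
    unfolding second_derivative_def frechet_derivative_at[OF D, symmetric] ..
  show ?thesis
    using Taylor_second_order[OF tw e] unfolding 1 2
    by eventually_elim (simp add: power2_eq_square abs_le_iff)
qed

text \<open>With $c=\epsilon-\delta(x)$, the Hessian of $(\epsilon-\delta)^2$ is $2cB+2\nu\nu^T$; over the hyperplane $n^\perp$ its trace is
  $2(1-(n\cdot\nu)^2)-2cB(n,n)$, which is nonnegative because $cB(n,n)\le\epsilon B(n,n)\le1-(n\cdot\nu)^2$ if $B(n,n)>0$.
  Where $\delta\ge\epsilon$ the function is minimal and $0$ is a subjet.\<close>

lemma subjet_squared_depth:
  fixes M :: "(real^'n) set" and A :: "(real^'n, 'm::finite) chart set"
  assumes M: "properly_embedded_minimal_hypersurface M A" and un: "unique_nearest_points M \<epsilon>"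
    and \<epsilon>: "\<epsilon> > 0" and x: "0 < infdist x M"
  obtains a H where "subjet (\<lambda>z. (max 0 (\<epsilon> - infdist z M))\<^sup>2 - k) x a H"
    "\<And>n. norm n = 1 \<Longrightarrow> n \<bullet> (H *v n) \<le> trace H"
proof (cases "infdist x M < \<epsilon>")
  case False
  have "subjet (\<lambda>z. (max 0 (\<epsilon> - infdist z M))\<^sup>2 - k) x 0 0"
    unfolding subjet_def
  proof (intro allI impI always_eventually)
    fix e :: real and \<xi> :: "real^'n" assume "e > 0"
    then have "0 \<le> e * (norm \<xi>)\<^sup>2" by simp
    then have "- (e * (norm \<xi>)\<^sup>2) \<le> (max 0 (\<epsilon> - infdist (x + \<xi>) M))\<^sup>2"
      using zero_le_power2[of "max 0 (\<epsilon> - infdist (x + \<xi>) M)"] by linarith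
    then show "(max 0 (\<epsilon> - infdist x M))\<^sup>2 - k + quadratic 0 0 \<xi> - e * (norm \<xi>)\<^sup>2
        \<le> (max 0 (\<epsilon> - infdist (x + \<xi>) M))\<^sup>2 - k"
      using False by (simp add: quadratic_def)
  qed
  then show ?thesis by (rule that) (simp add: trace_def)
next
  case True
  obtain \<nu> B where B: "norm \<nu> = 1" "subjet (\<lambda>z. - infdist z M) x (- \<nu>) B" "trace B = 0"
    "\<And>n. norm n = 1 \<Longrightarrow> \<epsilon> * (n \<bullet> (B *v n)) \<le> 1 - (n \<bullet> \<nu>)\<^sup>2"
    using distance_subjet[OF M un x True] by blast
  define c where "c = \<epsilon> - infdist x M"
  have c: "0 < c" "c \<le> \<epsilon>" using True infdist_nonneg[of x M] by (auto simp: c_def)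
  define \<psi> where "\<psi> s = (max 0 (\<epsilon> + s))\<^sup>2 - k" for s :: real
  have "mono_on (ball s 1) \<psi>" for s
    unfolding \<psi>_def by (intro mono_onI diff_right_mono power_mono) auto
  moreover have "\<forall>\<^sub>F t in nhds 0. \<psi> (- infdist x M) + 2 * c * t + 2 / 2 * t\<^sup>2 - e * t\<^sup>2 \<le> \<psi> (- infdist x M + t)"
    if "e > 0" for e
  proof -
    have "\<forall>\<^sub>F t in nhds (0::real). t \<in> {- c<..}"
      by (rule eventually_nhds_in_open) (use c in auto)
    then show ?thesis
    proof eventually_elim
      case (elim t)
      have "\<psi> (- infdist x M + t) = (c + t)\<^sup>2 - k" "\<psi> (- infdist x M) = c\<^sup>2 - k"
        using elim c by (auto simp: \<psi>_def c_def max_def algebra_simps)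
      then show ?case using that by (simp add: power2_sum)
    qed
  qed
  moreover have "isCont (\<lambda>z. - infdist z M) x" by (intro continuous_intros)
  ultimately have "subjet (\<lambda>z. \<psi> (- infdist z M)) x ((2 * c) *\<^sub>R - \<nu>) ((2 * c) *\<^sub>R B + 2 *\<^sub>R outer (- \<nu>))"
    using c by (intro subjet_compose[OF B(2), where \<delta> = 1]) auto
  then have "subjet (\<lambda>z. (max 0 (\<epsilon> - infdist z M))\<^sup>2 - k) x ((2 * c) *\<^sub>R - \<nu>) ((2 * c) *\<^sub>R B + 2 *\<^sub>R outer (- \<nu>))"
    by (simp add: \<psi>_def)
  then show ?thesis
  proof (rule that)
    fix n :: "real^'n" assume n: "norm n = 1"
    define b where "b = n \<bullet> (B *v n)"
    have "\<nu> \<bullet> \<nu> = 1" using B(1) by (simp add: norm_eq_1)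
    then have tr: "trace ((2 * c) *\<^sub>R B + 2 *\<^sub>R outer (- \<nu>)) = 2"
      by (simp add: trace_add trace_scaleR trace_outer B(3))
    have "n \<bullet> (((2 * c) *\<^sub>R B + 2 *\<^sub>R outer (- \<nu>)) *v n) = 2 * (c * b) + 2 * (n \<bullet> \<nu>)\<^sup>2"
      by (simp add: matrix_vector_mult_add_rdistrib inner_add_right outer_mult inner_commute b_def
          power2_eq_square flip: scaleR_matrix_vector_assoc)
    moreover have "c * b \<le> 1 - (n \<bullet> \<nu>)\<^sup>2"
    proof (cases "b \<le> 0")
      case True
      have "\<bar>n \<bullet> \<nu>\<bar> \<le> 1" using Cauchy_Schwarz_ineq2[of n \<nu>] n B(1) by simp
      then have "(n \<bullet> \<nu>)\<^sup>2 \<le> 1" by (simp add: abs_square_le_1)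
      moreover have "c * b \<le> 0" using True c by (simp add: mult_nonneg_nonpos)
      ultimately show ?thesis by linarith
    next
      case False
      then have "c * b \<le> \<epsilon> * b" using c by (intro mult_right_mono) auto
      then show ?thesis using B(4)[OF n] by (simp add: b_def)
    qed
    ultimately show "n \<bullet> (((2 * c) *\<^sub>R B + 2 *\<^sub>R outer (- \<nu>)) *v n) \<le> trace ((2 * c) *\<^sub>R B + 2 *\<^sub>R outer (- \<nu>))"
      unfolding tr by linarith
  qed
qed

lemma parabolic_constant:
  assumes "parabolic T A g" "subharmonic T A g (\<lambda>r. ereal (u r))" "\<And>r. r \<in> topspace T \<Longrightarrow> u r < 0"
    "r \<in> topspace T" "r' \<in> topspace T"
  shows "u r = u r'"
proof -
  have "\<forall>x\<in>topspace T. ereal (u x) < 0" using assms(3) by simp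
  then obtain a where "\<forall>x\<in>topspace T. ereal (u x) = a"
    using assms(1,2) unfolding parabolic_def by blast
  then show ?thesis using assms(4,5) by (metis ereal.inject)
qed

lemma distance_constant:
  fixes M :: "(real^'n) set" and A\<^sub>M :: "(real^'n, 'm::finite) chart set"
    and A :: "('r, 'm) chart set" and F :: "'r \<Rightarrow> real^'n"
  assumes M: "properly_embedded_minimal_hypersurface M A\<^sub>M" and un: "unique_nearest_points M \<epsilon>"
    and \<epsilon>: "\<epsilon> > 0" and min: "immersed_minimal_hypersurface T A F"
    and par: "parabolic T A (induced_metric F)"
    and disj: "\<forall>r\<in>topspace T. F r - v \<notin> M"
    and r: "r \<in> topspace T" "infdist (F r - v) M < \<epsilon>" and r': "r' \<in> topspace T"
  shows "infdist (F r' - v) M = infdist (F r - v) M"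
proof -
  define w where "w z = (max 0 (\<epsilon> - infdist z M))\<^sup>2 - (\<epsilon>\<^sup>2 + 1)" for z
  have cl: "closed M" and ne: "M \<noteq> {}"
    using M by (auto simp: properly_embedded_minimal_hypersurface_def immersed_minimal_hypersurface_def)
  have sm: "smooth_manifold T A" using min by (simp add: immersed_minimal_hypersurface_def)
  have pos: "infdist (F r - v) M > 0" if "r \<in> topspace T" for r
    using disj that cl ne by (simp add: infdist_pos_not_in_closed)
  have cw: "continuous_on UNIV (\<lambda>z. w (z - v))"
    unfolding w_def by (intro continuous_intros)
  have "subharmonic T A (induced_metric F) (\<lambda>r. ereal (w (F r - v)))"
  proof (rule subharmonic_if_subjets[OF min, of "\<lambda>z. w (z - v)"])
    show "continuous_map T euclideanreal (\<lambda>r. w (F r - v))"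
      using continuous_map_compose[OF minimal_hypersurface_continuous[OF min], of euclideanreal "\<lambda>z. w (z - v)"] cw
      by (simp add: o_def)
    fix c y assume c: "c \<in> A" "y \<in> chart_image c"
    have "fst c \<subseteq> topspace T" using smooth_manifold_chartD(1)[OF sm c(1)] by (rule openin_subset)
    then have cy: "chart_inv c y \<in> topspace T" using chart_inv_into(1)[OF c(2)] by blast
    have "w = (\<lambda>z. (max 0 (\<epsilon> - infdist z M))\<^sup>2 - (\<epsilon>\<^sup>2 + 1))" by (simp add: w_def fun_eq_iff)
    then obtain a H where "subjet w (F (chart_inv c y) - v) a H"
      "\<And>n. norm n = 1 \<Longrightarrow> n \<bullet> (H *v n) \<le> trace H"
      using subjet_squared_depth[OF M un \<epsilon> pos[OF cy], where k = "\<epsilon>\<^sup>2 + 1"] by metis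
    then show "\<exists>a H. subjet (\<lambda>z. w (z - v)) (F (chart_inv c y)) a H \<and>
        (\<forall>n. unit_normal (F \<circ> chart_inv c) y n \<longrightarrow> n \<bullet> (H *v n) \<le> trace H)"
      by (intro exI[of _ a] exI[of _ H]) (auto simp: unit_normal_def intro: subjet_translate)
  qed
  moreover have "w (F r - v) < 0" for r
  proof -
    have "(max 0 (\<epsilon> - infdist (F r - v) M))\<^sup>2 \<le> \<epsilon>\<^sup>2"
      using \<epsilon> infdist_nonneg[of "F r - v" M] by (intro power_mono) auto
    then show ?thesis by (simp add: w_def)
  qed
  ultimately have "w (F r - v) = w (F r' - v)"
    by (intro parabolic_constant[OF par _ _ r(1) r'])
  then have "(max 0 (\<epsilon> - infdist (F r - v) M))\<^sup>2 = (max 0 (\<epsilon> - infdist (F r' - v) M))\<^sup>2"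
    by (simp add: w_def)
  then have "max 0 (\<epsilon> - infdist (F r - v) M) = max 0 (\<epsilon> - infdist (F r' - v) M)"
    by (simp add: power2_eq_iff_nonneg)
  then show ?thesis using r(2) by linarith
qed

text \<open>If $F(R)$ stays at distance at least $\epsilon$ from $M$, translate it by $sV$, where $V$ brings a point of $F(R)$ to
  $M$ at $s=1$, and stop at the last $\sigma$ up to which the distance is at least $\epsilon/2$. Just after $\sigma$ it is smaller at
  some point, so at $\sigma$ this point is closer than $\epsilon$.\<close>

lemma exists_translation_at_constant_distance:
  fixes M :: "(real^'n) set" and A\<^sub>M :: "(real^'n, 'm::finite) chart set"
    and A :: "('r, 'm) chart set" and F :: "'r \<Rightarrow> real^'n"
  assumes M: "properly_embedded_minimal_hypersurface M A\<^sub>M" and un: "unique_nearest_points M \<epsilon>"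
    and \<epsilon>: "\<epsilon> > 0" and min: "immersed_minimal_hypersurface T A F"
    and par: "parabolic T A (induced_metric F)"
    and disj: "F ` topspace T \<inter> M = {}"
  obtains v t where "0 < t" "t < \<epsilon>" "\<And>r. r \<in> topspace T \<Longrightarrow> infdist (F r - v) M = t"
proof -
  have cl: "closed M" and ne: "M \<noteq> {}" and neT: "topspace T \<noteq> {}"
    using M min by (auto simp: properly_embedded_minimal_hypersurface_def immersed_minimal_hypersurface_def)
  note found = that
  have conclude: thesis if v: "\<forall>r\<in>topspace T. F r - v \<notin> M"
    and r: "r \<in> topspace T" "infdist (F r - v) M < \<epsilon>" for v r
  proof (rule found[OF _ r(2)])
    show "0 < infdist (F r - v) M"
      using v r(1) cl ne by (simp add: infdist_pos_not_in_closed)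
  qed (use distance_constant[OF M un \<epsilon> min par v r] in auto)
  show thesis
  proof (cases "\<exists>r\<in>topspace T. infdist (F r) M < \<epsilon>")
    case True
    then obtain r where "r \<in> topspace T" "infdist (F r - 0) M < \<epsilon>" by auto
    then show ?thesis using disj by (intro conclude[of 0 r]) auto
  next
    case False
    obtain r\<^sub>1 where r1: "r\<^sub>1 \<in> topspace T" using neT by blast
    obtain q where q: "q \<in> M" using ne by blast
    define V where "V = F r\<^sub>1 - q"
    define S where "S = {0..1} \<inter> (\<Inter>r\<in>topspace T. {s. \<epsilon> / 2 \<le> infdist (F r - s *\<^sub>R V) M})"
    have "closed {s. \<epsilon> / 2 \<le> infdist (F r - s *\<^sub>R V) M}" for r
      by (intro closed_Collect_le continuous_intros)
    then have "closed S" unfolding S_def by (intro closed_Int closed_INT) auto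
    moreover have "0 \<in> S" using False \<epsilon> by (force simp: S_def)
    moreover have bdd: "bdd_above S" by (rule bdd_aboveI[of _ 1]) (auto simp: S_def)
    ultimately have sup: "Sup S \<in> S"
      using closed_contains_Sup by blast
    define \<sigma> where "\<sigma> = Sup S"
    have \<sigma>: "\<sigma> \<in> S" using sup by (simp add: \<sigma>_def)
    have "1 \<notin> S" using r1 q \<epsilon> by (auto simp: S_def V_def intro!: bexI[of _ r\<^sub>1])
    then have \<sigma>1: "\<sigma> < 1" using \<sigma> by (force simp: S_def less_le)
    define N where "N = norm V + 1"
    have N: "N > 0" "norm V < N" using norm_ge_zero[of V] unfolding N_def by linarith+
    define h where "h = min (1 - \<sigma>) (\<epsilon> / (2 * N))"
    have h: "h > 0" "\<sigma> + h \<le> 1" using \<sigma>1 \<epsilon> N by (auto simp: h_def)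
    have "h * norm V < h * N" using h N by simp
    also have "h * N \<le> \<epsilon> / (2 * N) * N"
      using N by (intro mult_right_mono) (auto simp: h_def)
    also have "\<dots> = \<epsilon> / 2"
      using N by simp
    finally have hV: "h * norm V < \<epsilon> / 2" .
    have "\<sigma> + h \<notin> S"
      using cSup_upper[OF _ bdd, of "\<sigma> + h"] h by (auto simp: \<sigma>_def)
    moreover have "\<sigma> + h \<in> {0..1}" using \<sigma> h by (auto simp: S_def)
    ultimately obtain r where r: "r \<in> topspace T" "infdist (F r - (\<sigma> + h) *\<^sub>R V) M < \<epsilon> / 2"
      by (auto simp: S_def not_le)
    have "infdist (F r - \<sigma> *\<^sub>R V) M \<le> infdist (F r - (\<sigma> + h) *\<^sub>R V) M + dist (F r - \<sigma> *\<^sub>R V) (F r - (\<sigma> + h) *\<^sub>R V)"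
      by (rule infdist_triangle)
    also have "dist (F r - \<sigma> *\<^sub>R V) (F r - (\<sigma> + h) *\<^sub>R V) = h * norm V"
      using h by (simp add: dist_norm scaleR_add_left)
    finally have lt: "infdist (F r - \<sigma> *\<^sub>R V) M < \<epsilon>" using r(2) hV by simp
    have "\<forall>r\<in>topspace T. F r - \<sigma> *\<^sub>R V \<notin> M"
    proof (intro ballI notI)
      fix r assume that: "r \<in> topspace T"
      assume "F r - \<sigma> *\<^sub>R V \<in> M"
      then have "infdist (F r - \<sigma> *\<^sub>R V) M = 0" by simp
      then show False using \<sigma> that \<epsilon> by (auto simp: S_def)
    qed
    then show ?thesis using r(1) lt by (rule conclude)
  qed
qed

text \<open>Let $\nu$ be the direction from the nearest point to a first point $F(r_0)-v$. After the translation by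
  $-s\nu$ this point has distance $t-s$ from $M$, and so has every other point $F(r)-v$ by \<open>distance_constant\<close>. As the original distances are $t$,
  each of them has decreased by the full length $s$ of the translation, which is possible only if $\nu$ is the direction from
  the nearest point there too.\<close>

lemma common_nearest_direction:
  fixes M :: "(real^'n) set" and A\<^sub>M :: "(real^'n, 'm::finite) chart set"
    and A :: "('r, 'm) chart set" and F :: "'r \<Rightarrow> real^'n"
  assumes M: "properly_embedded_minimal_hypersurface M A\<^sub>M" and un: "unique_nearest_points M \<epsilon>"
    and min: "immersed_minimal_hypersurface T A F"
    and par: "parabolic T A (induced_metric F)"
    and t: "0 < t" "t < \<epsilon>" and dist: "\<And>r. r \<in> topspace T \<Longrightarrow> infdist (F r - v) M = t"
  obtains \<nu> where "norm \<nu> = 1" "\<And>r. r \<in> topspace T \<Longrightarrow> F r - v - t *\<^sub>R \<nu> \<in> M"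
proof -
  have cl: "closed M" and ne: "M \<noteq> {}" and neT: "topspace T \<noteq> {}"
    using M min by (auto simp: properly_embedded_minimal_hypersurface_def immersed_minimal_hypersurface_def)
  have \<epsilon>: "\<epsilon> > 0" using t by simp
  obtain r\<^sub>0 where r0: "r\<^sub>0 \<in> topspace T" using neT by blast
  obtain p where p: "p \<in> M" "dist (F r\<^sub>0 - v) p = infdist (F r\<^sub>0 - v) M"
    using infdist_attained[OF cl ne] .
  define \<nu> where "\<nu> = (F r\<^sub>0 - v - p) /\<^sub>R t"
  have \<nu>: "norm \<nu> = 1" using p(2) dist[OF r0] t by (simp add: \<nu>_def dist_norm)
  then have \<nu>\<nu>: "\<nu> \<bullet> \<nu> = 1" by (simp add: norm_eq_1)
  have x0: "p + t *\<^sub>R \<nu> = F r\<^sub>0 - v" using t by (simp add: \<nu>_def)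
  define s where "s = min t (\<epsilon> - t) / 2"
  have s: "0 < s" "s < t" "s < \<epsilon> - t" using t by (auto simp: s_def min_def)
  have move: "infdist (F r - (v + s *\<^sub>R \<nu>)) M > 0" "infdist (F r - (v + s *\<^sub>R \<nu>)) M < \<epsilon>" if "r \<in> topspace T" for r
  proof -
    have "dist (F r - (v + s *\<^sub>R \<nu>)) (F r - v) = s" using s \<nu> by (simp add: dist_norm)
    then have "\<bar>infdist (F r - (v + s *\<^sub>R \<nu>)) M - infdist (F r - v) M\<bar> \<le> s"
      using infdist_triangle_abs[of "F r - (v + s *\<^sub>R \<nu>)" M "F r - v"] by simp
    then show "infdist (F r - (v + s *\<^sub>R \<nu>)) M > 0" "infdist (F r - (v + s *\<^sub>R \<nu>)) M < \<epsilon>"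
      using dist[OF that] s by auto
  qed
  have "\<forall>r\<in>topspace T. F r - (v + s *\<^sub>R \<nu>) \<notin> M"
    using move(1) by fastforce
  note const = distance_constant[OF M un \<epsilon> min par this r0 move(2)[OF r0]]
  have "infdist (p + (t - s) *\<^sub>R \<nu>) M = t - s"
    by (rule nearest_point_on_segment[OF p(1) \<nu>, of _ t]) (use s dist[OF r0] x0 in auto)
  moreover have "p + (t - s) *\<^sub>R \<nu> = F r\<^sub>0 - (v + s *\<^sub>R \<nu>)"
    using x0 by (simp add: algebra_simps)
  ultimately have d0: "infdist (F r\<^sub>0 - (v + s *\<^sub>R \<nu>)) M = t - s" by simp
  have "F r - v - t *\<^sub>R \<nu> \<in> M" if r: "r \<in> topspace T" for r
  proof -
    obtain q where q: "q \<in> M" "dist (F r - (v + s *\<^sub>R \<nu>)) q = infdist (F r - (v + s *\<^sub>R \<nu>)) M"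
      using infdist_attained[OF cl ne] .
    \<comment> \<open>Equality in the triangle inequality for \<open>a\<close> and \<open>s *\<^sub>R \<nu>\<close>.\<close>
    define a where "a = F r - (v + s *\<^sub>R \<nu>) - q"
    have na: "norm a = t - s" using q(2) const[OF r] d0 by (simp add: a_def dist_norm)
    have "t \<le> norm (a + s *\<^sub>R \<nu>)"
      using infdist_le[OF q(1), of "F r - v"] dist[OF r] by (simp add: a_def dist_norm algebra_simps)
    then have "t\<^sup>2 \<le> (norm (a + s *\<^sub>R \<nu>))\<^sup>2" using t by (intro power_mono) auto
    also have "\<dots> = (norm a)\<^sup>2 + 2 * s * (a \<bullet> \<nu>) + s\<^sup>2"
      unfolding power2_norm_eq_inner
      by (simp add: inner_add_left inner_add_right inner_commute \<nu>\<nu> power2_eq_square)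
    finally have "t\<^sup>2 - (t - s)\<^sup>2 - s\<^sup>2 \<le> 2 * s * (a \<bullet> \<nu>)" by (simp add: na)
    then have "2 * s * (t - s) \<le> 2 * s * (a \<bullet> \<nu>)" by (simp add: power2_eq_square algebra_simps)
    then have a\<nu>: "t - s \<le> a \<bullet> \<nu>" using s by simp
    have "(norm (a - (t - s) *\<^sub>R \<nu>))\<^sup>2 = (norm a)\<^sup>2 - 2 * (t - s) * (a \<bullet> \<nu>) + (t - s)\<^sup>2"
      unfolding power2_norm_eq_inner
      by (simp add: inner_diff_left inner_diff_right inner_commute \<nu>\<nu> power2_eq_square algebra_simps)
    also have "\<dots> = 2 * (t - s) * ((t - s) - a \<bullet> \<nu>)"
      by (simp add: na power2_eq_square algebra_simps)
    also have "\<dots> \<le> 0" using a\<nu> s by (intro mult_nonneg_nonpos) auto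
    finally have "a = (t - s) *\<^sub>R \<nu>" by simp
    then have "F r - v - t *\<^sub>R \<nu> = q" by (simp add: a_def algebra_simps)
    then show ?thesis using q(1) by simp
  qed
  then show ?thesis using that \<nu> by blast
qed

section \<open>Parabolic hypersurfaces in a hyperplane\<close>

text \<open>At the foot point of $F(r)$ the distance to the nearby points of $F(R)$ is minimal at $r$.\<close>

lemma tangent_orthogonal_to_common_direction:
  fixes M :: "(real^'n) set" and A :: "('r, 'm::finite) chart set" and F :: "'r \<Rightarrow> real^'n"
  assumes min: "immersed_minimal_hypersurface T A F"
    and t: "0 < t" and dist: "\<And>r. r \<in> topspace T \<Longrightarrow> infdist (F r - v) M = t"
    and \<nu>: "norm \<nu> = 1" "\<And>r. r \<in> topspace T \<Longrightarrow> F r - v - t *\<^sub>R \<nu> \<in> M"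
    and c: "c \<in> A" "y \<in> chart_image c"
  shows "frechet_derivative (F \<circ> chart_inv c) (at y) u \<bullet> \<nu> = 0"
proof -
  have sm: "smooth_manifold T A" using min by (simp add: immersed_minimal_hypersurface_def)
  have "fst c \<subseteq> topspace T" using smooth_manifold_chartD(1)[OF sm c(1)] by (rule openin_subset)
  then have cT: "chart_inv c z \<in> topspace T" if "z \<in> chart_image c" for z
    using chart_inv_into(1)[OF that] by blast
  let ?X = "F \<circ> chart_inv c"
  have X: "twice_differentiable_at ?X y"
    using minimal_hypersurface_minimal_at[OF min c] by (simp add: minimal_at_def)
  have "\<forall>\<^sub>F z in nhds y. z \<in> chart_image c"
    using smooth_manifold_chartD(2)[OF sm c(1)] c(2) by (rule eventually_nhds_in_open)
  then have "\<forall>\<^sub>F z in nhds y. t \<le> norm (?X z - (?X y + t *\<^sub>R - \<nu>))"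
  proof eventually_elim
    case (elim z)
    show ?case
      using infdist_le[OF \<nu>(2)[OF cT[OF c(2)]], of "F (chart_inv c z) - v"] dist[OF cT[OF elim]]
      by (simp add: dist_norm algebra_simps)
  qed
  then have "frechet_derivative ?X (at y) u \<bullet> - \<nu> = 0"
    using minimal_touched_by_ball(1)[OF X _ t, of "- \<nu>"] \<nu>(1) by simp
  then show ?thesis by simp
qed

text \<open>The component $F\cdot\nu$ has vanishing derivative in every chart, so its level sets are open and closed.\<close>

lemma image_in_hyperplane:
  fixes A :: "('r, 'm::finite) chart set" and F :: "'r \<Rightarrow> real^'n"
  assumes min: "immersed_minimal_hypersurface T A F" and conn: "connected_space T"
    and tan: "\<And>c y u. \<lbrakk>c \<in> A; y \<in> chart_image c\<rbrakk> \<Longrightarrow> frechet_derivative (F \<circ> chart_inv c) (at y) u \<bullet> \<nu> = 0"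
    and r: "r \<in> topspace T" "r' \<in> topspace T"
  shows "F r' \<bullet> \<nu> = F r \<bullet> \<nu>"
proof -
  have sm: "smooth_manifold T A" using min by (simp add: immersed_minimal_hypersurface_def)
  define S where "S = {p \<in> topspace T. F p \<bullet> \<nu> = F r \<bullet> \<nu>}"
  have "continuous_map T euclideanreal (\<lambda>p. F p \<bullet> \<nu>)"
    using continuous_map_compose[OF minimal_hypersurface_continuous[OF min], of euclideanreal "\<lambda>z. z \<bullet> \<nu>"]
    by (simp add: o_def continuous_on_inner)
  then have "closedin T {p \<in> topspace T. F p \<bullet> \<nu> \<in> {F r \<bullet> \<nu>}}"
    by (rule closedin_continuous_map_preimage) simp
  then have "closedin T S" by (simp add: S_def)
  moreover have "openin T S"
  proof (subst openin_subopen, intro ballI)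
    fix p assume p: "p \<in> S"
    obtain c where c: "c \<in> A" "p \<in> fst c" "snd c p \<in> chart_image c" "chart_inv c (snd c p) = p"
      using chart_exists[OF sm, of p] p by (auto simp: S_def)
    obtain d where d: "d > 0" "ball (snd c p) d \<subseteq> chart_image c"
      using smooth_manifold_chartD(2)[OF sm c(1)] c(3) open_contains_ball by blast
    define V where "V = {q \<in> fst c. snd c q \<in> ball (snd c p) d}"
    have "openin T V" unfolding V_def by (rule open_chart_preimage[OF sm c(1)]) simp
    moreover have "p \<in> V" using c d by (simp add: V_def)
    moreover have "V \<subseteq> S"
    proof
      fix q assume q: "q \<in> V"
      have "(\<lambda>z. F (chart_inv c z) \<bullet> \<nu>) (snd c q) = (\<lambda>z. F (chart_inv c z) \<bullet> \<nu>) (snd c p)"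
      proof (rule has_derivative_zero_unique[of "ball (snd c p) d"])
        fix z assume z: "z \<in> ball (snd c p) d"
        then have zc: "z \<in> chart_image c" using d by blast
        have "(F \<circ> chart_inv c) differentiable (at z)"
          using minimal_hypersurface_minimal_at[OF min c(1) zc] by (rule minimal_at_differentiable)
        from has_derivative_inner_left[OF has_derivative_frechet[OF this], of \<nu>]
        have "((\<lambda>z. F (chart_inv c z) \<bullet> \<nu>) has_derivative (\<lambda>h. 0)) (at z)"
          by (simp add: tan[OF c(1) zc])
        then show "((\<lambda>z. F (chart_inv c z) \<bullet> \<nu>) has_derivative (\<lambda>h. 0)) (at z within ball (snd c p) d)"
          by (rule has_derivative_at_withinI)
      qed (use q d in \<open>auto simp: V_def\<close>)
      moreover have "chart_inv c (snd c q) = q"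
        using q chart_inv_chart[OF sm c(1)] by (simp add: V_def)
      moreover have "q \<in> topspace T"
        using q openin_subset[OF \<open>openin T V\<close>] by blast
      ultimately show "q \<in> S" using p c(4) by (simp add: S_def)
    qed
    ultimately show "\<exists>V. openin T V \<and> p \<in> V \<and> V \<subseteq> S" by blast
  qed
  moreover have "r \<in> S" using r by (simp add: S_def)
  ultimately have "S = topspace T"
    using conn unfolding connected_space_clopen_in by blast
  then show ?thesis using r by (auto simp: S_def)
qed

text \<open>The normal space of a hypersurface is one-dimensional.\<close>

lemma normal_expand:
  fixes X :: "real^'m::finite \<Rightarrow> real^'n"
  assumes X: "minimal_at X y" and \<nu>: "norm \<nu> = 1" "\<And>u. frechet_derivative X (at y) u \<bullet> \<nu> = 0"
    and x: "\<And>u. frechet_derivative X (at y) u \<bullet> x = 0"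
  shows "x = (x \<bullet> \<nu>) *\<^sub>R \<nu>"
proof -
  have card: "CARD('n) = CARD('m) + 1" and tw: "twice_differentiable_at X y"
    and inj: "inj (frechet_derivative X (at y))"
    using X by (auto simp: minimal_at_def)
  obtain E :: "'m \<Rightarrow> real^'m" where "orthonormal_frame (\<lambda>k. frechet_derivative X (at y) (E k))"
    by (rule exists_tangent_frame[OF twice_differentiable_atD(1)[OF tw] inj]) (rule that)
  from frame_and_normal_expand[OF card this \<nu>, of x] show ?thesis
    using x by (simp add: inner_commute)
qed

text \<open>On $\nu^\perp\cong\mathbb{R}^m$ the Laplacian of $\psi(k|x-b|^2)$ is twice the expression in the last assumption. The factor $k$
  is $1$ or $-1$ in the applications and makes $\psi$ increasing for both signs of the radial derivative, as
  \<open>subjet_compose\<close> requires.\<close>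

lemma radial_subharmonic:
  fixes A :: "('r, 'm::finite) chart set" and F :: "'r \<Rightarrow> real^'n" and \<psi> :: "real \<Rightarrow> real"
  assumes min: "immersed_minimal_hypersurface T A F"
    and \<nu>: "norm \<nu> = 1"
    and tan: "\<And>c y u. \<lbrakk>c \<in> A; y \<in> chart_image c\<rbrakk> \<Longrightarrow> frechet_derivative (F \<circ> chart_inv c) (at y) u \<bullet> \<nu> = 0"
    and b: "\<And>r. r \<in> topspace T \<Longrightarrow> (F r - b) \<bullet> \<nu> = 0"
    and S: "open S" "mono_on S \<psi>" "\<And>r. r \<in> topspace T \<Longrightarrow> k * (norm (F r - b))\<^sup>2 \<in> S"
    and \<psi>: "\<And>s. s \<in> S \<Longrightarrow> (\<psi> has_real_derivative \<psi>' s) (at s)"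
      "\<And>s. s \<in> S \<Longrightarrow> (\<psi>' has_real_derivative \<psi>'' s) (at s)"
      "\<And>s. s \<in> S \<Longrightarrow> \<psi>' s \<ge> 0"
    and sub: "\<And>r. r \<in> topspace T \<Longrightarrow>
        k * CARD('m) * \<psi>' (k * (norm (F r - b))\<^sup>2) + 2 * k\<^sup>2 * (norm (F r - b))\<^sup>2 * \<psi>'' (k * (norm (F r - b))\<^sup>2) \<ge> 0"
  shows "subharmonic T A (induced_metric F) (\<lambda>r. ereal (\<psi> (k * (norm (F r - b))\<^sup>2)))"
proof -
  have sm: "smooth_manifold T A" and card: "CARD('n) = CARD('m) + 1"
    using min by (simp_all add: immersed_minimal_hypersurface_def)
  have \<nu>\<nu>: "\<nu> \<bullet> \<nu> = 1" using \<nu> by (simp add: norm_eq_1)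
  define g where "g z = k * (norm (z - b))\<^sup>2" for z
  have "subharmonic T A (induced_metric F) (\<lambda>r. ereal (\<psi> (g (F r))))"
  proof (rule subharmonic_if_subjets[OF min, of "\<lambda>z. \<psi> (g z)"])
    have "continuous_map T euclideanreal (\<lambda>r. g (F r))"
      using continuous_map_compose[OF minimal_hypersurface_continuous[OF min], of euclideanreal g]
      by (simp add: o_def g_def[abs_def] continuous_intros)
    then have "continuous_map T (top_of_set S) (\<lambda>r. g (F r))"
      using S(3) by (auto simp: continuous_map_in_subtopology g_def)
    moreover have "continuous_map (top_of_set S) euclideanreal \<psi>"
      using \<psi>(1) by (auto intro!: continuous_at_imp_continuous_on DERIV_isCont)
    ultimately show "continuous_map T euclideanreal (\<lambda>r. \<psi> (g (F r)))"
      using continuous_map_compose[of T "top_of_set S" "\<lambda>r. g (F r)" euclideanreal \<psi>] by (simp add: o_def)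
    fix c y assume c: "c \<in> A" "y \<in> chart_image c"
    have "fst c \<subseteq> topspace T" using smooth_manifold_chartD(1)[OF sm c(1)] by (rule openin_subset)
    then have cT: "chart_inv c y \<in> topspace T" using chart_inv_into(1)[OF c(2)] by blast
    define x where "x = F (chart_inv c y)"
    have gS: "g x \<in> S" using S(3)[OF cT] by (simp add: g_def x_def)
    have ex: "g (x + \<xi>) = g x + quadratic ((2 * k) *\<^sub>R (x - b)) ((2 * k) *\<^sub>R mat 1) \<xi>" for \<xi>
      unfolding g_def quadratic_def power2_norm_eq_inner
      by (simp add: inner_add_left inner_add_right inner_diff_left inner_diff_right inner_commute algebra_simps
          flip: scaleR_matrix_vector_assoc)
    obtain \<delta> where \<delta>: "\<delta> > 0" "ball (g x) \<delta> \<subseteq> S"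
      using S(1) gS open_contains_ball by blast
    define H where "H = \<psi>' (g x) *\<^sub>R ((2 * k) *\<^sub>R mat 1) + \<psi>'' (g x) *\<^sub>R outer ((2 * k) *\<^sub>R (x - b))"
    have T: "\<forall>\<^sub>F t in nhds 0. \<psi> (g x) + \<psi>' (g x) * t + \<psi>'' (g x) / 2 * t\<^sup>2 - e * t\<^sup>2 \<le> \<psi> (g x + t)" if "e > 0" for e
    proof (rule Taylor_lower_real[OF _ \<psi>(2)[OF gS] that])
      show "\<forall>\<^sub>F z in nhds (g x). (\<psi> has_real_derivative \<psi>' z) (at z)"
        using eventually_nhds_in_open[OF S(1) gS] by eventually_elim (rule \<psi>(1))
    qed
    have sj: "subjet (\<lambda>z. \<psi> (g z)) x (\<psi>' (g x) *\<^sub>R ((2 * k) *\<^sub>R (x - b))) H"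
      unfolding H_def
    proof (rule subjet_compose[OF subjet_exact[OF ex] _ \<delta>(1) mono_on_subset[OF S(2) \<delta>(2)] \<psi>(3)[OF gS] T])
      show "isCont g x" unfolding g_def by (intro continuous_intros)
    qed
    have tr: "n \<bullet> (H *v n) \<le> trace H" if n: "unit_normal (F \<circ> chart_inv c) y n" for n
    proof -
      have mX: "minimal_at (F \<circ> chart_inv c) y" by (rule minimal_hypersurface_minimal_at[OF min c])
      have nt: "norm n = 1" "frechet_derivative (F \<circ> chart_inv c) (at y) u \<bullet> n = 0" for u
        using n unit_normal_iff[OF minimal_at_differentiable[OF mX]] by auto
      have n\<nu>: "n = (n \<bullet> \<nu>) *\<^sub>R \<nu>"
        by (rule normal_expand[OF mX \<nu> tan[OF c] nt(2)])
      have nn: "n \<bullet> n = 1" using nt(1) by (simp add: norm_eq_1)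
      have "(x - b) \<bullet> n = (n \<bullet> \<nu>) * ((x - b) \<bullet> \<nu>)"
        by (subst n\<nu>) (simp only: inner_scaleR_right)
      then have nx: "(x - b) \<bullet> n = 0" using b[OF cT] by (simp add: x_def)
      have "n \<bullet> (H *v n) = \<psi>' (g x) * (2 * k)"
        by (simp add: H_def matrix_vector_mult_add_rdistrib inner_add_right outer_mult nx nn
            flip: scaleR_matrix_vector_assoc)
      moreover have "trace (mat 1 :: real^'n^'n) = CARD('m) + 1" using card by (simp add: trace_def mat_def)
      then have "trace H = \<psi>' (g x) * (2 * k) * (CARD('m) + 1) + \<psi>'' (g x) * ((2 * k)\<^sup>2 * (norm (x - b))\<^sup>2)"
        unfolding power2_norm_eq_inner
        by (simp add: H_def trace_add trace_scaleR trace_outer power2_eq_square)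
      moreover have "0 \<le> k * CARD('m) * \<psi>' (g x) + 2 * k\<^sup>2 * (norm (x - b))\<^sup>2 * \<psi>'' (g x)"
        using sub[OF cT] by (simp add: g_def x_def)
      ultimately show ?thesis by (simp add: algebra_simps power_mult_distrib)
    qed
    show "\<exists>a H. subjet (\<lambda>z. \<psi> (g z)) (F (chart_inv c y)) a H \<and>
        (\<forall>n. unit_normal (F \<circ> chart_inv c) y n \<longrightarrow> n \<bullet> (H *v n) \<le> trace H)"
      using sj tr by (auto simp: x_def)
  qed
  then show ?thesis by (simp add: g_def)
qed

text \<open>If $|F-b|$ is constant, then $F-b$ is orthogonal to the tangent space as well as to $\nu$, so $F=b$, which is not
  an immersion.\<close>

lemma radius_not_constant:
  fixes A :: "('r, 'm::finite) chart set" and F :: "'r \<Rightarrow> real^'n"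
  assumes min: "immersed_minimal_hypersurface T A F"
    and \<nu>: "norm \<nu> = 1"
    and tan: "\<And>c y u. \<lbrakk>c \<in> A; y \<in> chart_image c\<rbrakk> \<Longrightarrow> frechet_derivative (F \<circ> chart_inv c) (at y) u \<bullet> \<nu> = 0"
    and b: "\<And>r. r \<in> topspace T \<Longrightarrow> (F r - b) \<bullet> \<nu> = 0"
  shows "\<not> (\<forall>r\<in>topspace T. norm (F r - b) = \<rho>)"
proof
  assume const: "\<forall>r\<in>topspace T. norm (F r - b) = \<rho>"
  have sm: "smooth_manifold T A" and ne: "topspace T \<noteq> {}"
    using min by (simp_all add: immersed_minimal_hypersurface_def)
  obtain r where "r \<in> topspace T" using ne by blast
  then obtain c where c: "c \<in> A" "snd c r \<in> chart_image c"
    using chart_exists[OF sm] by metis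
  have "fst c \<subseteq> topspace T" using smooth_manifold_chartD(1)[OF sm c(1)] by (rule openin_subset)
  then have cT: "chart_inv c z \<in> topspace T" if "z \<in> chart_image c" for z
    using chart_inv_into(1)[OF that] by blast
  let ?X = "F \<circ> chart_inv c"
  note cI = smooth_manifold_chartD(2)[OF sm c(1)]
  have Xb: "?X z = b" if z: "z \<in> chart_image c" for z
  proof -
    have mX: "minimal_at ?X z" by (rule minimal_hypersurface_minimal_at[OF min c(1) z])
    note DX = has_derivative_frechet[OF minimal_at_differentiable[OF mX]]
    have D1: "((\<lambda>z. ?X z - b) has_derivative frechet_derivative ?X (at z)) (at z)"
      using has_derivative_diff[OF DX has_derivative_const, of b] by simp
    have D2: "((\<lambda>z. (?X z - b) \<bullet> (?X z - b)) has_derivative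
        (\<lambda>u. (?X z - b) \<bullet> frechet_derivative ?X (at z) u + frechet_derivative ?X (at z) u \<bullet> (?X z - b))) (at z)"
      by (rule has_derivative_inner[OF D1 D1])
    have "\<forall>\<^sub>F w in nhds z. \<rho>\<^sup>2 = (?X w - b) \<bullet> (?X w - b)"
      using eventually_nhds_in_open[OF cI z]
      by eventually_elim (use const cT in \<open>simp flip: power2_norm_eq_inner\<close>)
    then have "((\<lambda>z. (?X z - b) \<bullet> (?X z - b)) has_derivative (\<lambda>u. 0)) (at z)"
      by (rule has_derivative_transform_nhds[OF has_derivative_const])
    from has_derivative_unique[OF this D2]
    have "frechet_derivative ?X (at z) u \<bullet> (?X z - b) = 0" for u
      by (simp add: fun_eq_iff inner_commute)
    then have "?X z - b = ((?X z - b) \<bullet> \<nu>) *\<^sub>R \<nu>"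
      by (rule normal_expand[OF mX \<nu> tan[OF c(1) z]])
    also have "\<dots> = 0" using b[OF cT[OF z]] by simp
    finally show ?thesis by simp
  qed
  have mX: "minimal_at ?X (snd c r)" by (rule minimal_hypersurface_minimal_at[OF min c])
  have "\<forall>\<^sub>F z in nhds (snd c r). b = ?X z"
    using eventually_nhds_in_open[OF cI c(2)] by eventually_elim (simp only: Xb)
  then have "(?X has_derivative (\<lambda>u. 0)) (at (snd c r))"
    by (rule has_derivative_transform_nhds[OF has_derivative_const])
  then have "frechet_derivative ?X (at (snd c r)) = (\<lambda>u. 0)"
    by (rule frechet_derivative_at[symmetric])
  then have "inj (\<lambda>u::real^'m. 0::real^'n)" using mX by (simp add: minimal_at_def)
  then have "axis undefined 1 = (0::real^'m)" by (rule injD) simp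
  then show False by (simp add: axis_eq_0_iff)
qed

text \<open>On $\mathbb{R}^m$ with $m\ge3$ the negative function $-(1+|x-b|^2)^{-1/2}$ is subharmonic: with $s=|x-b|^2$ the condition of
  \<open>radial_subharmonic\<close> becomes $m(1+s)\ge3s$.\<close>

lemma parabolic_in_hyperplane_dim:
  fixes A :: "('r, 'm::finite) chart set" and F :: "'r \<Rightarrow> real^'n"
  assumes min: "immersed_minimal_hypersurface T A F" and par: "parabolic T A (induced_metric F)"
    and \<nu>: "norm \<nu> = 1"
    and tan: "\<And>c y u. \<lbrakk>c \<in> A; y \<in> chart_image c\<rbrakk> \<Longrightarrow> frechet_derivative (F \<circ> chart_inv c) (at y) u \<bullet> \<nu> = 0"
    and b: "\<And>r. r \<in> topspace T \<Longrightarrow> (F r - b) \<bullet> \<nu> = 0"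
  shows "CARD('m) < 3"
proof (rule ccontr)
  assume "\<not> CARD('m) < 3"
  then have m: "real CARD('m) \<ge> 3" by simp
  define \<psi> where "\<psi> s = - ((1 + s) powr (-1/2))" for s :: real
  define \<psi>' where "\<psi>' s = 1/2 * (1 + s) powr (-3/2)" for s :: real
  define \<psi>'' where "\<psi>'' s = - 3/4 * (1 + s) powr (-5/2)" for s :: real
  have "subharmonic T A (induced_metric F) (\<lambda>r. ereal (\<psi> (1 * (norm (F r - b))\<^sup>2)))"
  proof (rule radial_subharmonic[OF min \<nu> tan b, where S = "{-1<..}" and \<psi>' = \<psi>' and \<psi>'' = \<psi>''])
    show "mono_on {-1<..} \<psi>"
      unfolding \<psi>_def by (intro mono_onI) (auto intro!: powr_mono2')
    show "(\<psi> has_real_derivative \<psi>' s) (at s)" if "s \<in> {-1<..}" for s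
      unfolding \<psi>_def \<psi>'_def using that by (auto intro!: derivative_eq_intros)
    show "(\<psi>' has_real_derivative \<psi>'' s) (at s)" if "s \<in> {-1<..}" for s
      unfolding \<psi>'_def \<psi>''_def using that by (auto intro!: derivative_eq_intros)
    show "\<psi>' s \<ge> 0" for s by (simp add: \<psi>'_def)
    show "1 * (norm (F r - b))\<^sup>2 \<in> {-1<..}" for r
      unfolding greaterThan_iff using zero_le_power2[of "norm (F r - b)"] by linarith
    show "0 \<le> 1 * real CARD('m) * \<psi>' (1 * (norm (F r - b))\<^sup>2)
        + 2 * 1\<^sup>2 * (norm (F r - b))\<^sup>2 * \<psi>'' (1 * (norm (F r - b))\<^sup>2)" for r
    proof -
      define s where "s = (norm (F r - b))\<^sup>2"
      have s: "s \<ge> 0" by (simp add: s_def)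
      have "(1 + s) powr (-3/2) = (1 + s) powr (1 + -5/2)" by simp
      also have "\<dots> = (1 + s) * (1 + s) powr (-5/2)"
        using s by (subst powr_add) simp
      finally have "CARD('m) * \<psi>' s + 2 * s * \<psi>'' s
          = (1 + s) powr (-5/2) * (CARD('m) * (1 + s) / 2 - 3/2 * s)"
        by (simp add: \<psi>'_def \<psi>''_def algebra_simps)
      moreover have "3 * (1 + s) \<le> CARD('m) * (1 + s)" using m s by (intro mult_right_mono) auto
      ultimately show ?thesis using s by (simp add: s_def[symmetric])
    qed
  qed (simp_all)
  moreover have "\<psi> (1 * (norm (F r - b))\<^sup>2) < 0" for r
    using zero_le_power2[of "norm (F r - b)"] by (simp add: \<psi>_def add_nonneg_eq_0_iff)
  ultimately have const: "\<psi> (1 * (norm (F r - b))\<^sup>2) = \<psi> (1 * (norm (F r' - b))\<^sup>2)"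
    if "r \<in> topspace T" "r' \<in> topspace T" for r r'
    using parabolic_constant[OF par _ _ that, of "\<lambda>r. \<psi> (1 * (norm (F r - b))\<^sup>2)"] by blast
  have inj: "s = s'" if "\<psi> s = \<psi> s'" "s \<ge> 0" "s' \<ge> 0" for s s'
  proof -
    have "((1 + s) powr (-1/2)) powr (-2) = ((1 + s') powr (-1/2)) powr (-2)" using that(1) by (simp add: \<psi>_def)
    then show ?thesis using that by (simp add: powr_powr)
  qed
  have "topspace T \<noteq> {}" using min unfolding immersed_minimal_hypersurface_def by blast
  then obtain r\<^sub>0 where r0: "r\<^sub>0 \<in> topspace T" by blast
  have "norm (F r - b) = norm (F r\<^sub>0 - b)" if r: "r \<in> topspace T" for r
  proof -
    have "\<psi> ((norm (F r - b))\<^sup>2) = \<psi> ((norm (F r\<^sub>0 - b))\<^sup>2)" using const[OF r r0] by simp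
    then have "(norm (F r - b))\<^sup>2 = (norm (F r\<^sub>0 - b))\<^sup>2" by (rule inj) simp_all
    then show ?thesis by (rule power2_eq_imp_eq) simp_all
  qed
  then show False using radius_not_constant[OF min \<nu> tan b] by blast
qed

text \<open>If $F(R)$ keeps the distance $\rho$ from $b$, then $-\log(|F-b|^2/\rho^2)-1$ is a negative harmonic function on
  the surface, and it is not constant.\<close>

lemma parabolic_dense_in_plane:
  fixes A :: "('r, 'm::finite) chart set" and F :: "'r \<Rightarrow> real^'n"
  assumes min: "immersed_minimal_hypersurface T A F" and par: "parabolic T A (induced_metric F)"
    and m: "CARD('m) = 2" and \<nu>: "norm \<nu> = 1"
    and tan: "\<And>c y u. \<lbrakk>c \<in> A; y \<in> chart_image c\<rbrakk> \<Longrightarrow> frechet_derivative (F \<circ> chart_inv c) (at y) u \<bullet> \<nu> = 0"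
    and b: "\<And>r. r \<in> topspace T \<Longrightarrow> (F r - b) \<bullet> \<nu> = 0" and \<rho>: "\<rho> > 0"
  shows "\<exists>r\<in>topspace T. norm (F r - b) < \<rho>"
proof (rule ccontr)
  assume "\<not> ?thesis"
  then have far: "\<rho>\<^sup>2 \<le> (norm (F r - b))\<^sup>2" if "r \<in> topspace T" for r
    using that \<rho> by (intro power_mono) (auto simp: not_less)
  have pos: "(norm (F r - b))\<^sup>2 > 0" if "r \<in> topspace T" for r
    using far[OF that] \<rho> by (meson less_le_trans zero_less_power)
  define \<psi> where "\<psi> s = - ln (- s) + (ln (\<rho>\<^sup>2) - 1)" for s :: real
  define \<psi>' where "\<psi>' s = - 1 / s" for s :: real
  define \<psi>'' where "\<psi>'' s = 1 / s\<^sup>2" for s :: real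
  have "subharmonic T A (induced_metric F) (\<lambda>r. ereal (\<psi> (- 1 * (norm (F r - b))\<^sup>2)))"
  proof (rule radial_subharmonic[OF min \<nu> tan b, where S = "{..<0}" and \<psi>' = \<psi>' and \<psi>'' = \<psi>''])
    show "mono_on {..<0} \<psi>"
      unfolding \<psi>_def by (intro mono_onI) auto
    show "(\<psi> has_real_derivative \<psi>' s) (at s)" if "s \<in> {..<0}" for s
      unfolding \<psi>_def \<psi>'_def using that by (auto intro!: derivative_eq_intros simp: field_simps)
    show "(\<psi>' has_real_derivative \<psi>'' s) (at s)" if "s \<in> {..<0}" for s
      unfolding \<psi>'_def \<psi>''_def using that by (auto intro!: derivative_eq_intros simp: power2_eq_square)
    show "\<psi>' s \<ge> 0" if "s \<in> {..<0}" for s using that by (simp add: \<psi>'_def divide_nonpos_neg)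
    show "- 1 * (norm (F r - b))\<^sup>2 \<in> {..<0}" if "r \<in> topspace T" for r
      using pos[OF that] by simp
    show "0 \<le> - 1 * real CARD('m) * \<psi>' (- 1 * (norm (F r - b))\<^sup>2)
        + 2 * (- 1)\<^sup>2 * (norm (F r - b))\<^sup>2 * \<psi>'' (- 1 * (norm (F r - b))\<^sup>2)" if "r \<in> topspace T" for r
      using pos[OF that] by (simp add: m \<psi>'_def \<psi>''_def power2_eq_square)
  qed (simp_all)
  moreover have "\<psi> (- 1 * (norm (F r - b))\<^sup>2) < 0" if "r \<in> topspace T" for r
  proof -
    have "ln (\<rho>\<^sup>2) \<le> ln ((norm (F r - b))\<^sup>2)"
      using far[OF that] pos[OF that] \<rho> by (subst ln_le_cancel_iff) auto
    then show ?thesis by (simp only: \<psi>_def) simp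
  qed
  ultimately have const: "\<psi> (- 1 * (norm (F r - b))\<^sup>2) = \<psi> (- 1 * (norm (F r' - b))\<^sup>2)"
    if "r \<in> topspace T" "r' \<in> topspace T" for r r'
    using parabolic_constant[OF par _ _ that, of "\<lambda>r. \<psi> (- 1 * (norm (F r - b))\<^sup>2)"] by blast
  have "topspace T \<noteq> {}" using min unfolding immersed_minimal_hypersurface_def by blast
  then obtain r\<^sub>0 where r0: "r\<^sub>0 \<in> topspace T" by blast
  have "norm (F r - b) = norm (F r\<^sub>0 - b)" if r: "r \<in> topspace T" for r
  proof -
    have "ln ((norm (F r - b))\<^sup>2) = ln ((norm (F r\<^sub>0 - b))\<^sup>2)"
      using const[OF r r0] unfolding \<psi>_def by simp
    then have "(norm (F r - b))\<^sup>2 = (norm (F r\<^sub>0 - b))\<^sup>2"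
      using pos[OF r] pos[OF r0] by (subst (asm) ln_inj_iff) auto
    then show ?thesis by (rule power2_eq_imp_eq) simp_all
  qed
  then show False using radius_not_constant[OF min \<nu> tan b] by blast
qed

section \<open>Intersection of parabolic minimal hypersurfaces with $M$\<close>

text \<open>In a chart of $M$ a piece of $P$ is mapped injectively into a space of the same dimension, so its image is open by
  invariance of domain. Thus $P$ is open in $M$; it is also closed.\<close>

lemma hypersurface_eq_affine_subset:
  fixes M :: "(real^'n) set" and A :: "(real^'n, 'm::finite) chart set"
  assumes sm: "smooth_manifold (top_of_set M) A" and conn: "connected M"
    and P: "affine P" "aff_dim P = CARD('m)" "P \<subseteq> M" "P \<noteq> {}"
  shows "M = P"
proof -
  have "openin (top_of_set M) P"
  proof (subst openin_subopen, intro ballI)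
    fix p assume p: "p \<in> P"
    obtain c where c: "c \<in> A" "p \<in> fst c" "snd c p \<in> chart_image c" "chart_inv c (snd c p) = p"
      using chart_exists[OF sm, of p] p P by auto
    define S where "S = P \<inter> fst c"
    have op: "openin (top_of_set M) (fst c)" using smooth_manifold_chartD(1)[OF sm c(1)] .
    have "fst c \<subseteq> M" using openin_subset[OF op] by simp
    have "continuous_map (subtopology (top_of_set M) (fst c)) (top_of_set (chart_image c)) (snd c)"
      using smooth_manifold_chartD(3)[OF sm c(1)] by (rule homeomorphic_imp_continuous_map)
    then have "continuous_on (fst c) (snd c)"
      using \<open>fst c \<subseteq> M\<close> by (auto simp: subtopology_subtopology Int_absorb1 Int_absorb2 continuous_map_in_subtopology)
    then have cont: "continuous_on S (snd c)"
      by (rule continuous_on_subset) (simp add: S_def)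
    have inj: "inj_on (snd c) (fst c)"
      by (rule inj_on_inverseI[of _ "chart_inv c"]) (rule chart_inv_chart[OF sm c(1)])
    have "openin (top_of_set P) S"
    proof -
      obtain W where "open W" "fst c = M \<inter> W" using op by (auto simp: openin_open)
      then have "S = P \<inter> W" using P(3) by (auto simp: S_def)
      then show ?thesis using \<open>open W\<close> by (auto simp: openin_open)
    qed
    then have "openin (top_of_set UNIV) (snd c ` S)"
      by (rule invariance_of_domain_affine_sets[OF _ P(1) affine_UNIV])
        (use P(2) cont inj in \<open>auto simp: S_def inj_on_def\<close>)
    then have "open (snd c ` S)" by simp
    then have "openin (top_of_set M) {r \<in> fst c. snd c r \<in> snd c ` S}"
      by (rule open_chart_preimage[OF sm c(1)])
    moreover have "{r \<in> fst c. snd c r \<in> snd c ` S} = S"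
      using inj by (auto simp: S_def inj_on_def)
    ultimately show "\<exists>V. openin (top_of_set M) V \<and> p \<in> V \<and> V \<subseteq> P"
      using p c(2) by (intro exI[of _ S]) (auto simp: S_def)
  qed
  moreover have "closedin (top_of_set M) P"
    using closed_affine_hull[of P] P(1,3) by (simp add: closed_subset affine_hull_eq[THEN iffD2])
  ultimately show ?thesis
    using conn P(4) unfolding connected_clopen by blast
qed

theorem corollary2p2:
  fixes M :: "(real^'n) set"
    and A\<^sub>M :: "(real^'n, 'm::finite) chart set"
    and \<epsilon> :: real
    and T :: "'r topology"
    and A :: "('r, 'm) chart set"
    and F :: "'r \<Rightarrow> real^'n"
  assumes "CARD('n) \<ge> 3"
    and "properly_embedded_minimal_hypersurface M A\<^sub>M" and "connected M"
    and "\<epsilon> > 0"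
    and "\<And>x. infdist x M < \<epsilon> \<Longrightarrow> \<exists>!p. p \<in> M \<and> dist x p = infdist x M"
    and "immersed_minimal_hypersurface T A F" and "connected_space T"
    and "parabolic T A (induced_metric F)"
  shows "F ` topspace T \<inter> M \<noteq> {} \<or>
    (CARD('n) = 3 \<and> affine M \<and> aff_dim M = 2 \<and>
     (\<exists>P. affine_parallel M P \<and> F ` topspace T \<subseteq> P))"
proof (cases "F ` topspace T \<inter> M = {}")
  case False
  then show ?thesis by blast
next
  case True
  note M = assms(2) and min = assms(6) and par = assms(8)
  have un: "unique_nearest_points M \<epsilon>"
    using assms(5) by (simp add: unique_nearest_points_def)
  have cl: "closed M" and smM: "smooth_manifold (top_of_set M) A\<^sub>M"
    and card: "CARD('n) = CARD('m) + 1" and neT: "topspace T \<noteq> {}"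
    using M min by (auto simp: properly_embedded_minimal_hypersurface_def immersed_minimal_hypersurface_def)
  obtain v t where t: "0 < t" "t < \<epsilon>" and dist: "\<And>r. r \<in> topspace T \<Longrightarrow> infdist (F r - v) M = t"
    using exists_translation_at_constant_distance[OF M un assms(4) min par True] by blast
  obtain \<nu> where \<nu>: "norm \<nu> = 1" and foot: "\<And>r. r \<in> topspace T \<Longrightarrow> F r - v - t *\<^sub>R \<nu> \<in> M"
    using common_nearest_direction[OF M un min par t dist] by blast
  have \<nu>\<nu>: "\<nu> \<bullet> \<nu> = 1" using \<nu> by (simp add: norm_eq_1)
  have tan: "frechet_derivative (F \<circ> chart_inv c) (at y) u \<bullet> \<nu> = 0" if "c \<in> A" "y \<in> chart_image c" for c y u
    by (rule tangent_orthogonal_to_common_direction[OF min t(1) dist \<nu> foot that])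
  obtain r\<^sub>0 where r0: "r\<^sub>0 \<in> topspace T" using neT by blast
  define \<beta> where "\<beta> = F r\<^sub>0 \<bullet> \<nu>"
  have plane: "F r \<bullet> \<nu> = \<beta>" if "r \<in> topspace T" for r
    unfolding \<beta>_def by (rule image_in_hyperplane[OF min assms(7) tan r0 that])
  have "CARD('m) < 3"
    by (rule parabolic_in_hyperplane_dim[OF min par \<nu> tan, of "F r\<^sub>0"]) (simp_all add: plane r0 inner_diff_left)
  then have m: "CARD('m) = 2" using card assms(1) by simp
  define a where "a = v + t *\<^sub>R \<nu>"
  define P where "P = {z. \<nu> \<bullet> z = \<beta> - \<nu> \<bullet> a}"
  have PM: "P \<subseteq> M"
  proof
    fix z assume z: "z \<in> P"
    have "\<exists>y\<in>M. dist y z < e" if "e > 0" for e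
    proof -
      have "(F r - (z + a)) \<bullet> \<nu> = 0" if "r \<in> topspace T" for r
        using z plane[OF that] by (simp add: P_def inner_diff_right inner_add_right inner_commute[of _ \<nu>])
      then obtain r where r: "r \<in> topspace T" "norm (F r - (z + a)) < e"
        using parabolic_dense_in_plane[OF min par m \<nu> tan _ \<open>e > 0\<close>] by blast
      then have "dist (F r - v - t *\<^sub>R \<nu>) z < e" by (simp add: dist_norm a_def algebra_simps)
      then show ?thesis using foot[OF r(1)] by blast
    qed
    then have "z \<in> closure M" by (simp add: closure_approachable)
    then show "z \<in> M" using cl by simp
  qed
  have "\<nu> \<noteq> 0" using \<nu> by auto
  have affP: "affine P" unfolding P_def by (rule affine_hyperplane)
  have "aff_dim P = DIM(real^'n) - 1"
    unfolding P_def by (rule aff_dim_hyperplane[OF \<open>\<nu> \<noteq> 0\<close>])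
  then have dimP: "aff_dim P = 2" using card m by simp
  then have "P \<noteq> {}" by auto
  then have MP: "M = P"
    using hypersurface_eq_affine_subset[OF smM assms(3) affP _ PM] dimP m by simp
  have shift: "(\<lambda>x. a + x) ` P = {z. \<nu> \<bullet> z = \<beta>}"
  proof
    show "{z. \<nu> \<bullet> z = \<beta>} \<subseteq> (\<lambda>x. a + x) ` P"
    proof
      fix z assume "z \<in> {z. \<nu> \<bullet> z = \<beta>}"
      then have "z - a \<in> P" by (simp add: P_def inner_diff_right)
      then show "z \<in> (\<lambda>x. a + x) ` P" by (rule rev_image_eqI) simp
    qed
  qed (auto simp: P_def inner_add_right)
  then have "affine_parallel M {z. \<nu> \<bullet> z = \<beta>}"
    unfolding affine_parallel_def MP by metis
  moreover have "F ` topspace T \<subseteq> {z. \<nu> \<bullet> z = \<beta>}"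
    using plane by (auto simp: inner_commute)
  moreover have "CARD('n) = 3" using card m by simp
  ultimately show ?thesis
    using affP dimP MP by blast
qed

end
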